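(* Let $\delta>0$, $\eta>0$, $n=\lceil\delta\rceil$, and let $\nu\in(0,1)$ be such that $\nu r\in(0,1)$ for all $r=1,\dots,n$. Let $v(x,t)=\mathbb{P}({}_\eta\mathfrak{V}_t^{\nu,\delta}\in\mathrm dx)/\mathrm dx$ be the probability density function of ${}_\eta\mathfrak{V}_t^{\nu,\delta}$. Then $v$ satisfies $$\frac{\mathrm d}{\mathrm dt}v(x,t)=-\,{}_\eta\Theta_x^{\nu,\delta}v(x,t),\qquad x\ge0,\ t\ge0,$$ where $${}_\eta\Theta_x^{\nu,\delta}f(x,t)=\int_0^\infty\left(f(x,t)-f(x-y,t)\right)m(\mathrm dy)$$ and $m$ is the Lévy measure of ${}_\eta\mathfrak{V}^{\nu,\delta}$. Moreover $${}_\eta\Theta_x^{\nu,\delta}=\mathbf{D}^{\delta}_{\nu,\nu\delta,-\eta;0+}-\eta^\delta,$$ where $\mathbf{D}^{\delta}_{\nu,\nu\delta,-\eta;0+}$ is the Prabhakar derivative (acting in the variable $x$), and thus $$\int_0^\infty e^{-\mu x}\,{}_\eta\Theta_x^{\nu,\delta}v(x,t)\,\mathrm dx=\left[(\mu^\nu+\eta)^\delta-\eta^\delta\right]\tilde v(\mu,t),$$ where $\tilde v(\mu,t)=\int_0^\infty e^{-\mu x}v(x,t)\,\mathrm dx$.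
   Context: A subordinator is a process $S_t$, $t\ge 0$, starting from zero, with increasing paths and with independent and stationary increments; its Laplace exponent $\Phi$ is defined by $\mathbb{E}e^{-\mu S_t}=e^{-t\Phi(\mu)}$, and its Lévy measure is the measure $m$ in the representation $\Phi(\mu)=b\mu+\int_0^\infty(1-e^{-\mu x})m(\mathrm dx)$, $b\ge0$. For $\beta\in(0,1)$, a $\beta$-stable subordinator $V_t^\beta$ has Laplace exponent $\mu^\beta$. For $n\in\mathbb{N}$, $\eta>0$, $\nu r\in(0,1)$, $r=1,\dots,n$, let $V^{\nu r}_t$ be independent $\nu r$-stable subordinators and ${}_\eta\mathcal{V}_t^{\nu,n}=\sum_{r=1}^n\binom{n}{r}^{1/(\nu r)}\eta^{(n-r)/(\nu r)}V_t^{\nu r}$. For $\delta>0$ with $\lceil\delta\rceil=n$, let $\mathscr{V}_t^{\delta/n}$ be a tempered $\delta/n$-stable subordinator, independent of the $V^{\nu r}$, with Laplace exponent $(\eta^n+\mu)^{\delta/n}-\eta^\delta$. Define ${}_\eta\mathfrak{V}_t^{\nu,\delta}={}_\eta\mathcal{V}^{\nu,n}_{\mathscr{V}_t^{\delta/n}}$. It is a subordinator with Laplace exponent $(\eta+\mu^\nu)^\delta-\eta^\delta$ and Lévy measure $$m(\mathrm dx)=\int_0^\infty e^{-\eta^n t}\,\mathbb{P}\left({}_\eta\mathcal{V}_t^{\nu,n}\in \mathrm dx\right)\frac{\delta}{n}\,\frac{t^{-(1+\delta/n)}}{\Gamma(1-\delta/n)}\,\mathrm dt .$$ Since the process is nonnegative,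 $v(x,t)=0$ for $x<0$. The Riemann–Liouville derivative of order $\beta>0$ is $(D_{0+}^\beta f)(x)=\frac{1}{\Gamma(k-\beta)}\frac{\mathrm d^k}{\mathrm dx^k}\int_0^x\frac{f(y)}{(x-y)^{\beta-k+1}}\,\mathrm dy$, $k=[\beta]+1$. The generalized Mittag-Leffler function is $E_{\kappa,\varpi}^{\gamma}(x)=\sum_{r=0}^\infty\frac{x^r(\gamma)_r}{r!\,\Gamma(\kappa r+\varpi)}$, $\kappa,\varpi,\gamma\in\mathbb{C}$, $\Re(\kappa)>0$, with $(\gamma)_r$ the Pochhammer symbol. The Prabhakar derivative is defined, for a suitable set of functions $f$, by $$\mathbf{D}_{\alpha,a,\zeta;0+}^{\xi}f(x)=D_{0+}^{a+\theta}\int_0^x(x-y)^{\theta-1}E_{\alpha,\theta}^{-\xi}\left[\zeta(x-y)^\alpha\right]f(y)\,\mathrm dy,$$ with $\theta,a\in\mathbb{C}$, $\Re(\theta)>0$, $\Re(a)>0$, $\zeta\in\mathbb{C}$; its Laplace transform is $s^{a}(1-\zeta s^{-\alpha})^{\xi}\tilde f(s)$, $s>0$, where $\tilde f$ is the Laplace transform of $f$.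
   Formalization: Stated for t>0 rather than t≥0, since at t=0 the process is 0 and has no density; the identity of Θ with the Prabhakar derivative is stated for x>0, on functions vanishing for x<0 and C¹ on [0,∞), with real θ>0. *)

theory Defs
  imports "HOL-Probability.Probability"
begin

section \<open>Subordinators\<close>

text \<open>Processes are functions of time and outcome; only times \<open>t \<ge> 0\<close> matter.
  No path regularity beyond monotonicity is required.\<close>

definition independent_increments :: "'a measure \<Rightarrow> (real \<Rightarrow> 'a \<Rightarrow> real) \<Rightarrow> bool" where
  "independent_increments M S \<longleftrightarrow>
     (\<forall>ts. sorted ts \<and> set ts \<subseteq> {0..} \<longrightarrow>
        prob_space.indep_vars M (\<lambda>_. borel)
          (\<lambda>i \<omega>. S (ts ! Suc i) \<omega> - S (ts ! i) \<omega>) {..<length ts - 1})"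

definition stationary_increments :: "'a measure \<Rightarrow> (real \<Rightarrow> 'a \<Rightarrow> real) \<Rightarrow> bool" where
  "stationary_increments M S \<longleftrightarrow>
     (\<forall>s\<ge>0. \<forall>t\<ge>0. distr M borel (\<lambda>\<omega>. S (s + t) \<omega> - S s \<omega>)
                    = distr M borel (\<lambda>\<omega>. S t \<omega> - S 0 \<omega>))"

definition subordinator :: "'a measure \<Rightarrow> (real \<Rightarrow> 'a \<Rightarrow> real) \<Rightarrow> bool" where
  "subordinator M S \<longleftrightarrow>
     (\<forall>t\<ge>0. S t \<in> borel_measurable M) \<and>
     (AE \<omega> in M. S 0 \<omega> = 0 \<and> mono_on {0..} (\<lambda>t. S t \<omega>)) \<and>
     independent_increments M S \<and> stationary_increments M S"

definition has_laplace_exponent ::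
    "'a measure \<Rightarrow> (real \<Rightarrow> 'a \<Rightarrow> real) \<Rightarrow> (real \<Rightarrow> real) \<Rightarrow> bool" where
  "has_laplace_exponent M S \<Phi> \<longleftrightarrow>
     (\<forall>t\<ge>0. \<forall>\<mu>>0. (LINT \<omega>|M. exp (- \<mu> * S t \<omega>)) = exp (- t * \<Phi> \<mu>))"

definition stable_subordinator :: "'a measure \<Rightarrow> real \<Rightarrow> (real \<Rightarrow> 'a \<Rightarrow> real) \<Rightarrow> bool" where
  "stable_subordinator M \<beta> S \<longleftrightarrow>
     subordinator M S \<and> has_laplace_exponent M S (\<lambda>\<mu>. \<mu> powr \<beta>)"

text \<open>The tempered \<open>\<delta>/n\<close>-stable subordinator; for \<open>\<delta> = n\<close> it is the pure drift \<open>t\<close>.\<close>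

definition tempered_stable_subordinator ::
    "'a measure \<Rightarrow> real \<Rightarrow> real \<Rightarrow> nat \<Rightarrow> (real \<Rightarrow> 'a \<Rightarrow> real) \<Rightarrow> bool" where
  "tempered_stable_subordinator M \<eta> \<delta> n S \<longleftrightarrow>
     subordinator M S \<and>
     has_laplace_exponent M S (\<lambda>\<mu>. (\<eta> ^ n + \<mu>) powr (\<delta> / real n) - \<eta> powr \<delta>)"

definition independent_processes ::
    "'a measure \<Rightarrow> (nat \<Rightarrow> real \<Rightarrow> 'a \<Rightarrow> real) \<Rightarrow> nat set \<Rightarrow> bool" where
  "independent_processes M Y I \<longleftrightarrow>
     prob_space.indep_vars M (\<lambda>_. PiM {0..} (\<lambda>_. borel))
       (\<lambda>i \<omega>. restrict (\<lambda>t. Y i t \<omega>) {0..}) I"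

definition stable_sum ::
    "real \<Rightarrow> real \<Rightarrow> nat \<Rightarrow> (nat \<Rightarrow> real \<Rightarrow> 'a \<Rightarrow> real) \<Rightarrow> real \<Rightarrow> 'a \<Rightarrow> real" where
  "stable_sum \<eta> \<nu> n V t \<omega> =
     (\<Sum>r=1..n. real (n choose r) powr (1 / (\<nu> * real r))
              * \<eta> powr (real (n - r) / (\<nu> * real r)) * V r t \<omega>)"

definition time_changed ::
    "(real \<Rightarrow> 'a \<Rightarrow> real) \<Rightarrow> (real \<Rightarrow> 'a \<Rightarrow> real) \<Rightarrow> real \<Rightarrow> 'a \<Rightarrow> real" where
  "time_changed Y T t \<omega> = Y (T t \<omega>) \<omega>"

text \<open>The measure on the open half-line in the representation of the Laplace exponent; it is
  encoded as a Borel measure on the reals that does not charge the nonpositive numbers.\<close>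

definition is_levy_measure :: "'a measure \<Rightarrow> (real \<Rightarrow> 'a \<Rightarrow> real) \<Rightarrow> real measure \<Rightarrow> bool" where
  "is_levy_measure M S m \<longleftrightarrow>
     sets m = sets borel \<and> emeasure m {..0} = 0 \<and>
     set_integrable m {0<..} (\<lambda>x. min 1 x) \<and>
     (\<exists>b\<ge>0. has_laplace_exponent M S (\<lambda>\<mu>. b * \<mu> + (LINT x:{0<..}|m. 1 - exp (- \<mu> * x))))"

section \<open>Densities\<close>

text \<open>A density is determined only almost everywhere, whereas the equations for it are
  pointwise: the density is taken to be its continuous version, which is unique.\<close>

definition is_continuous_pdf :: "'a measure \<Rightarrow> ('a \<Rightarrow> real) \<Rightarrow> (real \<Rightarrow> real) \<Rightarrow> bool" where
  "is_continuous_pdf M X f \<longleftrightarrow>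
     continuous_on UNIV f \<and> (\<forall>x. 0 \<le> f x) \<and> distributed M lborel X (\<lambda>x. ennreal (f x))"

definition pdf :: "'a measure \<Rightarrow> ('a \<Rightarrow> real) \<Rightarrow> real \<Rightarrow> real" where
  "pdf M X = (THE f. is_continuous_pdf M X f)"

section \<open>Operators in the space variable\<close>

definition Theta :: "real measure \<Rightarrow> (real \<Rightarrow> real) \<Rightarrow> real \<Rightarrow> real" where
  "Theta m f x = (LINT y:{0<..}|m. f x - f (x - y))"

definition laplace_transform :: "(real \<Rightarrow> real) \<Rightarrow> real \<Rightarrow> real" where
  "laplace_transform f \<mu> = (LBINT x:{0..}. exp (- \<mu> * x) * f x)"

definition RL_derivative :: "real \<Rightarrow> (real \<Rightarrow> real) \<Rightarrow> real \<Rightarrow> real" where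
  "RL_derivative \<beta> f x =
     (let k = nat \<lfloor>\<beta>\<rfloor> + 1 in
        1 / Gamma (real k - \<beta>) *
        (deriv ^^ k) (\<lambda>z. LBINT y:{0..z}. f y / (z - y) powr (\<beta> - real k + 1)) x)"

text \<open>At a pole of the Gamma function both \<open>Gamma\<close> and division by it give \<open>0\<close>,
  which is the usual convention \<open>1 / \<Gamma> = 0\<close> there.\<close>

definition prabhakar_E :: "'a::Gamma \<Rightarrow> 'a \<Rightarrow> 'a \<Rightarrow> 'a \<Rightarrow> 'a" where
  "prabhakar_E \<kappa> \<omega> \<gamma> x =
     (\<Sum>r. x ^ r * pochhammer \<gamma> r / (fact r * Gamma (\<kappa> * of_nat r + \<omega>)))"

text \<open>The parameter \<open>\<theta>\<close> is auxiliary and does not occur in the usual notation. It is real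
  because the Riemann-Liouville derivative of order \<open>a + \<theta>\<close> needs a real order.\<close>

definition prabhakar_derivative ::
    "real \<Rightarrow> real \<Rightarrow> real \<Rightarrow> real \<Rightarrow> real \<Rightarrow> (real \<Rightarrow> real) \<Rightarrow> real \<Rightarrow> real" where
  "prabhakar_derivative \<theta> \<alpha> a \<zeta> \<xi> f =
     RL_derivative (a + \<theta>)
       (\<lambda>x. LBINT y:{0..x}. (x - y) powr (\<theta> - 1)
              * prabhakar_E \<alpha> \<theta> (- \<xi>) (\<zeta> * (x - y) powr \<alpha>) * f y)"

text \<open>Domain of the operators: continuously differentiable on the closed half-line
  (one-sided at \<open>0\<close>, and with no condition on \<open>f 0\<close>), zero to its left.\<close>

definition half_line_C1 :: "(real \<Rightarrow> real) set" where
  "half_line_C1 =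
     {f. (\<forall>x<0. f x = 0) \<and>
         (\<exists>f'. continuous_on {0..} f' \<and>
               (\<forall>x\<ge>0. (f has_real_derivative f' x) (at x within {0..})))}"

end

theory Submission
  imports Defs "HOL-Complex_Analysis.Complex_Analysis" "HOL-Real_Asymp.Real_Asymp"
begin

text \<open>
  Conditioning on the tempered subordinator gives \<open>X\<^sub>t\<close> the Laplace exponent
  \<open>\<Phi>(s) = (\<eta> + s\<^sup>\<nu>)\<^sup>\<delta> - \<eta>\<^sup>\<delta>\<close>. Both sides of \<open>E exp(-s X\<^sub>t) = exp(-t \<Phi>(s))\<close> and of
  \<open>\<Phi>(s) = \<integral> (1 - exp(-s y)) m(dy)\<close> (the drift vanishes because \<open>\<Phi>\<close> is sublinear) are
  holomorphic in the right half-plane and extend continuously to the imaginary axis. There \<open>Re \<Phi>\<close>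
  grows like \<open>|\<xi>|\<^sup>\<nu>\<^sup>\<delta>\<close>, so Fourier inversion yields a smooth density; differentiating it in time
  multiplies the integrand by \<open>-\<Phi>(-i\<xi>)\<close>, and by Fubini so does \<open>-\<Theta>\<close>.

  For the Prabhakar derivative, let \<open>e\<^sub>\<theta>(u) = u\<^sup>\<theta>\<^sup>-\<^sup>1 E(-\<eta> u\<^sup>\<nu>)\<close> with \<open>E\<close> of parameters
  \<open>(\<nu>, \<theta>, -\<delta>)\<close>. Its Laplace transform is \<open>s\<^sup>-\<^sup>\<theta> (1 + \<eta> s\<^sup>-\<^sup>\<nu>)\<^sup>\<delta>\<close>. Uniqueness of Laplace transforms
  therefore shows that fractional integration of order \<open>\<beta>\<close> maps \<open>e\<^sub>\<theta>\<close> to \<open>e\<close> with index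
  \<open>\<theta> + \<beta>\<close>, and that \<open>e\<close> with index \<open>1 - \<nu>\<delta>\<close> equals \<open>\<eta>\<^sup>\<delta>\<close> plus the tail \<open>u \<mapsto> m(u, \<infinity>)\<close>.
  So the Prabhakar derivative of \<open>f\<close> is the derivative of the convolution of \<open>f\<close> with
  \<open>\<eta>\<^sup>\<delta> + m(u, \<infinity>)\<close>, and integration by parts turns the tail term into \<open>\<Theta> f\<close>.
\<close>

section \<open>Laplace transforms on the imaginary axis\<close>

text \<open>The hypotheses give Laplace transforms at positive reals only, while a smooth density
  needs the characteristic function. Boundary values link the two: the identity theorem carries an
  equality into the right half-plane, and dominated convergence along
  \<open>1 / (n + 1) + \<i> * \<xi>\<close> carries it to the axis, with the branch point
  \<open>0\<close> treated apart. The same passage reduces uniqueness of Laplace transforms to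
  uniqueness of characteristic functions. The condition \<open>\<nu> * \<delta> < 1\<close> acts
  three times: it keeps the argument of \<open>(\<eta> + z powr \<nu>) powr \<delta>\<close> below
  \<open>pi / 2\<close>, so that its real part grows; it makes the exponent sublinear; and it makes
  the index \<open>1 - \<nu> * \<delta>\<close> positive, so that the kernel is integrable at
  \<open>0\<close>. Uniqueness yields equalities almost everywhere. They suffice under a
  convolution, but a function of the domain may jump at \<open>0\<close>, and the resulting boundary
  term contains the tail of \<open>m\<close> at one given point. There the right continuity of the
  tail and the continuity of the kernel close the gap.\<close>

lemma has_field_derivative_integral_dominated:
  fixes f f' :: "'b::{real_normed_field, banach, second_countable_topology} \<Rightarrow> 'a \<Rightarrow> 'b"
  assumes e: "e > 0"
    and int: "\<And>y. y \<in> ball x e \<Longrightarrow> integrable M (f y)"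
    and der: "\<And>y \<omega>. y \<in> ball x e \<Longrightarrow> ((\<lambda>y. f y \<omega>) has_field_derivative f' y \<omega>) (at y)"
    and meas: "f' x \<in> borel_measurable M"
    and bd: "\<And>y \<omega>. y \<in> ball x e \<Longrightarrow> norm (f' y \<omega>) \<le> w \<omega>"
    and w: "integrable M w"
  shows "((\<lambda>y. integral\<^sup>L M (f y)) has_field_derivative integral\<^sup>L M (f' x)) (at x)"
proof -
  have x: "x \<in> ball x e" using e by simp
  have "((\<lambda>y. (integral\<^sup>L M (f y) - integral\<^sup>L M (f x)) / (y - x)) \<longlongrightarrow> integral\<^sup>L M (f' x))
      (at x within ball x e)"
    unfolding tendsto_at_iff_sequentially
  proof (intro allI impI)
    fix X assume X: "\<forall>i. X i \<in> ball x e - {x}" and lim: "X \<longlonglongrightarrow> x"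
    have "(\<lambda>i. \<integral>\<omega>. (f (X i) \<omega> - f x \<omega>) / (X i - x) \<partial>M) \<longlonglongrightarrow> integral\<^sup>L M (f' x)"
    proof (rule integral_dominated_convergence[where w=w])
      show "(\<lambda>\<omega>. (f (X i) \<omega> - f x \<omega>) / (X i - x)) \<in> borel_measurable M" for i
      proof -
        have [measurable]: "f (X i) \<in> borel_measurable M" "f x \<in> borel_measurable M"
          using int[of "X i"] int[OF x] X by auto
        show ?thesis by simp
      qed
      show "AE \<omega> in M. (\<lambda>i. (f (X i) \<omega> - f x \<omega>) / (X i - x)) \<longlonglongrightarrow> f' x \<omega>"
      proof (intro AE_I2)
        fix \<omega>
        have "((\<lambda>y. (f y \<omega> - f x \<omega>) / (y - x)) \<longlongrightarrow> f' x \<omega>) (at x within UNIV)"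
          using der[OF x, of \<omega>] by (simp add: has_field_derivative_iff)
        then show "(\<lambda>i. (f (X i) \<omega> - f x \<omega>) / (X i - x)) \<longlonglongrightarrow> f' x \<omega>"
          unfolding tendsto_at_iff_sequentially using X lim by (auto simp: comp_def)
      qed
      show "AE \<omega> in M. norm ((f (X i) \<omega> - f x \<omega>) / (X i - x)) \<le> w \<omega>" for i
      proof (intro AE_I2)
        fix \<omega>
        \<comment> \<open>The mean value inequality on the convex ball turns the bound on the
          derivative into one on the difference quotients. It holds over any normed field, so one
          lemma serves complex and real parameters.\<close>
        have "norm (f (X i) \<omega> - f x \<omega>) \<le> w \<omega> * norm (X i - x)"
        proof (rule field_differentiable_bound[OF convex_ball[of x e]])
          show "((\<lambda>y. f y \<omega>) has_field_derivative f' y \<omega>) (at y within ball x e)" if "y \<in> ball x e" for y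
            using der[OF that] by (rule has_field_derivative_at_within)
        qed (use X x bd in auto)
        then show "norm ((f (X i) \<omega> - f x \<omega>) / (X i - x)) \<le> w \<omega>"
          using X by (auto simp: norm_divide divide_simps)
      qed
    qed (use meas w in auto)
    moreover have "(\<integral>\<omega>. (f (X i) \<omega> - f x \<omega>) / (X i - x) \<partial>M)
        = (integral\<^sup>L M (f (X i)) - integral\<^sup>L M (f x)) / (X i - x)" for i
      using Bochner_Integration.integral_diff[OF int[of "X i"] int[OF x]] X by (simp del: Bochner_Integration.integral_diff)
    ultimately show "((\<lambda>y. (integral\<^sup>L M (f y) - integral\<^sup>L M (f x)) / (y - x)) \<circ> X)
        \<longlonglongrightarrow> integral\<^sup>L M (f' x)"
      unfolding comp_def by (simp only:)
  qed
  then show ?thesis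
    using x by (simp add: has_field_derivative_iff at_within_open[OF _ open_ball])
qed

text \<open>A Levy measure integrates the weight \<open>min 1 x\<close>. For large \<open>x\<close>
  the left side is at most \<open>2\<close>; for small \<open>x\<close> the mean value inequality
  along the ray of nonnegative reals gives \<open>norm z * x\<close>. The constant
  \<open>2 + norm z\<close> dominates both.\<close>

lemma norm_exp_diff_le:
  fixes z :: complex and x :: real
  assumes "Re z \<ge> 0" "x \<ge> 0"
  shows "norm (1 - exp (- z * x)) \<le> (2 + norm z) * min 1 x"
proof -
  have "norm (exp (- z * x)) \<le> 1" using assms by simp
  then have "norm (1 - exp (- z * x)) \<le> 2"
    using norm_triangle_ineq4[of 1 "exp (- z * x)"] unfolding norm_one by linarith
  also have "\<dots> \<le> 2 + norm z" by simp
  finally have 1: "norm (1 - exp (- z * x)) \<le> (2 + norm z) * 1" by simp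
  have "norm (exp (- z * of_real x) - exp (- z * of_real 0)) \<le> norm z * norm (of_real x - of_real 0 :: complex)"
  proof (rule field_differentiable_bound[where S = "of_real ` {0..}" and f' = "\<lambda>w. - z * exp (- z * w)"])
    show "convex (complex_of_real ` {0..})"
      by (intro convex_linear_image) (auto simp: linear_iff scaleR_conv_of_real)
    show "norm (- z * exp (- z * w)) \<le> norm z" if "w \<in> of_real ` {0..}" for w
    proof -
      have "norm (exp (- z * w)) \<le> 1" using that assms by auto
      then show ?thesis by (simp add: norm_mult mult_left_le)
    qed
  qed (use assms in \<open>auto intro!: derivative_eq_intros\<close>)
  then have "norm (1 - exp (- z * x)) \<le> norm z * x" using assms by (simp add: norm_minus_commute)
  also have "\<dots> \<le> (2 + norm z) * x" using assms by (intro mult_right_mono) auto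
  finally show ?thesis using 1 assms by (cases "1 \<le> x") (auto simp: min_def)
qed

lemma mult_exp_neg_le:
  fixes s x :: real
  assumes "s > 0" "x \<ge> 0"
  shows "x * exp (- s * x) \<le> (1 + 1 / s) * min 1 x"
proof -
  have "s * x \<le> exp (s * x)" using exp_ge_add_one_self[of "s * x"] by linarith
  then have "x * exp (- s * x) \<le> 1 / s" using assms by (simp add: exp_minus field_simps)
  moreover have "x * exp (- s * x) \<le> x" using assms by (simp add: mult_left_le)
  moreover have "x \<le> (1 + 1 / s) * x" using assms by (simp add: field_simps)
  ultimately show ?thesis using assms by (auto simp: min_def)
qed

text \<open>Two cases are covered at once: \<open>a = 1\<close> for a Levy measure,
  \<open>a = 0\<close> for a finite measure. On a disc of radius \<open>Re z / 2\<close> the real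
  part stays above \<open>Re z / 2\<close>, so the derivative \<open>x * exp (- z * x)\<close> is
  dominated there by one multiple of \<open>min 1 x\<close>.\<close>

lemma holomorphic_on_laplace_integral:
  fixes N :: "real measure" and a :: complex
  assumes [measurable_cong, simp]: "sets N = sets borel"
    and w: "integrable N (\<lambda>x. indicator {0..} x * min 1 x)"
    and int: "\<And>z. Re z > 0 \<Longrightarrow> integrable N (\<lambda>x. indicator {0..} x *\<^sub>R (a - exp (- z * of_real x)))"
  shows "(\<lambda>z. \<integral>x. indicator {0..} x *\<^sub>R (a - exp (- z * of_real x)) \<partial>N) holomorphic_on {z. Re z > 0}"
proof -
  have "(\<lambda>z. \<integral>x. indicator {0..} x *\<^sub>R (a - exp (- z * of_real x)) \<partial>N) field_differentiable (at z)"
    if z: "Re z > 0" for z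
    unfolding field_differentiable_def
  proof (intro exI, rule has_field_derivative_integral_dominated[where e = "Re z / 2"
        and f' = "\<lambda>z x. indicator {0..} x *\<^sub>R (of_real x * exp (- z * of_real x))"
        and w = "\<lambda>x. (1 + 1 / (Re z / 2)) * (indicator {0..} x * min 1 x)"])
    have Re: "Re z / 2 \<le> Re y" if "y \<in> ball z (Re z / 2)" for y
    proof -
      have "\<bar>Re (z - y)\<bar> < Re z / 2"
        using abs_Re_le_cmod[of "z - y"] that by (simp add: dist_norm)
      then show ?thesis unfolding minus_complex.sel by linarith
    qed
    show "Re z / 2 > 0" using z by simp
    show "integrable N (\<lambda>x. indicator {0..} x *\<^sub>R (a - exp (- y * of_real x)))" if "y \<in> ball z (Re z / 2)" for y
      using int[of y] Re[OF that] z by auto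
    show "(\<lambda>x. indicator {0..} x *\<^sub>R (of_real x * exp (- z * of_real x))) \<in> borel_measurable N"
      by measurable
    show "norm (indicator {0..} x *\<^sub>R (of_real x * exp (- y * of_real x)))
        \<le> (1 + 1 / (Re z / 2)) * (indicator {0..} x * min 1 x)" if y: "y \<in> ball z (Re z / 2)" for y x
    proof (cases "x \<ge> 0")
      case True
      have "norm (of_real x * exp (- y * of_real x)) = x * exp (- Re y * x)"
        using True by (simp add: norm_mult)
      also have "\<dots> \<le> x * exp (- (Re z / 2) * x)"
        using True mult_right_mono[OF Re[OF y] True] by (intro mult_left_mono) simp_all
      also have "\<dots> \<le> (1 + 1 / (Re z / 2)) * min 1 x"
        using True z by (intro mult_exp_neg_le) auto
      finally show ?thesis using True by simp
    qed auto
    show "((\<lambda>y. indicator {0..} x *\<^sub>R (a - exp (- y * of_real x))) has_field_derivative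
       indicator {0..} x *\<^sub>R (of_real x * exp (- y * of_real x))) (at y)" for y x
      by (auto intro!: derivative_eq_intros simp: scaleR_conv_of_real)
    show "integrable N (\<lambda>x. (1 + 1 / (Re z / 2)) * (indicator {0..} x * min 1 x))"
      using w by (intro integrable_mult_right)
  qed
  then show ?thesis
    by (auto simp: holomorphic_on_def intro: field_differentiable_at_within)
qed

text \<open>Identity theorem: the positive reals accumulate at \<open>1\<close>, inside the
  connected half-plane.\<close>

lemma right_half_plane_eqI:
  fixes F G :: "complex \<Rightarrow> complex"
  assumes F: "F holomorphic_on {z. Re z > 0}" and G: "G holomorphic_on {z. Re z > 0}"
    and eq: "\<And>s. s > 0 \<Longrightarrow> F (of_real s) = G (of_real s)" and z: "Re z > 0"
  shows "F z = G z"
proof -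
  have "F z - G z = 0"
  proof (rule analytic_continuation[where S = "{z. Re z > 0}" and U = "of_real ` {0<..}" and \<xi> = 1
        and f = "\<lambda>z. F z - G z" and w = z])
    show "(\<lambda>z. F z - G z) holomorphic_on {z. Re z > 0}" by (rule holomorphic_on_diff[OF F G])
    show "open {z. Re z > 0}" by (rule open_halfspace_Re_gt)
    show "connected {z. Re z > 0}" by (intro convex_connected convex_halfspace_Re_gt)
    have "(\<lambda>n. complex_of_real (1 + inverse (real (Suc n)))) \<longlonglongrightarrow> of_real (1 + 0)"
      by (intro tendsto_intros LIMSEQ_inverse_real_of_nat)
    moreover have "complex_of_real (1 + inverse (real (Suc n))) \<in> of_real ` {0<..} - {1}" for n
    proof -
      define r where "r = 1 + inverse (real (Suc n))"
      have "inverse (real (Suc n)) > 0" by simp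
      then have "r > 0" "r \<noteq> 1" unfolding r_def by linarith+
      then have "complex_of_real r \<in> of_real ` {0<..} - {1}" by simp
      then show ?thesis unfolding r_def .
    qed
    ultimately show "(1::complex) islimpt of_real ` {0<..}"
      unfolding islimpt_sequential
      by (intro exI[of _ "\<lambda>n. complex_of_real (1 + inverse (real (Suc n)))"] conjI allI) simp_all
  qed (use z eq in auto)
  then show ?thesis by simp
qed

lemma tendsto_imaginary_axis:
  "(\<lambda>n. complex_of_real (inverse (real (Suc n))) + of_real x * \<i>) \<longlonglongrightarrow> of_real x * \<i>"
proof -
  have "(\<lambda>n. complex_of_real (inverse (real (Suc n))) + of_real x * \<i>) \<longlonglongrightarrow> of_real 0 + of_real x * \<i>"
    by (intro tendsto_intros LIMSEQ_inverse_real_of_nat)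
  then show ?thesis by simp
qed

text \<open>The identity theorem extends \<open>eq\<close> to the open half-plane, and dominated
  convergence then reaches the axis. The conclusion is a limit along a horizontal sequence, so that
  \<open>F\<close> itself is evaluated in the open half-plane only. The weight \<open>w\<close> is
  \<open>min 1 x\<close> for a Levy measure and constant for a finite measure.\<close>

lemma laplace_integral_boundary_value:
  fixes N :: "real measure" and a :: complex and w :: "real \<Rightarrow> real"
  assumes N [measurable_cong, simp]: "sets N = sets borel"
    and w: "integrable N (\<lambda>x. indicator {0..} x * w x)"
    and w_ge: "\<And>x. x \<ge> 0 \<Longrightarrow> min 1 x \<le> w x"
    and bd: "\<And>z x. Re z \<ge> 0 \<Longrightarrow> x \<ge> 0 \<Longrightarrow> norm (a - exp (- z * of_real x)) \<le> (2 + norm z) * w x"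
    and F: "F holomorphic_on {z. Re z > 0}"
    and eq: "\<And>s. s > 0 \<Longrightarrow>
      (\<integral>x. indicator {0..} x *\<^sub>R (a - exp (- of_real s * of_real x)) \<partial>N) = F (of_real s)"
  shows "(\<lambda>n. F (of_real (inverse (real (Suc n))) + of_real \<xi> * \<i>))
    \<longlonglongrightarrow> (\<integral>x. indicator {0..} x *\<^sub>R (a - exp (- (of_real \<xi> * \<i>) * of_real x)) \<partial>N)"
proof -
  have bd': "norm (indicator {0..} x *\<^sub>R (a - exp (- z * of_real x)))
      \<le> (2 + norm z) * (indicator {0..} x * w x)" if "Re z \<ge> 0" for z x
    using bd[OF that, of x] by (auto simp: indicator_def)
  have int: "integrable N (\<lambda>x. indicator {0..} x *\<^sub>R (a - exp (- z * of_real x)))" if "Re z > 0" for z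
  proof (rule Bochner_Integration.integrable_bound)
    show "integrable N (\<lambda>x. (2 + norm z) * (indicator {0..} x * w x))"
      using w by (rule integrable_mult_right)
    show "AE x in N. norm (indicator {0..} x *\<^sub>R (a - exp (- z * of_real x)))
      \<le> norm ((2 + norm z) * (indicator {0..} x * w x))"
    proof (intro AE_I2)
      fix x
      show "norm (indicator {0..} x *\<^sub>R (a - exp (- z * of_real x)))
          \<le> norm ((2 + norm z) * (indicator {0..} x * w x))"
        by (rule order_trans[OF bd' [OF less_imp_le[OF that]]]) simp
    qed
  qed measurable
  have min: "integrable N (\<lambda>x. indicator {0..} x * min 1 x)"
  proof (rule Bochner_Integration.integrable_bound[OF w])
    show "AE x in N. norm (indicator {0..} x * min 1 x) \<le> norm (indicator {0..} x * w x)"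
    proof (intro AE_I2)
      fix x show "norm (indicator {0..} x * min 1 x) \<le> norm (indicator {0..} x * w x)"
      proof (cases "x \<ge> 0")
        case True
        then have "0 \<le> min 1 x" by simp
        with w_ge[OF True] True show ?thesis by simp
      qed simp
    qed
  qed measurable
  have F_eq: "F z = (\<integral>x. indicator {0..} x *\<^sub>R (a - exp (- z * of_real x)) \<partial>N)" if "Re z > 0" for z
    by (rule right_half_plane_eqI[OF F holomorphic_on_laplace_integral[OF N min int] _ that])
       (use eq in auto)
  let ?z = "\<lambda>n. of_real (inverse (real (Suc n))) + of_real \<xi> * \<i>"
  have Re: "Re (?z n) > 0" for n by simp
  have norm: "norm (?z n) \<le> 1 + \<bar>\<xi>\<bar>" for n
  proof -
    have "inverse (real (Suc n)) \<le> 1" by (simp add: field_simps)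
    then have "norm (complex_of_real (inverse (real (Suc n)))) \<le> 1"
      unfolding norm_of_real by simp
    then show ?thesis
      by (intro norm_triangle_mono) (simp_all add: norm_mult)
  qed
  have "(\<lambda>n. \<integral>x. indicator {0..} x *\<^sub>R (a - exp (- ?z n * of_real x)) \<partial>N)
    \<longlonglongrightarrow> (\<integral>x. indicator {0..} x *\<^sub>R (a - exp (- (of_real \<xi> * \<i>) * of_real x)) \<partial>N)"
  \<comment> \<open>Along the sequence \<open>norm z \<le> 1 + \<bar>\<xi>\<bar>\<close>, hence
    \<open>2 + norm z \<le> 3 + \<bar>\<xi>\<bar>\<close>.\<close>
  proof (rule integral_dominated_convergence[where w = "\<lambda>x. (3 + \<bar>\<xi>\<bar>) * (indicator {0..} x * w x)"])
    show "integrable N (\<lambda>x. (3 + \<bar>\<xi>\<bar>) * (indicator {0..} x * w x))"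
      using w by (rule integrable_mult_right)
    show "AE x in N. (\<lambda>n. indicator {0..} x *\<^sub>R (a - exp (- ?z n * of_real x)))
        \<longlonglongrightarrow> indicator {0..} x *\<^sub>R (a - exp (- (of_real \<xi> * \<i>) * of_real x))"
      by (intro AE_I2 tendsto_scaleR tendsto_const tendsto_diff tendsto_exp tendsto_mult tendsto_minus
          tendsto_imaginary_axis)
    show "AE x in N. norm (indicator {0..} x *\<^sub>R (a - exp (- ?z n * of_real x)))
        \<le> (3 + \<bar>\<xi>\<bar>) * (indicator {0..} x * w x)" for n
    proof (intro AE_I2)
      fix x
      have "0 \<le> indicator {0..} x * w x" using w_ge[of x] by (auto simp: indicator_def min_def split: if_splits)
      then have "(2 + norm (?z n)) * (indicator {0..} x * w x) \<le> (3 + \<bar>\<xi>\<bar>) * (indicator {0..} x * w x)"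
        using norm[of n] by (intro mult_right_mono) linarith+
      with bd'[OF less_imp_le[OF Re[of n]], of x]
      show "norm (indicator {0..} x *\<^sub>R (a - exp (- ?z n * of_real x)))
        \<le> (3 + \<bar>\<xi>\<bar>) * (indicator {0..} x * w x)" by (rule order_trans)
    qed
  qed measurable
  then show ?thesis unfolding F_eq[OF Re] .
qed

lemma finite_measure_laplace_boundary_value:
  fixes N :: "real measure"
  assumes "finite_measure N" and N [measurable_cong, simp]: "sets N = sets borel"
    and pos: "AE x in N. x \<ge> 0"
    and F: "F holomorphic_on {z. Re z > 0}"
    and eq: "\<And>s. s > 0 \<Longrightarrow> of_real (\<integral>x. exp (- s * x) \<partial>N) = F (of_real s)"
  shows "(\<lambda>n. F (of_real (inverse (real (Suc n))) + of_real \<xi> * \<i>))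
    \<longlonglongrightarrow> (\<integral>x. exp (- (of_real \<xi> * \<i>) * of_real x) \<partial>N)"
proof -
  interpret finite_measure N by fact
  have AE: "(\<integral>x. indicator {0..} x *\<^sub>R (0 - f x) \<partial>N) = - (\<integral>x. f x \<partial>N)"
    if [measurable]: "f \<in> borel_measurable borel" for f :: "real \<Rightarrow> complex"
  proof -
    have "(\<integral>x. indicator {0..} x *\<^sub>R (0 - f x) \<partial>N) = (\<integral>x. - f x \<partial>N)"
      by (intro integral_cong_AE) (use pos in auto)
    then show ?thesis by simp
  qed
  have "(\<lambda>n. - F (of_real (inverse (real (Suc n))) + of_real \<xi> * \<i>))
    \<longlonglongrightarrow> (\<integral>x. indicator {0..} x *\<^sub>R (0 - exp (- (of_real \<xi> * \<i>) * of_real x)) \<partial>N)"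
  proof (rule laplace_integral_boundary_value[where w = "\<lambda>_. 1"])
    show "integrable N (\<lambda>x. indicator {0..} x * (1::real))"
      by (intro integrable_const_bound[where B = 1]) auto
    show "(\<lambda>z. - F z) holomorphic_on {z. Re z > 0}" using F by (rule holomorphic_on_minus)
    show "norm (0 - exp (- z * of_real x)) \<le> (2 + norm z) * 1" if "Re z \<ge> 0" "x \<ge> 0" for z :: complex and x :: real
    proof -
      have "norm (exp (- z * of_real x)) \<le> 1" using that by simp
      also have "1 \<le> (2 + norm z) * 1" by simp
      finally show ?thesis by simp
    qed
    show "(\<integral>x. indicator {0..} x *\<^sub>R (0 - exp (- of_real s * of_real x)) \<partial>N) = - F (of_real s)" if "s > 0" for s
      by (subst AE) (simp_all flip: eq[OF that] integral_complex_of_real exp_of_real)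
  qed auto
  then have "(\<lambda>n. - F (of_real (inverse (real (Suc n))) + of_real \<xi> * \<i>))
    \<longlonglongrightarrow> - (\<integral>x. exp (- (of_real \<xi> * \<i>) * of_real x) \<partial>N)"
    by (subst (asm) AE) simp_all
  then show ?thesis by (rule tendsto_minus_cancel)
qed

text \<open>Both transforms have the same analytic extension \<open>F\<close>, so both
  characteristic functions are the boundary value of \<open>F\<close> at
  \<open>- \<xi> * \<i>\<close>. The sign comes from the Laplace kernel \<open>exp (- z * x)\<close>
  against the Fourier kernel \<open>exp (\<i> * \<xi> * x)\<close>.\<close>

lemma finite_measure_laplace_eqD:
  fixes N1 N2 :: "real measure"
  assumes N1: "finite_measure N1" "sets N1 = sets borel" "AE x in N1. x \<ge> 0"
    and N2: "finite_measure N2" "sets N2 = sets borel" "AE x in N2. x \<ge> 0"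
    and eq: "\<And>s. s > 0 \<Longrightarrow> (\<integral>x. exp (- s * x) \<partial>N1) = (\<integral>x. exp (- s * x) \<partial>N2)"
  shows "char N1 = char N2"
proof
  fix \<xi> :: real
  interpret N1: finite_measure N1 by fact
  note [measurable_cong] = N1(2)
  define F where "F = (\<lambda>z::complex. - (\<integral>x. indicator {0..} x *\<^sub>R (0 - exp (- z * of_real x)) \<partial>N1))"
  have F: "F holomorphic_on {z. Re z > 0}"
    unfolding F_def
  proof (intro holomorphic_on_minus holomorphic_on_laplace_integral)
    show "integrable N1 (\<lambda>x. indicator {0..} x * min 1 x)"
      by (intro N1.integrable_const_bound[where B = 1]) (auto simp: indicator_def min_def)
    show "integrable N1 (\<lambda>x. indicator {0..} x *\<^sub>R (0 - exp (- z * of_real x)))" if "Re z > 0" for z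
      using that by (intro N1.integrable_const_bound[where B = 1]) (auto simp: indicator_def)
  qed fact
  have F_eq: "F (of_real s) = of_real (\<integral>x. exp (- s * x) \<partial>N1)" if "s > 0" for s
  proof -
    have "F (of_real s) = - (\<integral>x. - of_real (exp (- s * x)) \<partial>N1)"
      unfolding F_def using N1(3) by (intro arg_cong[where f = uminus] integral_cong_AE) (auto simp flip: exp_of_real)
    then show ?thesis by simp
  qed
  show "char N1 \<xi> = char N2 \<xi>"
  proof (rule LIMSEQ_unique)
    show "(\<lambda>n. F (of_real (inverse (real (Suc n))) + of_real (- \<xi>) * \<i>)) \<longlonglongrightarrow> char N1 \<xi>"
      using finite_measure_laplace_boundary_value[OF N1 F F_eq[symmetric], of "- \<xi>"]
      by (simp add: char_def mult_ac)
    show "(\<lambda>n. F (of_real (inverse (real (Suc n))) + of_real (- \<xi>) * \<i>)) \<longlonglongrightarrow> char N2 \<xi>"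
      using finite_measure_laplace_boundary_value[OF N2 F, of "- \<xi>"] F_eq eq
      by (simp add: char_def mult_ac)
  qed
qed

section \<open>Uniqueness of Laplace transforms and convolution\<close>

text \<open>The positive and the negative part of \<open>h\<close> are made into probability
  densities, to which Levy's uniqueness theorem applies. Adding the bump \<open>g\<close> to both
  keeps the normalising constant \<open>C\<close> positive even for \<open>h = 0\<close>; the case
  \<open>s = 0\<close> says that the two masses agree, so one \<open>C\<close> serves both.\<close>

lemma AE_zero_if_laplace_zero:
  fixes h :: "real \<Rightarrow> real"
  assumes h: "integrable lborel h" and neg: "\<And>x. x < 0 \<Longrightarrow> h x = 0"
    and L: "\<And>s. s \<ge> 0 \<Longrightarrow> (\<integral>x. exp (- s * x) * h x \<partial>lborel) = 0"
  shows "AE x in lborel. h x = 0"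
proof -
  have hm [measurable]: "h \<in> borel_measurable borel" using h by auto
  define g :: "real \<Rightarrow> real" where "g = indicator {0..1}"
  have g [measurable]: "integrable lborel g" "g \<in> borel_measurable borel" unfolding g_def by auto
  define C where "C = (\<integral>x. max 0 (h x) + g x \<partial>lborel)"
  have pos: "integrable lborel (\<lambda>x. max 0 (h x))" using h by auto
  have neg': "integrable lborel (\<lambda>x. max 0 (- h x))" using h by auto
  have "(\<integral>x. h x \<partial>lborel) = 0" using L[of 0] by simp
  then have "(\<integral>x. max 0 (h x) \<partial>lborel) - (\<integral>x. max 0 (- h x) \<partial>lborel) = 0"
  proof -
    have "max 0 (h x) - max 0 (- h x) = h x" for x by (simp add: max_def)
    then show "(\<integral>x. h x \<partial>lborel) = 0 \<Longrightarrow> ?thesis"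
      using Bochner_Integration.integral_diff[OF pos neg'] by simp
  qed
  then have C2: "C = (\<integral>x. max 0 (- h x) + g x \<partial>lborel)"
    unfolding C_def using pos neg' g by simp
  have "C \<ge> (\<integral>x. g x \<partial>lborel)"
    unfolding C_def using pos g by (intro integral_mono) auto
  then have C: "C > 0" unfolding g_def by simp
  have real: "real_distribution (density lborel (\<lambda>x. ennreal ((f x + g x) / C)))"
    if f: "integrable lborel f" "\<And>x. f x \<ge> 0" "(\<integral>x. f x + g x \<partial>lborel) = C" for f
  proof -
    have [measurable]: "f \<in> borel_measurable borel" using f by auto
    have "emeasure (density lborel (\<lambda>x. ennreal ((f x + g x) / C))) UNIV = (\<integral>\<^sup>+x. ennreal ((f x + g x) / C) \<partial>lborel)"
      by (subst emeasure_density) auto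
    also have "\<dots> = ennreal (\<integral>x. (f x + g x) / C \<partial>lborel)"
      using f g C by (intro nn_integral_eq_integral) (auto simp: g_def)
    also have "\<dots> = 1" using f C by simp
    finally show ?thesis
      unfolding real_distribution_def real_distribution_axioms_def by (auto intro!: prob_spaceI)
  qed
  define N1 where "N1 = density lborel (\<lambda>x. ennreal ((max 0 (h x) + g x) / C))"
  define N2 where "N2 = density lborel (\<lambda>x. ennreal ((max 0 (- h x) + g x) / C))"
  have N: "real_distribution N1" "real_distribution N2"
    unfolding N1_def N2_def by (rule real[OF pos _ C_def[symmetric]] real[OF neg' _ C2[symmetric]], simp)+
  have AE: "AE x in density lborel (\<lambda>x. ennreal ((f x + g x) / C)). x \<ge> 0"
    if [measurable]: "f \<in> borel_measurable borel" and "\<And>x. x < 0 \<Longrightarrow> f x = 0" for f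
  proof (subst AE_density)
    show "AE x in lborel. 0 < ennreal ((f x + g x) / C) \<longrightarrow> x \<ge> 0"
    proof (intro AE_I2 impI)
      fix x assume "0 < ennreal ((f x + g x) / C)"
      then have "f x + g x \<noteq> 0" by (intro notI) simp
      moreover have "f x + g x = 0" if "x < 0"
        unfolding g_def using \<open>x < 0\<close> that by (simp add: \<open>\<And>x. x < 0 \<Longrightarrow> f x = 0\<close>)
      ultimately show "x \<ge> 0" by (meson not_le)
    qed
  qed measurable
  have "char N1 = char N2"
  proof (rule finite_measure_laplace_eqD)
    show "finite_measure N1" "finite_measure N2"
      using N by (simp_all add: real_distribution_def prob_space_def)
    show "sets N1 = sets borel" "sets N2 = sets borel" by (simp_all add: N1_def N2_def)
    show "AE x in N1. x \<ge> 0" "AE x in N2. x \<ge> 0"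
      unfolding N1_def N2_def by (rule AE; use neg in simp)+
    show "(\<integral>x. exp (- s * x) \<partial>N1) = (\<integral>x. exp (- s * x) \<partial>N2)" if s: "s > 0" for s
    proof -
      have int: "integrable lborel (\<lambda>x. exp (- s * x) * f x)"
        if f: "integrable lborel f" and "\<And>x. x < 0 \<Longrightarrow> f x = 0" for f :: "real \<Rightarrow> real"
      proof (rule Bochner_Integration.integrable_bound[OF f])
        have [measurable]: "f \<in> borel_measurable borel" using f by auto
        show "(\<lambda>x. exp (- s * x) * f x) \<in> borel_measurable lborel" by measurable
        show "AE x in lborel. norm (exp (- s * x) * f x) \<le> norm (f x)"
        proof (intro AE_I2)
          fix x show "norm (exp (- s * x) * f x) \<le> norm (f x)"
            using that(2)[of x] s by (cases "x < 0") (auto simp: abs_mult intro!: mult_left_le_one_le)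
        qed
      qed
      have *: "(\<integral>x. exp (- s * x) \<partial>density lborel (\<lambda>x. ennreal ((f x + g x) / C)))
          = ((\<integral>x. exp (- s * x) * f x \<partial>lborel) + (\<integral>x. exp (- s * x) * g x \<partial>lborel)) / C"
        if f: "integrable lborel f" "\<And>x. f x \<ge> 0" "\<And>x. x < 0 \<Longrightarrow> f x = 0" for f
      proof -
        have [measurable]: "f \<in> borel_measurable borel" using f by auto
        have "(\<integral>x. exp (- s * x) \<partial>density lborel (\<lambda>x. ennreal ((f x + g x) / C)))
          = (\<integral>x. ((f x + g x) / C) * exp (- s * x) \<partial>lborel)"
          using f C by (subst integral_density) (auto simp: g_def)
        also have "\<dots> = (\<integral>x. (exp (- s * x) * f x + exp (- s * x) * g x) / C \<partial>lborel)"
          by (intro Bochner_Integration.integral_cong) (auto simp: field_simps)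
        also have "\<dots> = ((\<integral>x. exp (- s * x) * f x \<partial>lborel) + (\<integral>x. exp (- s * x) * g x \<partial>lborel)) / C"
          using int[OF f(1,3)] int[OF g(1)] by (simp add: g_def)
        finally show ?thesis .
      qed
      have h2: "integrable lborel (\<lambda>x. exp (- s * x) * max 0 (h x))"
        "integrable lborel (\<lambda>x. exp (- s * x) * max 0 (- h x))"
        by (rule int[OF pos], use neg in simp) (rule int[OF neg'], use neg in simp)
      have "0 = (\<integral>x. exp (- s * x) * max 0 (h x) - exp (- s * x) * max 0 (- h x) \<partial>lborel)"
      proof -
        have "exp (- s * x) * max 0 (h x) - exp (- s * x) * max 0 (- h x) = exp (- s * x) * h x" for x
          by (simp add: max_def)
        then show ?thesis using L[of s] s by simp
      qed
      then have "(\<integral>x. exp (- s * x) * max 0 (h x) \<partial>lborel) = (\<integral>x. exp (- s * x) * max 0 (- h x) \<partial>lborel)"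
        unfolding Bochner_Integration.integral_diff[OF h2] by simp
      then show ?thesis
        unfolding N1_def N2_def using pos neg' neg by (subst (1 2) *) auto
    qed
  qed
  with N have "N1 = N2" by (intro Levy_uniqueness)
  then have "AE x in lborel. ennreal ((max 0 (h x) + g x) / C) = ennreal ((max 0 (- h x) + g x) / C)"
    unfolding N1_def N2_def by (subst (asm) sigma_finite_measure.density_unique_iff[OF lborel.sigma_finite_measure_axioms]) auto
  then show ?thesis
  proof eventually_elim
    case (elim x)
    then have "(max 0 (h x) + g x) / C = (max 0 (- h x) + g x) / C"
      using C by (subst (asm) ennreal_inj) (auto simp: g_def)
    then show ?case using C by (auto simp: max_def split: if_splits)
  qed
qed

text \<open>The weight \<open>exp (- c * x)\<close> makes the difference integrable and shifts the
  known range \<open>s \<ge> c\<close> to \<open>s \<ge> 0\<close>. Transforms known for large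
  \<open>s\<close> only, such as those of the Prabhakar kernels, are therefore enough.\<close>

lemma AE_eq_if_laplace_eq:
  fixes f g :: "real \<Rightarrow> real"
  assumes neg: "\<And>x. x < 0 \<Longrightarrow> f x = 0" "\<And>x. x < 0 \<Longrightarrow> g x = 0"
    and f: "\<And>s. s \<ge> c \<Longrightarrow> has_bochner_integral lborel (\<lambda>x. exp (- s * x) * f x) (L s)"
    and g: "\<And>s. s \<ge> c \<Longrightarrow> has_bochner_integral lborel (\<lambda>x. exp (- s * x) * g x) (L s)"
  shows "AE x in lborel. f x = g x"
proof -
  have "AE x in lborel. exp (- c * x) * (f x - g x) = 0"
  proof (rule AE_zero_if_laplace_zero)
    have diff: "has_bochner_integral lborel (\<lambda>x. exp (- s * x) * (f x - g x)) 0" if "s \<ge> c" for s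
      using has_bochner_integral_diff[OF f[OF that] g[OF that]] by (simp add: algebra_simps)
    show "integrable lborel (\<lambda>x. exp (- c * x) * (f x - g x))"
      using diff[of c] by (auto simp: has_bochner_integral_iff)
    show "(\<integral>x. exp (- s * x) * (exp (- c * x) * (f x - g x)) \<partial>lborel) = 0" if "s \<ge> 0" for s
    proof -
      have "exp (- s * x) * (exp (- c * x) * (f x - g x)) = exp (- (c + s) * x) * (f x - g x)" for x
      proof -
        have "exp (- (c + s) * x) = exp (- s * x) * exp (- c * x)"
          unfolding exp_add[symmetric] by (simp add: algebra_simps)
        then show ?thesis by (simp only: mult.assoc)
      qed
      then show ?thesis using diff[of "c + s"] that unfolding has_bochner_integral_iff by (simp only:)
    qed
  qed (use neg in auto)
  then show ?thesis by eventually_elim simp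
qed

text \<open>With integration over the whole line, commutativity and associativity come from
  translation and Fubini. For functions that vanish on the negative half-line this is the usual
  integral over \<open>{0..x}\<close>.\<close>

definition convolve :: "(real \<Rightarrow> real) \<Rightarrow> (real \<Rightarrow> real) \<Rightarrow> real \<Rightarrow> real" where
  "convolve f g x = (\<integral>y. f (x - y) * g y \<partial>lborel)"

lemma borel_measurable_convolution [measurable]:
  assumes [measurable]: "f \<in> borel_measurable borel" "g \<in> borel_measurable borel"
  shows "convolve f g \<in> borel_measurable borel"
  unfolding convolve_def by measurable

lemma convolution_commute: "convolve f g x = convolve g f x"
  unfolding convolve_def
  by (subst lborel_integral_real_affine[where c = "-1" and t = x]) (auto simp: mult.commute)

lemma convolution_cong_AE:
  assumes "AE x in lborel. f x = f' x"
    and [measurable]: "f \<in> borel_measurable borel" "f' \<in> borel_measurable borel" "g \<in> borel_measurable borel"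
  shows "convolve f g x = convolve f' g x"
  unfolding convolution_commute[of _ g] unfolding convolve_def
  by (intro integral_cong_AE) (use assms in auto)

lemma integrable_lborel_shift:
  "integrable lborel f \<Longrightarrow> integrable lborel (\<lambda>x. f (x - t))"
  for f :: "real \<Rightarrow> real"
  using lborel_integrable_real_affine[of f 1 "- t"] by simp

lemma integral_lborel_shift:
  "(\<integral>x. f (x - t) \<partial>lborel) = (\<integral>x. f x \<partial>lborel)" for f :: "real \<Rightarrow> real"
  using lborel_integral_real_affine[of 1 f "- t"] by simp

lemma integrable_convolution_kernel:
  fixes f g :: "real \<Rightarrow> real"
  assumes f: "integrable lborel f" and g: "integrable lborel g"
  shows "integrable (lborel \<Otimes>\<^sub>M lborel) (\<lambda>(y, x). f (x - y) * g y)"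
proof (rule lborel_pair.Fubini_integrable)
  have [measurable]: "f \<in> borel_measurable borel" "g \<in> borel_measurable borel" using f g by auto
  show "(\<lambda>(y, x). f (x - y) * g y) \<in> borel_measurable (lborel \<Otimes>\<^sub>M lborel)" by measurable
  show "AE y in lborel. integrable lborel (\<lambda>x. case (y, x) of (y, x) \<Rightarrow> f (x - y) * g y)"
    using integrable_lborel_shift[OF f] by auto
  have "(\<integral>x. norm (f (x - y) * g y) \<partial>lborel) = (\<integral>x. norm (f x) \<partial>lborel) * norm (g y)" for y
    using integral_lborel_shift[of "\<lambda>x. norm (f x)" y] by (simp add: abs_mult)
  then show "integrable lborel (\<lambda>y. \<integral>x. norm (case (y, x) of (y, x) \<Rightarrow> f (x - y) * g y) \<partial>lborel)"
    using g by simp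
qed

lemma has_bochner_integral_convolution:
  fixes f g :: "real \<Rightarrow> real"
  assumes "has_bochner_integral lborel f a" and "has_bochner_integral lborel g b"
  shows "has_bochner_integral lborel (convolve f g) (a * b)"
proof -
  have f: "integrable lborel f" "(\<integral>x. f x \<partial>lborel) = a" and g: "integrable lborel g" "(\<integral>x. g x \<partial>lborel) = b"
    using assms by (simp_all add: has_bochner_integral_iff)
  note k = integrable_convolution_kernel[OF f(1) g(1)]
  have "integrable lborel (convolve f g)"
    unfolding convolve_def using lborel_pair.integrable_snd[OF k] by simp
  moreover have "(\<integral>x. convolve f g x \<partial>lborel) = (\<integral>y. \<integral>x. f (x - y) * g y \<partial>lborel \<partial>lborel)"
    unfolding convolve_def using lborel_pair.Fubini_integral[OF k] by simp
  ultimately show ?thesis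
    using f g integral_lborel_shift[of f] by (simp add: has_bochner_integral_iff)
qed

lemma has_bochner_integral_laplace_convolution:
  fixes f g :: "real \<Rightarrow> real"
  assumes "has_bochner_integral lborel (\<lambda>x. exp (- s * x) * f x) a"
    and "has_bochner_integral lborel (\<lambda>x. exp (- s * x) * g x) b"
  shows "has_bochner_integral lborel (\<lambda>x. exp (- s * x) * convolve f g x) (a * b)"
proof -
  have "exp (- s * x) * convolve f g x
      = convolve (\<lambda>x. exp (- s * x) * f x) (\<lambda>x. exp (- s * x) * g x) x" for x
    unfolding convolve_def integral_mult_right_zero[symmetric]
    by (intro Bochner_Integration.integral_cong) (auto simp: algebra_simps simp flip: exp_add)
  with has_bochner_integral_convolution[OF assms] show ?thesis by simp
qed

lemma convolution_assoc:
  assumes "integrable (lborel \<Otimes>\<^sub>M lborel) (\<lambda>(y, u). p (z - y) * (e (y - u) * f u))"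
  shows "convolve p (convolve e f) z = convolve (convolve p e) f z"
proof -
  have "convolve p (convolve e f) z = (\<integral>y. \<integral>u. p (z - y) * (e (y - u) * f u) \<partial>lborel \<partial>lborel)"
    unfolding convolve_def by simp
  also have "\<dots> = (\<integral>u. \<integral>y. p (z - y) * (e (y - u) * f u) \<partial>lborel \<partial>lborel)"
    using lborel_pair.Fubini_integral[OF assms] by simp
  also have "\<dots> = (\<integral>u. convolve p e (z - u) * f u \<partial>lborel)"
  proof (rule Bochner_Integration.integral_cong[OF refl])
    fix u
    have "(\<integral>y. p (z - y) * (e (y - u) * f u) \<partial>lborel) = (\<integral>y. p (z - u - (y - u)) * e (y - u) * f u \<partial>lborel)"
      by (simp add: mult_ac)
    also have "\<dots> = (\<integral>y. p (z - u - y) * e y * f u \<partial>lborel)"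
      by (rule integral_lborel_shift)
    also have "\<dots> = convolve p e (z - u) * f u"
      unfolding convolve_def by simp
    finally show "(\<integral>y. p (z - y) * (e (y - u) * f u) \<partial>lborel) = convolve p e (z - u) * f u" .
  qed
  finally show ?thesis unfolding convolve_def[of "convolve p e"] .
qed

text \<open>The exponential weight makes the two kernels integrable on the whole line, while \<open>f\<close> is
  only evaluated on the bounded interval \<open>{0..z}\<close>.\<close>

lemma convolution_assoc_causal:
  fixes p e f :: "real \<Rightarrow> real"
  assumes s: "s \<ge> 0"
    and p: "integrable lborel (\<lambda>x. exp (- s * x) * p x)" and p0: "\<And>x. x < 0 \<Longrightarrow> p x = 0"
    and e: "integrable lborel (\<lambda>x. exp (- s * x) * e x)" and e0: "\<And>x. x < 0 \<Longrightarrow> e x = 0"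
    and [measurable]: "p \<in> borel_measurable borel" "e \<in> borel_measurable borel" "f \<in> borel_measurable borel"
    and f0: "\<And>x. x < 0 \<Longrightarrow> f x = 0"
    and B: "\<And>x. x \<in> {0..z} \<Longrightarrow> \<bar>f x\<bar> \<le> B"
  shows "convolve p (convolve e f) z = convolve (convolve p e) f z"
proof (rule convolution_assoc, rule Bochner_Integration.integrable_bound)
  let ?p = "\<lambda>x. exp (- s * x) * p x" and ?e = "\<lambda>x. exp (- s * x) * e x"
  have "integrable (lborel \<Otimes>\<^sub>M lborel) (\<lambda>(y, u). ?e (- u - (- y)) * ?p (z - y))"
  proof -
    have 1: "integrable lborel (\<lambda>y. ?p (z + y))"
      using lborel_integrable_real_affine[OF p, of 1 z] by simp
    have "integrable (lborel \<Otimes>\<^sub>M lborel) (\<lambda>(y, u). ?e (y - u) * ?p (z - y))"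
    proof (rule lborel_pair.Fubini_integrable)
      show "(\<lambda>(y, u). ?e (y - u) * ?p (z - y)) \<in> borel_measurable (lborel \<Otimes>\<^sub>M lborel)" by measurable
      have e': "integrable lborel (\<lambda>u. ?e (y - u))" for y
        using lborel_integrable_real_affine[OF e, of "-1" y] by simp
      show "AE y in lborel. integrable lborel (\<lambda>u. case (y, u) of (y, u) \<Rightarrow> ?e (y - u) * ?p (z - y))"
        using e' by auto
      have "(\<integral>u. norm (?e (y - u) * ?p (z - y)) \<partial>lborel) = (\<integral>u. norm (?e u) \<partial>lborel) * norm (?p (z - y))" for y
        using lborel_integral_real_affine[of "-1" "\<lambda>u. norm (?e u)" y] by (simp add: abs_mult)
      moreover have "integrable lborel (\<lambda>y. ?p (z - y))"
        using lborel_integrable_real_affine[OF p, of "-1" z] by simp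
      ultimately show "integrable lborel (\<lambda>y. \<integral>u. norm (case (y, u) of (y, u) \<Rightarrow> ?e (y - u) * ?p (z - y)) \<partial>lborel)"
        by simp
    qed
    then show ?thesis by (simp add: algebra_simps)
  qed
  then show "integrable (lborel \<Otimes>\<^sub>M lborel) (\<lambda>(y, u). exp (s * z) * B * (?e (y - u) * ?p (z - y)))"
    by (auto simp: case_prod_unfold intro!: integrable_mult_right)
  show "AE x in lborel \<Otimes>\<^sub>M lborel. norm (case x of (y, u) \<Rightarrow> p (z - y) * (e (y - u) * f u))
      \<le> norm (case x of (y, u) \<Rightarrow> exp (s * z) * B * (?e (y - u) * ?p (z - y)))"
  proof (intro AE_I2, clarify)
    fix y u
    show "norm (p (z - y) * (e (y - u) * f u)) \<le> norm (exp (s * z) * B * (?e (y - u) * ?p (z - y)))"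
    proof (cases "u \<in> {0..z} \<and> y \<le> z \<and> u \<le> y")
      case True
      then have "\<bar>f u\<bar> \<le> 1 * \<bar>B\<bar>" using B[of u] by simp
      also have "\<dots> \<le> exp (s * u) * \<bar>B\<bar>"
        using True s by (intro mult_right_mono) auto
      finally have f: "\<bar>f u\<bar> \<le> exp (s * u) * \<bar>B\<bar>" .
      have "norm (p (z - y) * (e (y - u) * f u)) = \<bar>p (z - y)\<bar> * \<bar>e (y - u)\<bar> * \<bar>f u\<bar>"
        by (simp add: abs_mult)
      also have "\<dots> \<le> \<bar>p (z - y)\<bar> * \<bar>e (y - u)\<bar> * (exp (s * u) * \<bar>B\<bar>)"
        using f by (intro mult_left_mono) auto
      also have "exp (s * u) = exp (s * z) * exp (- s * (y - u)) * exp (- s * (z - y))"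
        by (simp add: algebra_simps flip: exp_add)
      finally show ?thesis by (simp add: abs_mult mult_ac)
    next
      case False
      then have "p (z - y) * (e (y - u) * f u) = 0"
        using p0[of "z - y"] e0[of "y - u"] f0[of u] by (cases "z < y"; cases "y < u") auto
      then show ?thesis unfolding \<open>p (z - y) * (e (y - u) * f u) = 0\<close> by simp
    qed
  qed
qed measurable

text \<open>An interval of positive length is not a null set. This supplies points of validity
  arbitrarily close to a given point.\<close>

lemma AE_lborel_between:
  assumes "AE x in lborel. P x" and "a < (b::real)"
  shows "\<exists>x. a < x \<and> x < b \<and> P x"
proof (rule ccontr)
  assume "\<not> ?thesis"
  then have "\<not> P x" if "x \<in> {a<..<b}" for x using that by auto
  then have "AE x in lborel. x \<notin> {a<..<b}" using assms(1) by (auto elim!: eventually_mono)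
  moreover have "{x \<in> space lborel. \<not> x \<notin> {a<..<b}} = {a<..<b}" by auto
  ultimately have "emeasure lborel {a<..<b} = 0"
    by (subst (asm) AE_iff_measurable[OF _ refl]) (simp_all del: greaterThanLessThan_iff)
  then show False using assms(2) by simp
qed

section \<open>Prabhakar kernels and the Prabhakar derivative\<close>

text \<open>Convolution with it is the Riemann-Liouville integral of order \<open>\<beta>\<close>;
  for \<open>\<beta> = 1\<close> it is ordinary integration.\<close>

definition power_kernel :: "real \<Rightarrow> real \<Rightarrow> real" where
  "power_kernel \<beta> u = (if u > 0 then u powr (\<beta> - 1) / Gamma \<beta> else 0)"

lemma borel_measurable_power_kernel [measurable]: "power_kernel \<beta> \<in> borel_measurable borel"
  unfolding power_kernel_def by measurable

lemma power_kernel_nonneg: "\<beta> > 0 \<Longrightarrow> power_kernel \<beta> u \<ge> 0"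
  by (auto simp: power_kernel_def intro!: divide_nonneg_pos Gamma_real_pos)

text \<open>This is the Gamma integral after the substitution \<open>t = s * x\<close>. Nonnegative
  integrals give the value and the integrability together; the scaled identity \<open>eq\<close> is
  then solved for the transform.\<close>

lemma has_bochner_integral_laplace_power_kernel:
  assumes \<beta>: "\<beta> > 0" and s: "s > 0"
  shows "has_bochner_integral lborel (\<lambda>x. exp (- s * x) * power_kernel \<beta> x) (s powr (- \<beta>))"
proof (rule has_bochner_integral_nn_integral)
  have G: "Gamma \<beta> > 0" using \<beta> by (rule Gamma_real_pos)
  have "ennreal (Gamma \<beta>) = (\<integral>\<^sup>+t. ennreal (indicator {0..} t * t powr (\<beta> - 1) / exp t) \<partial>lborel)"
    using \<beta> by (rule Gamma_conv_nn_integral_real)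
  also have "\<dots> = s * (\<integral>\<^sup>+x. ennreal (indicator {0..} (s * x) * (s * x) powr (\<beta> - 1) / exp (s * x)) \<partial>lborel)"
    using s by (subst nn_integral_real_affine[where c = s and t = 0]) auto
  also have "\<dots> = s * (\<integral>\<^sup>+x. ennreal (s powr (\<beta> - 1) * Gamma \<beta>) * ennreal (exp (- s * x) * power_kernel \<beta> x) \<partial>lborel)"
  proof (intro arg_cong2[where f = "(*)"] refl nn_integral_cong)
    fix x :: real
    show "ennreal (indicator {0..} (s * x) * (s * x) powr (\<beta> - 1) / exp (s * x))
      = ennreal (s powr (\<beta> - 1) * Gamma \<beta>) * ennreal (exp (- s * x) * power_kernel \<beta> x)"
      using s G
      by (cases "x = 0") (auto simp: power_kernel_def indicator_def powr_mult exp_minus field_simps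
        zero_le_mult_iff simp flip: ennreal_mult')
  qed
  also have "\<dots> = ennreal s * (ennreal (s powr (\<beta> - 1) * Gamma \<beta>) * (\<integral>\<^sup>+x. ennreal (exp (- s * x) * power_kernel \<beta> x) \<partial>lborel))"
    by (subst nn_integral_cmult) auto
  also have "\<dots> = ennreal (s powr \<beta> * Gamma \<beta>) * (\<integral>\<^sup>+x. ennreal (exp (- s * x) * power_kernel \<beta> x) \<partial>lborel)"
    using s G by (simp add: mult.assoc[symmetric] ennreal_mult'[symmetric] powr_diff)
  finally have eq: "ennreal (Gamma \<beta>) = ennreal (s powr \<beta> * Gamma \<beta>) * (\<integral>\<^sup>+x. ennreal (exp (- s * x) * power_kernel \<beta> x) \<partial>lborel)" .
  have "(\<integral>\<^sup>+x. ennreal (exp (- s * x) * power_kernel \<beta> x) \<partial>lborel)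
      = ennreal (s powr (- \<beta>) / Gamma \<beta>) * (ennreal (s powr \<beta> * Gamma \<beta>) * (\<integral>\<^sup>+x. ennreal (exp (- s * x) * power_kernel \<beta> x) \<partial>lborel))"
    using s G by (simp add: mult.assoc[symmetric] powr_minus field_simps flip: ennreal_mult')
  also have "\<dots> = ennreal (s powr (- \<beta>))"
    unfolding eq[symmetric] using s G by (simp flip: ennreal_mult')
  finally show "(\<integral>\<^sup>+x. ennreal (exp (- s * x) * power_kernel \<beta> x) \<partial>lborel) = ennreal (s powr (- \<beta>))" .
qed (use power_kernel_nonneg[OF \<beta>] in auto)

text \<open>The Taylor coefficients of \<open>(1 + \<eta> * x) powr \<delta>\<close> at
  \<open>x = 0\<close>, in the form in which the Mittag-Leffler series contains them.\<close>

definition prabhakar_coeff :: "real \<Rightarrow> real \<Rightarrow> nat \<Rightarrow> real" where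
  "prabhakar_coeff \<delta> \<eta> r = (- \<eta>) ^ r * pochhammer (- \<delta>) r / fact r"

text \<open>The function \<open>e\<close> of index \<open>\<theta>\<close>, extended by zero so that
  convolving with it is a causal operation.\<close>

definition prabhakar_kernel :: "real \<Rightarrow> real \<Rightarrow> real \<Rightarrow> real \<Rightarrow> real \<Rightarrow> real" where
  "prabhakar_kernel \<nu> \<delta> \<eta> \<theta> u =
     (if u > 0 then u powr (\<theta> - 1) * prabhakar_E \<nu> \<theta> (- \<delta>) (- \<eta> * u powr \<nu>) else 0)"

lemma prabhakar_coeff_eq: "prabhakar_coeff \<delta> \<eta> r = (\<delta> gchoose r) * \<eta> ^ r"
  unfolding prabhakar_coeff_def gbinomial_pochhammer power_minus[of \<eta>] by simp

lemma prabhakar_coeff_sums: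
  assumes "\<bar>\<eta> * x\<bar> < 1"
  shows "(\<lambda>r. prabhakar_coeff \<delta> \<eta> r * x ^ r) sums (1 + \<eta> * x) powr \<delta>"
  using gen_binomial_real[OF assms, of \<delta>]
  by (simp add: prabhakar_coeff_eq power_mult_distrib mult_ac)

text \<open>Convergence of the binomial series at a point strictly between
  \<open>\<bar>\<eta> * x\<bar>\<close> and \<open>1\<close> forces absolute convergence further
  inside.\<close>

lemma prabhakar_coeff_abs_summable:
  assumes "\<bar>\<eta> * x\<bar> < 1"
  shows "summable (\<lambda>r. \<bar>prabhakar_coeff \<delta> \<eta> r * x ^ r\<bar>)"
proof -
  obtain y where y: "\<bar>\<eta> * x\<bar> < y" "y < 1" using dense[OF assms] by auto
  have "summable (\<lambda>r. norm ((\<delta> gchoose r) * (\<eta> * x) ^ r))"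
  proof (rule powser_insidea)
    show "summable (\<lambda>n. (\<delta> gchoose n) * y ^ n)"
      using gen_binomial_real[of y \<delta>] y by (auto simp: sums_iff)
    show "norm (\<eta> * x) < norm y" using y by simp
  qed
  then show ?thesis by (simp add: prabhakar_coeff_eq power_mult_distrib mult_ac)
qed

context
  fixes \<nu> \<delta> \<eta> :: real
  assumes \<nu>: "\<nu> > 0" and \<eta>: "\<eta> > 0"
begin

text \<open>Above the threshold \<open>\<eta> powr (1 / \<nu>)\<close> the binomial series is
  evaluated, at \<open>s powr (- \<nu>)\<close>, inside its disc of convergence.\<close>

lemma laplace_parameter_large:
  assumes "s > \<eta> powr (1 / \<nu>)"
  shows "s > 0" "\<bar>\<eta> * s powr (- \<nu>)\<bar> < 1"
proof -
  have "\<eta> powr (1 / \<nu>) > 0" using \<eta> by simp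
  then show s: "s > 0" using assms by linarith
  have "(\<eta> powr (1 / \<nu>)) powr \<nu> < s powr \<nu>"
    using assms \<nu> by (intro powr_less_mono2) auto
  then have "\<eta> < s powr \<nu>" using \<nu> \<eta> by (simp add: powr_powr)
  then show "\<bar>\<eta> * s powr (- \<nu>)\<bar> < 1"
    using s \<eta> by (simp add: powr_minus field_simps)
qed

lemma has_bochner_integral_prabhakar_term:
  assumes "\<theta> > 0" "s > 0"
  shows "has_bochner_integral lborel
      (\<lambda>x. exp (- s * x) * (prabhakar_coeff \<delta> \<eta> r * power_kernel (\<nu> * real r + \<theta>) x))
      (s powr (- \<theta>) * (prabhakar_coeff \<delta> \<eta> r * (s powr (- \<nu>)) ^ r))"
proof -
  have "\<nu> * real r + \<theta> > 0" using assms \<nu> by (simp add: add_nonneg_pos)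
  from has_bochner_integral_mult_right[OF has_bochner_integral_laplace_power_kernel[OF this assms(2)],
    of "prabhakar_coeff \<delta> \<eta> r"]
  have *: "has_bochner_integral lborel
      (\<lambda>x. prabhakar_coeff \<delta> \<eta> r * (exp (- s * x) * power_kernel (\<nu> * real r + \<theta>) x))
      (prabhakar_coeff \<delta> \<eta> r * s powr (- (\<nu> * real r + \<theta>)))" by simp
  have "s powr (- (\<nu> * real r + \<theta>)) = s powr (- \<theta>) * (s powr (- \<nu>)) ^ r"
    using assms by (simp add: powr_realpow[symmetric] powr_powr powr_add[symmetric] algebra_simps)
  with * show ?thesis by (simp add: mult_ac)
qed

text \<open>The integrals of the absolute terms add up to an absolutely convergent binomial series,
  so the sum of the absolute terms is finite at almost every point. Convergence of the
  Mittag-Leffler series at every argument will be deduced from this.\<close>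

lemma AE_summable_prabhakar_terms:
  assumes \<theta>: "\<theta> > 0" and s: "s > \<eta> powr (1 / \<nu>)"
  shows "AE x in lborel. summable (\<lambda>r. norm (exp (- s * x) * (prabhakar_coeff \<delta> \<eta> r * power_kernel (\<nu> * real r + \<theta>) x)))"
proof -
  note s' = laplace_parameter_large[OF s]
  let ?f = "\<lambda>r x. exp (- s * x) * (prabhakar_coeff \<delta> \<eta> r * power_kernel (\<nu> * real r + \<theta>) x)"
  have nn: "(\<integral>\<^sup>+x. ennreal (norm (?f r x)) \<partial>lborel) = ennreal (s powr (- \<theta>) * \<bar>prabhakar_coeff \<delta> \<eta> r * (s powr (- \<nu>)) ^ r\<bar>)" for r
  proof -
    have pos: "\<nu> * real r + \<theta> > 0" using \<theta> \<nu> by (simp add: add_nonneg_pos)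
    have "(\<integral>\<^sup>+x. ennreal (norm (?f r x)) \<partial>lborel)
      = (\<integral>\<^sup>+x. ennreal \<bar>prabhakar_coeff \<delta> \<eta> r\<bar> * ennreal (exp (- s * x) * power_kernel (\<nu> * real r + \<theta>) x) \<partial>lborel)"
      using power_kernel_nonneg[OF pos]
      by (intro nn_integral_cong) (simp add: abs_mult mult_ac flip: ennreal_mult')
    also have "\<dots> = ennreal \<bar>prabhakar_coeff \<delta> \<eta> r\<bar> * ennreal (s powr (- (\<nu> * real r + \<theta>)))"
      using has_bochner_integral_laplace_power_kernel[OF pos s'(1)] power_kernel_nonneg[OF pos]
      by (subst nn_integral_cmult) (auto simp: nn_integral_eq_integral has_bochner_integral_iff)
    also have "s powr (- (\<nu> * real r + \<theta>)) = s powr (- \<theta>) * (s powr (- \<nu>)) ^ r"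
      using s' by (simp add: powr_realpow[symmetric] powr_powr powr_add[symmetric] algebra_simps)
    finally show ?thesis by (simp add: abs_mult mult_ac flip: ennreal_mult')
  qed
  have "(\<integral>\<^sup>+x. (\<Sum>r. ennreal (norm (?f r x))) \<partial>lborel) = (\<Sum>r. \<integral>\<^sup>+x. ennreal (norm (?f r x)) \<partial>lborel)"
    by (rule nn_integral_suminf) measurable
  also have "\<dots> < \<infinity>"
    unfolding nn using summable_mult[OF prabhakar_coeff_abs_summable[OF s'(2)]]
    by (subst suminf_ennreal2) auto
  finally have "AE x in lborel. (\<Sum>r. ennreal (norm (?f r x))) \<noteq> \<infinity>"
    by (intro nn_integral_PInf_AE) auto
  then show ?thesis
    by eventually_elim (rule summable_suminf_not_top, auto)
qed

lemma has_bochner_integral_suminf_prabhakar_terms: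
  assumes \<theta>: "\<theta> > 0" and s: "s > \<eta> powr (1 / \<nu>)"
  shows "has_bochner_integral lborel
      (\<lambda>x. \<Sum>r. exp (- s * x) * (prabhakar_coeff \<delta> \<eta> r * power_kernel (\<nu> * real r + \<theta>) x))
      (s powr (- \<theta>) * (1 + \<eta> * s powr (- \<nu>)) powr \<delta>)"
proof -
  note s' = laplace_parameter_large[OF s]
  let ?f = "\<lambda>r x. exp (- s * x) * (prabhakar_coeff \<delta> \<eta> r * power_kernel (\<nu> * real r + \<theta>) x)"
  have int: "integrable lborel (?f r)" and val: "(\<integral>x. ?f r x \<partial>lborel) = s powr (- \<theta>) * (prabhakar_coeff \<delta> \<eta> r * (s powr (- \<nu>)) ^ r)" for r
    using has_bochner_integral_prabhakar_term[OF \<theta> s'(1), of r] by (simp_all add: has_bochner_integral_iff)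
  have norm: "(\<integral>x. norm (?f r x) \<partial>lborel) = s powr (- \<theta>) * \<bar>prabhakar_coeff \<delta> \<eta> r * (s powr (- \<nu>)) ^ r\<bar>" for r
  proof -
    have pos: "\<nu> * real r + \<theta> > 0" using \<theta> \<nu> by (simp add: add_nonneg_pos)
    \<comment> \<open>The power kernel is nonnegative, so each term has the constant sign of its
      coefficient, and its norm integrates to the absolute value of its integral.\<close>
    have sgn: "\<bar>c * k\<bar> = sgn c * (c * k)" if "k \<ge> 0" for c k :: real
      using that by (simp add: abs_mult abs_sgn[of c] mult_ac)
    have "(\<integral>x. norm (?f r x) \<partial>lborel) = (\<integral>x. sgn (prabhakar_coeff \<delta> \<eta> r) * ?f r x \<partial>lborel)"
    proof (rule Bochner_Integration.integral_cong[OF refl])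
      fix x
      from sgn[OF power_kernel_nonneg[OF pos], of "prabhakar_coeff \<delta> \<eta> r" x]
      show "norm (?f r x) = sgn (prabhakar_coeff \<delta> \<eta> r) * ?f r x"
        unfolding real_norm_def abs_mult[of "exp (- s * x)"] abs_exp_cancel
        by (metis mult.left_commute)
    qed
    also have "\<dots> = sgn (prabhakar_coeff \<delta> \<eta> r) * (s powr (- \<theta>) * (prabhakar_coeff \<delta> \<eta> r * (s powr (- \<nu>)) ^ r))"
      by (simp only: integral_mult_right_zero val)
    also have "\<dots> = s powr (- \<theta>) * \<bar>prabhakar_coeff \<delta> \<eta> r * (s powr (- \<nu>)) ^ r\<bar>"
      by (subst sgn) (simp_all only: zero_le_power powr_ge_zero mult.left_commute)
    finally show ?thesis .
  qed
  have sm: "summable (\<lambda>r. \<integral>x. norm (?f r x) \<partial>lborel)"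
    unfolding norm by (intro summable_mult prabhakar_coeff_abs_summable s')
  note AE = AE_summable_prabhakar_terms[OF \<theta> s]
  have "(\<integral>x. (\<Sum>r. ?f r x) \<partial>lborel) = (\<Sum>r. s powr (- \<theta>) * (prabhakar_coeff \<delta> \<eta> r * (s powr (- \<nu>)) ^ r))"
    unfolding val[symmetric] by (rule integral_suminf[OF int AE sm])
  also have "\<dots> = s powr (- \<theta>) * (1 + \<eta> * s powr (- \<nu>)) powr \<delta>"
    using sums_mult[OF prabhakar_coeff_sums[OF s'(2), of \<delta>], of "s powr (- \<theta>)"] by (simp add: sums_iff)
  finally show ?thesis
    using integrable_suminf[OF int AE sm] by (simp add: has_bochner_integral_iff)
qed

text \<open>No growth estimate for \<open>Gamma\<close> enters: summability holds at almost every
  \<open>u\<close>, hence at some \<open>u\<close> as large as desired, and a power series converges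
  absolutely inside any radius where it converges.\<close>

lemma summable_prabhakar_E:
  assumes \<theta>: "\<theta> > 0"
  shows "summable (\<lambda>r. pochhammer (- \<delta>) r / (fact r * Gamma (\<nu> * real r + \<theta>)) * (x::real) ^ r)"
proof -
  define s where "s = \<eta> powr (1 / \<nu>) + 1"
  have s: "s > \<eta> powr (1 / \<nu>)" by (simp add: s_def)
  \<comment> \<open>\<open>K\<close> solves
    \<open>\<eta> * K powr \<nu> = \<bar>x\<bar> + 1\<close>, so every \<open>u > K\<close> yields
    an argument of modulus greater than \<open>\<bar>x\<bar>\<close>.\<close>
  define K where "K = ((\<bar>x\<bar> + 1) / \<eta>) powr (1 / \<nu>)"
  have K: "K > 0" using \<eta> unfolding K_def by (simp add: divide_pos_pos)
  obtain u where u: "u > K" and sm: "summable (\<lambda>r. norm (exp (- s * u) * (prabhakar_coeff \<delta> \<eta> r * power_kernel (\<nu> * real r + \<theta>) u)))"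
    using AE_lborel_between[OF AE_summable_prabhakar_terms[OF \<theta> s], of K "K + 1"] by auto
  have u0: "u > 0" using u K by simp
  have "summable (\<lambda>r. exp (- s * u) * (prabhakar_coeff \<delta> \<eta> r * power_kernel (\<nu> * real r + \<theta>) u))"
    using sm by (rule summable_norm_cancel)
  then have "summable (\<lambda>r. (exp (s * u) * u powr (1 - \<theta>)) * (exp (- s * u) * (prabhakar_coeff \<delta> \<eta> r * power_kernel (\<nu> * real r + \<theta>) u)))"
    by (rule summable_mult)
  moreover have "(exp (s * u) * u powr (1 - \<theta>)) * (exp (- s * u) * (prabhakar_coeff \<delta> \<eta> r * power_kernel (\<nu> * real r + \<theta>) u))
     = pochhammer (- \<delta>) r / (fact r * Gamma (\<nu> * real r + \<theta>)) * (- \<eta> * u powr \<nu>) ^ r" for r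
  proof -
    have "u powr (1 - \<theta>) * u powr (\<nu> * real r + \<theta> - 1) = (u powr \<nu>) ^ r"
      using u0 by (simp add: powr_realpow[symmetric] powr_powr powr_add[symmetric])
    moreover have "exp (s * u) * exp (- s * u) = 1" by (simp flip: exp_add)
    ultimately show ?thesis
      using u0 unfolding power_kernel_def prabhakar_coeff_def power_mult_distrib by (simp add: mult_ac)
  qed
  ultimately have "summable (\<lambda>r. pochhammer (- \<delta>) r / (fact r * Gamma (\<nu> * real r + \<theta>)) * (- \<eta> * u powr \<nu>) ^ r)"
    by (simp only:)
  then show ?thesis
  proof (rule powser_inside)
    have "K powr \<nu> < u powr \<nu>" using u K \<nu> by (intro powr_less_mono2) auto
    then have "(\<bar>x\<bar> + 1) / \<eta> < u powr \<nu>" using \<nu> \<eta> by (simp add: K_def powr_powr)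
    then show "norm x < norm (- \<eta> * u powr \<nu>)" using \<eta> by (simp add: abs_mult field_simps)
  qed
qed

lemma prabhakar_E_eq:
  "prabhakar_E \<nu> \<theta> (- \<delta>) x = (\<Sum>r. pochhammer (- \<delta>) r / (fact r * Gamma (\<nu> * real r + \<theta>)) * (x::real) ^ r)"
  unfolding prabhakar_E_def by (simp add: mult_ac)

lemma isCont_prabhakar_E:
  assumes \<theta>: "\<theta> > 0"
  shows "isCont (prabhakar_E \<nu> \<theta> (- \<delta>)) (x::real)"
  unfolding prabhakar_E_eq[abs_def]
  by (rule isCont_powser[OF summable_prabhakar_E[OF \<theta>, of "\<bar>x\<bar> + 1"]]) simp

lemma isCont_prabhakar_kernel:
  assumes \<theta>: "\<theta> > 0" and u: "u > 0"
  shows "isCont (prabhakar_kernel \<nu> \<delta> \<eta> \<theta>) u"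
proof -
  have "isCont (\<lambda>u. u powr (\<theta> - 1) * prabhakar_E \<nu> \<theta> (- \<delta>) (- \<eta> * u powr \<nu>)) u"
    using u by (intro continuous_intros isCont_o2[OF _ isCont_prabhakar_E[OF \<theta>]]) auto
  moreover have "eventually (\<lambda>u. prabhakar_kernel \<nu> \<delta> \<eta> \<theta> u = u powr (\<theta> - 1) * prabhakar_E \<nu> \<theta> (- \<delta>) (- \<eta> * u powr \<nu>)) (nhds u)"
    using eventually_nhds_in_open[OF open_greaterThan[of 0], of u] u
    by (auto elim!: eventually_mono simp: prabhakar_kernel_def)
  ultimately show ?thesis by (subst isCont_cong) auto
qed

lemma borel_measurable_prabhakar_kernel [measurable]:
  assumes \<theta>: "\<theta> > 0"
  shows "prabhakar_kernel \<nu> \<delta> \<eta> \<theta> \<in> borel_measurable borel"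
proof -
  have [measurable]: "(prabhakar_E \<nu> \<theta> (- \<delta>) :: real \<Rightarrow> real) \<in> borel_measurable borel"
    using isCont_prabhakar_E[OF \<theta>] by (intro borel_measurable_continuous_onI) (auto simp: continuous_on_eq_continuous_at)
  show ?thesis unfolding prabhakar_kernel_def by measurable
qed

lemma has_bochner_integral_laplace_prabhakar_kernel:
  assumes \<theta>: "\<theta> > 0" and s: "s > \<eta> powr (1 / \<nu>)"
  shows "has_bochner_integral lborel (\<lambda>x. exp (- s * x) * prabhakar_kernel \<nu> \<delta> \<eta> \<theta> x)
      (s powr (- \<theta>) * (1 + \<eta> * s powr (- \<nu>)) powr \<delta>)"
proof -
  have "(\<Sum>r. exp (- s * x) * (prabhakar_coeff \<delta> \<eta> r * power_kernel (\<nu> * real r + \<theta>) x))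
      = exp (- s * x) * prabhakar_kernel \<nu> \<delta> \<eta> \<theta> x" for x
  proof (cases "x > 0")
    case True
    have term_eq: "exp (- s * x) * (prabhakar_coeff \<delta> \<eta> r * power_kernel (\<nu> * real r + \<theta>) x)
      = (exp (- s * x) * x powr (\<theta> - 1)) * (pochhammer (- \<delta>) r / (fact r * Gamma (\<nu> * real r + \<theta>)) * (- \<eta> * x powr \<nu>) ^ r)" for r
    proof -
      have "x powr (\<nu> * real r + \<theta> - 1) = x powr (\<theta> - 1) * (x powr \<nu>) ^ r"
        using True by (simp add: powr_realpow[symmetric] powr_powr powr_add[symmetric] algebra_simps)
      then show ?thesis
        using True unfolding power_kernel_def prabhakar_coeff_def power_mult_distrib by (simp add: mult_ac)
    qed
    show ?thesis
      unfolding term_eq suminf_mult[OF summable_prabhakar_E[OF \<theta>]]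
      using True by (simp add: prabhakar_kernel_def prabhakar_E_eq mult_ac)
  qed (simp add: power_kernel_def prabhakar_kernel_def)
  with has_bochner_integral_suminf_prabhakar_terms[OF assms] show ?thesis by simp
qed

text \<open>On the transform side the power kernel contributes the factor
  \<open>s powr (- \<beta>)\<close>, which only raises the index. An equality almost everywhere is
  enough because it will be used under a further convolution.\<close>

lemma convolution_power_prabhakar_kernel:
  assumes \<theta>: "\<theta> > 0" and \<beta>: "\<beta> > 0"
  shows "AE x in lborel. convolve (power_kernel \<beta>) (prabhakar_kernel \<nu> \<delta> \<eta> \<theta>) x
    = prabhakar_kernel \<nu> \<delta> \<eta> (\<theta> + \<beta>) x"
proof (rule AE_eq_if_laplace_eq[where c = "\<eta> powr (1 / \<nu>) + 1"])
  show "convolve (power_kernel \<beta>) (prabhakar_kernel \<nu> \<delta> \<eta> \<theta>) x = 0" if "x < 0" for x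
  proof -
    have "power_kernel \<beta> (x - y) * prabhakar_kernel \<nu> \<delta> \<eta> \<theta> y = 0" for y
      using that by (auto simp: power_kernel_def prabhakar_kernel_def)
    then show ?thesis unfolding convolve_def by (simp only:) simp
  qed
  show "prabhakar_kernel \<nu> \<delta> \<eta> (\<theta> + \<beta>) x = 0" if "x < 0" for x
    using that by (simp add: prabhakar_kernel_def)
  fix s assume "s \<ge> \<eta> powr (1 / \<nu>) + 1"
  then have s: "s > \<eta> powr (1 / \<nu>)" by simp
  note s' = laplace_parameter_large[OF s]
  show "has_bochner_integral lborel (\<lambda>x. exp (- s * x) * prabhakar_kernel \<nu> \<delta> \<eta> (\<theta> + \<beta>) x)
      (s powr (- (\<theta> + \<beta>)) * (1 + \<eta> * s powr (- \<nu>)) powr \<delta>)"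
    using \<theta> \<beta> s by (intro has_bochner_integral_laplace_prabhakar_kernel) auto
  have "s powr (- (\<theta> + \<beta>)) = s powr (- \<beta>) * s powr (- \<theta>)"
    by (simp add: add.commute flip: powr_add)
  then show "has_bochner_integral lborel
      (\<lambda>x. exp (- s * x) * convolve (power_kernel \<beta>) (prabhakar_kernel \<nu> \<delta> \<eta> \<theta>) x)
      (s powr (- (\<theta> + \<beta>)) * (1 + \<eta> * s powr (- \<nu>)) powr \<delta>)"
    using has_bochner_integral_laplace_convolution[OF has_bochner_integral_laplace_power_kernel[OF \<beta> s'(1)]
        has_bochner_integral_laplace_prabhakar_kernel[OF \<theta> s]]
    by (simp add: mult_ac)
qed

end

section \<open>Functions that vanish on the negative half-line\<close>

lemma causal_borel_measurable:
  fixes g :: "real \<Rightarrow> real"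
  assumes "\<And>x. x < 0 \<Longrightarrow> g x = 0" "continuous_on {0..} g"
  shows "g \<in> borel_measurable borel"
proof -
  have "(\<lambda>x. indicator {0..} x *\<^sub>R g x) \<in> borel_measurable borel"
    using assms(2) by (intro borel_measurable_continuous_on_indicator) auto
  moreover have "(\<lambda>x. indicator {0..} x *\<^sub>R g x) = g"
    using assms(1) by (auto simp: indicator_def fun_eq_iff)
  ultimately show ?thesis by simp
qed

lemma causal_bounded:
  fixes g :: "real \<Rightarrow> real"
  assumes "\<And>x. x < 0 \<Longrightarrow> g x = 0" "continuous_on {0..} g"
  obtains B where "B \<ge> 0" "\<And>x. x \<le> R \<Longrightarrow> \<bar>g x\<bar> \<le> B"
proof -
  have "compact (g ` {0..R})"
    using assms(2) by (intro compact_continuous_image) (auto elim: continuous_on_subset)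
  then obtain B where B: "\<forall>x\<in>{0..R}. norm (g x) \<le> B"
    using compact_imp_bounded bounded_iff by (metis imageI)
  have "\<bar>g x\<bar> \<le> \<bar>B\<bar>" if "x \<le> R" for x
  proof (cases "x < 0")
    case False
    then have "norm (g x) \<le> B" using B that by simp
    then show ?thesis by simp
  qed (simp add: assms(1))
  then show ?thesis using that[of "\<bar>B\<bar>"] by auto
qed

lemma integrable_atMost_if_laplace:
  fixes h :: "real \<Rightarrow> real"
  assumes h: "integrable lborel (\<lambda>x. exp (- s * x) * h x)" and s: "s \<ge> 0"
    and [measurable]: "h \<in> borel_measurable borel"
  shows "integrable lborel (\<lambda>x. indicator {..R} x * h x)"
proof (rule Bochner_Integration.integrable_bound)
  show "integrable lborel (\<lambda>x. exp (s * R) * (exp (- s * x) * h x))"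
    using h by (rule integrable_mult_right)
  show "AE x in lborel. norm (indicator {..R} x * h x) \<le> norm (exp (s * R) * (exp (- s * x) * h x))"
  proof (intro AE_I2)
    fix x
    have "1 \<le> exp (s * R) * exp (- s * x)" if "x \<le> R"
      using that s by (simp add: mult_left_mono flip: exp_add)
    then have "1 * \<bar>h x\<bar> \<le> exp (s * R) * exp (- s * x) * \<bar>h x\<bar>" if "x \<le> R"
      using that by (intro mult_right_mono) auto
    then show "norm (indicator {..R} x * h x) \<le> norm (exp (s * R) * (exp (- s * x) * h x))"
      by (auto simp: abs_mult indicator_def mult_ac)
  qed
qed measurable

text \<open>A jump of \<open>g\<close> at \<open>0\<close> does no harm: in
  \<open>g (z - w) * h w\<close> it sits at the single point \<open>w = z\<close>. Causality
  confines the integral to a bounded range, on which \<open>g\<close> is bounded.\<close>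

lemma isCont_convolution_causal:
  fixes g h :: "real \<Rightarrow> real"
  assumes g0: "\<And>x. x < 0 \<Longrightarrow> g x = 0" and g: "continuous_on {0..} g"
    and h0: "\<And>x. x < 0 \<Longrightarrow> h x = 0" and [measurable]: "h \<in> borel_measurable borel"
    and h: "\<And>R. integrable lborel (\<lambda>x. indicator {..R} x * h x)"
  shows "isCont (convolve h g) z"
  unfolding continuous_at_sequentially
proof (intro allI impI)
  fix X assume X: "X \<longlonglongrightarrow> z"
  have gm [measurable]: "g \<in> borel_measurable borel" using g0 g by (rule causal_borel_measurable)
  obtain R where R: "\<And>n. norm (X n) \<le> R"
    using convergent_imp_Bseq[OF convergentI[OF X]] by (auto simp: Bseq_def)
  obtain B where B: "B \<ge> 0" "\<And>x. x \<le> R \<Longrightarrow> \<bar>g x\<bar> \<le> B" using causal_bounded[OF g0 g] by blast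
  have "(\<lambda>n. \<integral>w. g (X n - w) * h w \<partial>lborel) \<longlonglongrightarrow> (\<integral>w. g (z - w) * h w \<partial>lborel)"
  proof (rule integral_dominated_convergence[where w = "\<lambda>w. B * norm (indicator {..R} w * h w)"])
    show "integrable lborel (\<lambda>w. B * norm (indicator {..R} w * h w))"
      by (intro integrable_mult_right integrable_norm h)
    show "AE w in lborel. (\<lambda>n. g (X n - w) * h w) \<longlonglongrightarrow> g (z - w) * h w"
      using AE_lborel_singleton[of z]
    proof eventually_elim
      case (elim w)
      have "isCont g (z - w)"
      proof (cases "z - w > 0")
        case True
        have "continuous_on {0<..} g" using g by (rule continuous_on_subset) auto
        then show ?thesis using True by (simp add: continuous_on_eq_continuous_at)
      next
        case False
        then have "z - w < 0" using elim by simp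
        moreover have "continuous_on {..<0} g"
          using g0 by (subst continuous_on_cong[where g = "\<lambda>_. 0"]) auto
        ultimately show ?thesis by (simp add: continuous_on_eq_continuous_at)
      qed
      then show ?case
        by (intro tendsto_mult tendsto_const isCont_tendsto_compose[of _ g] tendsto_diff X)
    qed
    show "AE w in lborel. norm (g (X n - w) * h w) \<le> B * norm (indicator {..R} w * h w)" for n
    proof (intro AE_I2)
      fix w
      have Xn: "X n \<le> R" using R[of n] by simp
      show "norm (g (X n - w) * h w) \<le> B * norm (indicator {..R} w * h w)"
      proof (cases "w < 0 \<or> w > R")
        case True
        then have "g (X n - w) * h w = 0" using h0[of w] g0[of "X n - w"] Xn by auto
        then show ?thesis using B(1) by (simp only:) simp
      next
        case False
        then have "\<bar>g (X n - w)\<bar> \<le> B" using Xn by (intro B) auto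
        then show ?thesis using False by (simp add: abs_mult mult_right_mono)
      qed
    qed
  qed measurable
  then show "(convolve h g \<circ> X) \<longlonglongrightarrow> convolve h g z"
    unfolding comp_def convolution_commute[of h g] by (simp add: convolve_def)
qed

lemma convolution_causal_eq_0:
  assumes "\<And>x. x < 0 \<Longrightarrow> f x = 0" "\<And>x. x < 0 \<Longrightarrow> g x = 0" "x < 0"
  shows "convolve f g x = 0"
proof -
  have "f (x - y) * g y = 0" for y
    using assms(1)[of "x - y"] assms(2)[of y] assms(3) by (cases "y < 0") auto
  then show ?thesis unfolding convolve_def by (simp only:) simp
qed

lemma power_kernel_1: "power_kernel 1 u = indicator {0<..} u"
  by (simp add: power_kernel_def)

lemma convolution_power_kernel_1: "convolve (power_kernel 1) G z = (\<integral>w. indicator {..<z} w * G w \<partial>lborel)"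
  unfolding convolve_def power_kernel_1
  by (intro Bochner_Integration.integral_cong) (auto simp: indicator_def)

text \<open>\<open>G\<close> may be unbounded near \<open>0\<close>. The fundamental theorem of
  calculus is therefore applied from \<open>a = z / 2\<close> on, and the integral below
  \<open>a\<close> is the constant \<open>C\<close>.\<close>

lemma has_real_derivative_convolution_1:
  fixes G :: "real \<Rightarrow> real"
  assumes G: "continuous_on {0<..} G" and [measurable]: "G \<in> borel_measurable borel"
    and int: "\<And>R. integrable lborel (\<lambda>x. indicator {..R} x * G x)"
    and z: "z > 0"
  shows "(convolve (power_kernel 1) G has_real_derivative G z) (at z)"
proof -
  define a where "a = z / 2"
  have a: "0 < a" "a < z" using z by (auto simp: a_def)
  define C where "C = (\<integral>w. indicator {..<a} w * G w \<partial>lborel)"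
  have eq: "convolve (power_kernel 1) G x = C + integral {a..x} G" if "x > a" for x
  proof -
    have cont: "continuous_on {a..x} G" using G a by (auto elim: continuous_on_subset)
    then have si: "set_integrable lborel {a..x} G" by (rule borel_integrable_atLeastAtMost')
    have int': "integrable lborel (\<lambda>w. indicator {..<a} w * G w)"
      using integrable_mult_indicator[OF _ int[of a], of "{..<a}"]
      by (rule Bochner_Integration.integrable_cong[THEN iffD1, OF refl, rotated]) (auto simp: indicator_def)
    have "convolve (power_kernel 1) G x = (\<integral>w. indicator {..<a} w * G w + indicator {a..x} w *\<^sub>R G w \<partial>lborel)"
      unfolding convolution_power_kernel_1
    proof (rule integral_cong_AE)
      show "(\<lambda>w. indicator {..<x} w * G w) \<in> borel_measurable lborel" by measurable
      show "(\<lambda>w. indicator {..<a} w * G w + indicator {a..x} w *\<^sub>R G w) \<in> borel_measurable lborel"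
        by measurable
      show "AE w in lborel. indicator {..<x} w * G w = indicator {..<a} w * G w + indicator {a..x} w *\<^sub>R G w"
        using AE_lborel_singleton[of x] by eventually_elim (use that in \<open>auto simp: indicator_def\<close>)
    qed
    also have "\<dots> = C + (LBINT w:{a..x}. G w)"
      using int' si unfolding C_def set_integrable_def set_lebesgue_integral_def
      by (rule Bochner_Integration.integral_add)
    also have "(LBINT w:{a..x}. G w) = integral {a..x} G"
      by (rule set_borel_integral_eq_integral(2)[OF si])
    finally show ?thesis .
  qed
  have "((\<lambda>x. integral {a..x} G) has_real_derivative G z) (at z within {a..z + 1})"
    using G a by (intro integral_has_real_derivative) (auto elim: continuous_on_subset)
  then have "((\<lambda>x. integral {a..x} G) has_real_derivative G z) (at z)"
    using at_within_Icc_at[of a z "z + 1"] a by simp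
  then have "((\<lambda>x. C + integral {a..x} G) has_real_derivative G z) (at z)"
    by (auto intro!: derivative_eq_intros)
  then show ?thesis
    by (rule has_field_derivative_transform_within_open[where S = "{a<..}"]) (use a eq in auto)
qed

text \<open>\<open>H\<close> is a chain in which every function is the derivative of its successor.
  Equalities on the open half-line suffice because differentiation is local.\<close>

lemma iterated_deriv_eq:
  fixes H :: "nat \<Rightarrow> real \<Rightarrow> real"
  assumes "\<And>i z. z > 0 \<Longrightarrow> (H (Suc i) has_real_derivative H i z) (at z)"
    and "\<And>z. z > 0 \<Longrightarrow> F z = c * H j z" and "z > 0"
  shows "(deriv ^^ j) F z = c * H 0 z"
  using assms(2,3)
proof (induction j arbitrary: F z)
  case (Suc j)
  have "deriv F z = c * H j z" if "z > 0" for z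
  proof (rule DERIV_imp_deriv)
    have "((\<lambda>z. c * H (Suc j) z) has_real_derivative c * H j z) (at z)"
      using assms(1)[OF that, of j] by (auto intro!: derivative_eq_intros)
    then show "(F has_real_derivative c * H j z) (at z)"
      by (rule has_field_derivative_transform_within_open[where S = "{0<..}"]) (use that Suc.prems in auto)
  qed
  from Suc.IH[OF this Suc.prems(2)] show ?case
    unfolding funpow_Suc_right by (simp add: comp_def)
qed simp

text \<open>The integral form of membership in the domain: a one-sided derivative at
  \<open>0\<close> is enough for the fundamental theorem on \<open>{0..z}\<close>. The value
  \<open>f 0\<close> stays separate because \<open>f\<close> may jump there, and \<open>f'\<close>
  is extended by zero so that it is causal as well.\<close>

lemma half_line_C1E:
  assumes "f \<in> half_line_C1"
  obtains f' where "\<And>x. x < 0 \<Longrightarrow> f x = 0" "continuous_on {0..} f"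
    "\<And>x. x < 0 \<Longrightarrow> f' x = 0" "continuous_on {0..} f'"
    "\<And>z. z \<ge> 0 \<Longrightarrow> f z = f 0 + convolve (power_kernel 1) f' z"
proof -
  obtain g where f0: "\<And>x. x < 0 \<Longrightarrow> f x = 0" and g: "continuous_on {0..} g"
    and der: "\<And>x. x \<ge> 0 \<Longrightarrow> (f has_real_derivative g x) (at x within {0..})"
    using assms unfolding half_line_C1_def by auto
  define f' where "f' = (\<lambda>x. if x < 0 then 0 else g x)"
  have f': "continuous_on {0..} f'"
    using g by (subst continuous_on_cong[where g = g]) (auto simp: f'_def)
  have eq: "f z = f 0 + convolve (power_kernel 1) f' z" if z: "z \<ge> 0" for z
  proof -
    have "(f' has_integral f z - f 0) {0..z}"
    proof (rule fundamental_theorem_of_calculus[OF z])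
      fix x assume x: "x \<in> {0..z}"
      then have "(f has_real_derivative g x) (at x within {0..z})"
        using der[of x] by (auto intro: DERIV_subset)
      then show "(f has_vector_derivative f' x) (at x within {0..z})"
        using x by (simp add: f'_def has_real_derivative_iff_has_vector_derivative)
    qed
    moreover have si: "set_integrable lborel {0..z} f'"
      using f' by (intro borel_integrable_atLeastAtMost') (auto elim: continuous_on_subset)
    ultimately have "f z - f 0 = (LBINT w:{0..z}. f' w)"
      using set_borel_integral_eq_integral(2)[OF si] by (simp add: integral_unique)
    also have "\<dots> = convolve (power_kernel 1) f' z"
      unfolding convolution_power_kernel_1 set_lebesgue_integral_def
    proof (rule integral_cong_AE)
      have [measurable]: "f' \<in> borel_measurable borel"
        using f' by (intro causal_borel_measurable) (auto simp: f'_def)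
      show "(\<lambda>w. indicator {0..z} w *\<^sub>R f' w) \<in> borel_measurable lborel" by measurable
      show "(\<lambda>w. indicator {..<z} w * f' w) \<in> borel_measurable lborel" by measurable
      show "AE w in lborel. indicator {0..z} w *\<^sub>R f' w = indicator {..<z} w * f' w"
        using AE_lborel_singleton[of z] by eventually_elim (auto simp: indicator_def f'_def)
    qed
    finally show ?thesis by simp
  qed
  have "continuous_on {0..} f"
    using der by (auto simp: continuous_on_eq_continuous_within intro: DERIV_continuous)
  moreover have "f' x = 0" if "x < 0" for x using that by (simp add: f'_def)
  ultimately show ?thesis using that[OF f0 _ _ f' eq] by blast
qed

lemma set_integral_eq_convolution:
  fixes G :: "real \<Rightarrow> real"
  assumes \<beta>: "\<beta> > 0" and z: "z > 0" and G0: "\<And>x. x < 0 \<Longrightarrow> G x = 0"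
    and [measurable]: "G \<in> borel_measurable borel"
    and g: "\<And>y. y > 0 \<Longrightarrow> g y = G y"
  shows "(LBINT y:{0..z}. g y / (z - y) powr (1 - \<beta>)) = Gamma \<beta> * convolve (power_kernel \<beta>) G z"
proof -
  have G: "Gamma \<beta> > 0" using \<beta> by (rule Gamma_real_pos)
  have eq: "indicator {0..z} y *\<^sub>R (g y / (z - y) powr (1 - \<beta>)) = Gamma \<beta> * (power_kernel \<beta> (z - y) * G y)"
    if "y \<noteq> 0" "y \<noteq> z" for y
  proof -
    have "(z - y) powr (\<beta> - 1) = 1 / (z - y) powr (1 - \<beta>)"
      by (metis minus_diff_eq powr_minus_divide)
    then show ?thesis
      using that G G0[of y] g[of y] by (auto simp: power_kernel_def indicator_def)
  qed
  have "(LBINT y:{0..z}. g y / (z - y) powr (1 - \<beta>)) = (\<integral>y. Gamma \<beta> * (power_kernel \<beta> (z - y) * G y) \<partial>lborel)"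
    unfolding set_lebesgue_integral_def
  proof (rule integral_cong_AE)
    show "AE y in lborel. indicator {0..z} y *\<^sub>R (g y / (z - y) powr (1 - \<beta>)) = Gamma \<beta> * (power_kernel \<beta> (z - y) * G y)"
      using AE_lborel_singleton[of 0] AE_lborel_singleton[of z] by eventually_elim (rule eq)
    \<comment> \<open>Measurability of \<open>g\<close> is not among the hypotheses, but the
      integrand coincides with a measurable function except at \<open>0\<close> and
      \<open>z\<close>, whose values are inserted explicitly.\<close>
    have "(\<lambda>y. if y = 0 then indicator {0..z} (0::real) *\<^sub>R (g 0 / (z - 0) powr (1 - \<beta>))
        else if y = z then g z / 0 powr (1 - \<beta>) else Gamma \<beta> * (power_kernel \<beta> (z - y) * G y)) \<in> borel_measurable lborel"
      by measurable
    then show "(\<lambda>y. indicator {0..z} y *\<^sub>R (g y / (z - y) powr (1 - \<beta>))) \<in> borel_measurable lborel"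
      by (rule measurable_cong[THEN iffD1, rotated]) (use eq z in auto)
  qed measurable
  then show ?thesis by (simp add: convolve_def)
qed

section \<open>The Prabhakar derivative of continuously differentiable functions\<close>

context
  fixes \<nu> \<delta> \<eta> :: real
  assumes \<nu>: "\<nu> > 0" and \<eta>: "\<eta> > 0"
begin

lemma integrable_laplace_prabhakar_kernel:
  assumes "\<theta> > 0"
  shows "integrable lborel (\<lambda>x. exp (- (\<eta> powr (1 / \<nu>) + 1) * x) * prabhakar_kernel \<nu> \<delta> \<eta> \<theta> x)"
  using has_bochner_integral_laplace_prabhakar_kernel[OF \<nu> \<eta> assms, of "\<eta> powr (1 / \<nu>) + 1" \<delta>]
  by (simp add: has_bochner_integral_iff)

lemma integrable_atMost_prabhakar_kernel:
  assumes "\<theta> > 0"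
  shows "integrable lborel (\<lambda>x. indicator {..R} x * prabhakar_kernel \<nu> \<delta> \<eta> \<theta> x)"
  by (rule integrable_atMost_if_laplace[OF integrable_laplace_prabhakar_kernel[OF assms]])
     (use borel_measurable_prabhakar_kernel[OF \<nu> \<eta> assms] in auto)

text \<open>Associativity brings the index shift inside a convolution, where equality almost
  everywhere becomes equality at every point.\<close>

lemma convolution_power_prabhakar_kernel_causal:
  assumes \<theta>: "\<theta> > 0" and \<beta>: "\<beta> > 0" and f0: "\<And>x. x < 0 \<Longrightarrow> f x = 0" and f: "continuous_on {0..} f"
  shows "convolve (power_kernel \<beta>) (convolve (prabhakar_kernel \<nu> \<delta> \<eta> \<theta>) f) z
    = convolve (prabhakar_kernel \<nu> \<delta> \<eta> (\<theta> + \<beta>)) f z"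
proof -
  note [measurable] = causal_borel_measurable[OF f0 f]
  have [measurable]: "prabhakar_kernel \<nu> \<delta> \<eta> \<theta> \<in> borel_measurable borel"
    "prabhakar_kernel \<nu> \<delta> \<eta> (\<theta> + \<beta>) \<in> borel_measurable borel"
    using \<theta> \<beta> by (auto intro!: borel_measurable_prabhakar_kernel[OF \<nu> \<eta>])
  let ?s = "\<eta> powr (1 / \<nu>) + 1"
  have s: "?s > 0" using \<eta> by (simp add: add_pos_pos)
  obtain B where B: "\<And>x. x \<le> z \<Longrightarrow> \<bar>f x\<bar> \<le> B" using causal_bounded[OF f0 f] by blast
  have "convolve (power_kernel \<beta>) (convolve (prabhakar_kernel \<nu> \<delta> \<eta> \<theta>) f) z
      = convolve (convolve (power_kernel \<beta>) (prabhakar_kernel \<nu> \<delta> \<eta> \<theta>)) f z"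
  proof (rule convolution_assoc_causal[where s = ?s and B = B])
    show "integrable lborel (\<lambda>x. exp (- ?s * x) * power_kernel \<beta> x)"
      using has_bochner_integral_laplace_power_kernel[OF \<beta> s] by (simp add: has_bochner_integral_iff)
  qed (use s B f0 integrable_laplace_prabhakar_kernel[OF \<theta>] in \<open>auto simp: power_kernel_def prabhakar_kernel_def\<close>)
  also have "\<dots> = convolve (prabhakar_kernel \<nu> \<delta> \<eta> (\<theta> + \<beta>)) f z"
    by (rule convolution_cong_AE[OF convolution_power_prabhakar_kernel[OF \<nu> \<eta> \<theta> \<beta>]]) measurable
  finally show ?thesis .
qed

lemma isCont_convolution_prabhakar_kernel:
  assumes \<theta>: "\<theta> > 0" and f0: "\<And>x. x < 0 \<Longrightarrow> f x = 0" and f: "continuous_on {0..} f"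
  shows "isCont (convolve (prabhakar_kernel \<nu> \<delta> \<eta> \<theta>) f) z"
  by (rule isCont_convolution_causal[OF f0 f])
     (use \<theta> integrable_atMost_prabhakar_kernel borel_measurable_prabhakar_kernel[OF \<nu> \<eta>]
       in \<open>auto simp: prabhakar_kernel_def\<close>)

lemma convolution_prabhakar_kernel_causal:
  assumes f0: "\<And>x. x < 0 \<Longrightarrow> f x = 0" and "x < 0"
  shows "convolve (prabhakar_kernel \<nu> \<delta> \<eta> \<theta>) f x = 0"
  by (rule convolution_causal_eq_0) (use assms in \<open>auto simp: prabhakar_kernel_def\<close>)

text \<open>By the index shift with \<open>\<beta> = 1\<close>, the convolution of index
  \<open>\<theta> + 1\<close> is the integral of the continuous convolution of index
  \<open>\<theta>\<close>.\<close>

lemma has_real_derivative_convolution_prabhakar_kernel_Suc: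
  assumes \<theta>: "\<theta> > 0" and f0: "\<And>x. x < 0 \<Longrightarrow> f x = 0" and f: "continuous_on {0..} f" and z: "z > 0"
  shows "(convolve (prabhakar_kernel \<nu> \<delta> \<eta> (\<theta> + 1)) f has_real_derivative
    convolve (prabhakar_kernel \<nu> \<delta> \<eta> \<theta>) f z) (at z)"
proof -
  let ?G = "convolve (prabhakar_kernel \<nu> \<delta> \<eta> \<theta>) f"
  have cont: "continuous_on UNIV ?G"
    using isCont_convolution_prabhakar_kernel[OF \<theta> f0 f] by (simp add: continuous_on_eq_continuous_at)
  have "(convolve (power_kernel 1) ?G has_real_derivative ?G z) (at z)"
  proof (rule has_real_derivative_convolution_1[OF _ _ _ z])
    show "continuous_on {0<..} ?G" using cont by (rule continuous_on_subset) simp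
    show "?G \<in> borel_measurable borel" using cont by (rule borel_measurable_continuous_onI)
    fix R
    have "set_integrable lborel {0..R} ?G"
      by (rule borel_integrable_atLeastAtMost', rule continuous_on_subset[OF cont]) simp
    then show "integrable lborel (\<lambda>x. indicator {..R} x * ?G x)"
      unfolding set_integrable_def
      by (rule Bochner_Integration.integrable_cong[THEN iffD1, OF refl, rotated])
         (use convolution_prabhakar_kernel_causal[OF f0] in \<open>force simp: indicator_def\<close>)
  qed
  moreover have "convolve (power_kernel 1) ?G = convolve (prabhakar_kernel \<nu> \<delta> \<eta> (\<theta> + 1)) f"
    by (rule ext) (rule convolution_power_prabhakar_kernel_causal[OF \<theta> zero_less_one f0 f])
  ultimately show ?thesis by simp
qed

text \<open>Here the index is kept and the derivative falls on \<open>f\<close>. Writing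
  \<open>f\<close> as \<open>f 0\<close> plus the integral of \<open>f'\<close> splits the
  convolution into \<open>f 0\<close> times the integral of the kernel and the integral of the
  convolution with \<open>f'\<close>; the fundamental theorem differentiates both. The first summand
  is the trace of the jump of \<open>f\<close> at \<open>0\<close>.\<close>

lemma has_real_derivative_convolution_prabhakar_kernel_1:
  assumes \<theta>: "\<theta> > 0" and f0: "\<And>x. x < 0 \<Longrightarrow> f x = 0" and f: "continuous_on {0..} f"
    and f'0: "\<And>x. x < 0 \<Longrightarrow> f' x = 0" and f': "continuous_on {0..} f'"
    and ff': "\<And>z. z \<ge> 0 \<Longrightarrow> f z = f 0 + convolve (power_kernel 1) f' z" and z: "z > 0"
  shows "(convolve (prabhakar_kernel \<nu> \<delta> \<eta> \<theta>) f has_real_derivative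
    f 0 * prabhakar_kernel \<nu> \<delta> \<eta> \<theta> z + convolve (prabhakar_kernel \<nu> \<delta> \<eta> \<theta>) f' z) (at z)"
proof -
  let ?K = "prabhakar_kernel \<nu> \<delta> \<eta> \<theta>"
  note [measurable] = causal_borel_measurable[OF f0 f] causal_borel_measurable[OF f'0 f']
  have [measurable]: "?K \<in> borel_measurable borel"
    using borel_measurable_prabhakar_kernel[OF \<nu> \<eta> \<theta>] .
  have K_cont: "continuous_on {0<..} ?K"
    using isCont_prabhakar_kernel[OF \<nu> \<eta> \<theta>] by (auto simp: continuous_on_eq_continuous_at)
  have eq: "convolve ?K f x = f 0 * convolve (power_kernel 1) ?K x + convolve ?K (convolve (power_kernel 1) f') x" for x
  proof -
    have 1: "integrable lborel (\<lambda>y. ?K (x - y) * power_kernel 1 y)"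
    proof -
      have "integrable lborel (\<lambda>y. indicator {..x} (x - y) * ?K (x - y))"
        using lborel_integrable_real_affine[OF integrable_atMost_prabhakar_kernel[OF \<theta>, of x], of "-1" x] by simp
      then have "integrable lborel (\<lambda>y. indicator {0<..} y *\<^sub>R (indicator {..x} (x - y) * ?K (x - y)))"
        by (intro integrable_mult_indicator) auto
      then show ?thesis
        by (rule Bochner_Integration.integrable_cong[THEN iffD1, OF refl, rotated])
           (auto simp: power_kernel_1 indicator_def)
    qed
    have cont: "continuous_on UNIV (convolve (power_kernel 1) f')"
    proof -
      have "isCont (convolve (power_kernel 1) f') y" for y
      proof (rule isCont_convolution_causal[OF f'0 f'])
        show "integrable lborel (\<lambda>x. indicator {..R} x * power_kernel 1 x)" for R
        proof (rule integrable_atMost_if_laplace[where s = 1])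
          show "integrable lborel (\<lambda>x. exp (- 1 * x) * power_kernel 1 x)"
            using has_bochner_integral_laplace_power_kernel[of 1 1] by (simp add: has_bochner_integral_iff)
        qed auto
      qed (auto simp: power_kernel_def)
      then show ?thesis by (simp add: continuous_on_eq_continuous_at)
    qed
    obtain C where C: "\<And>y. y \<le> x \<Longrightarrow> \<bar>convolve (power_kernel 1) f' y\<bar> \<le> C"
    proof (rule causal_bounded)
      show "continuous_on {0..} (convolve (power_kernel 1) f')"
        using cont by (rule continuous_on_subset) simp
      show "convolve (power_kernel 1) f' y = 0" if "y < 0" for y
        using f'0 that by (intro convolution_causal_eq_0) (auto simp: power_kernel_def)
    qed blast
    have 2: "integrable lborel (\<lambda>y. ?K (x - y) * convolve (power_kernel 1) f' y)"
    proof (rule Bochner_Integration.integrable_bound)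
      show "integrable lborel (\<lambda>y. C * (?K (x - y) * power_kernel 1 y))"
        using 1 by (rule integrable_mult_right)
      show "AE y in lborel. norm (?K (x - y) * convolve (power_kernel 1) f' y) \<le> norm (C * (?K (x - y) * power_kernel 1 y))"
        using AE_lborel_singleton[of 0]
      proof eventually_elim
        case (elim y)
        consider "y < 0" | "y > x" | "0 < y" "y \<le> x" using elim by linarith
        then show ?case
        proof cases
          case 1
          then have "convolve (power_kernel 1) f' y = 0"
            using f'0 by (intro convolution_causal_eq_0) (auto simp: power_kernel_def)
          then show ?thesis by simp
        next
          case 2
          then show ?thesis by (simp add: prabhakar_kernel_def)
        next
          case 3
          then have "\<bar>convolve (power_kernel 1) f' y\<bar> \<le> \<bar>C\<bar>" using C[of y] by linarith
          then show ?thesis using 3 by (simp add: power_kernel_1 abs_mult mult_right_mono mult.commute[of "\<bar>?K (x - y)\<bar>"])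
        qed
      qed
    qed measurable
    have "convolve ?K f x = (\<integral>y. f 0 * (?K (x - y) * power_kernel 1 y) + ?K (x - y) * convolve (power_kernel 1) f' y \<partial>lborel)"
      unfolding convolve_def[of ?K]
    proof (rule integral_cong_AE)
      show "AE y in lborel. ?K (x - y) * f y = f 0 * (?K (x - y) * power_kernel 1 y) + ?K (x - y) * convolve (power_kernel 1) f' y"
        using AE_lborel_singleton[of 0]
      proof eventually_elim
        case (elim y)
        show ?case
        proof (cases "y < 0")
          case True
          then have "convolve (power_kernel 1) f' y = 0"
            using f'0 by (intro convolution_causal_eq_0) (auto simp: power_kernel_def)
          then show ?thesis using True f0[of y] by (simp add: power_kernel_def)
        next
          case False
          with elim have y: "y > 0" by simp
          show ?thesis unfolding ff'[OF less_imp_le[OF y]] using y by (simp add: power_kernel_1 algebra_simps)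
        qed
      qed
    qed measurable
    also have "\<dots> = f 0 * convolve ?K (power_kernel 1) x + convolve ?K (convolve (power_kernel 1) f') x"
      using 1 2 by (simp add: convolve_def[of ?K])
    finally show ?thesis unfolding convolution_commute[of ?K "power_kernel 1"] .
  qed
  have eq2: "convolve ?K (convolve (power_kernel 1) f') x = convolve (power_kernel 1) (convolve ?K f') x" for x
  proof -
    let ?s = "\<eta> powr (1 / \<nu>) + 1"
    have s: "?s > 0" using \<eta> by (simp add: add_pos_pos)
    obtain B where B: "\<And>y. y \<le> x \<Longrightarrow> \<bar>f' y\<bar> \<le> B" using causal_bounded[OF f'0 f'] by blast
    have p: "integrable lborel (\<lambda>x. exp (- ?s * x) * power_kernel 1 x)"
      using has_bochner_integral_laplace_power_kernel[OF zero_less_one s] by (simp add: has_bochner_integral_iff)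
    have "convolve ?K (convolve (power_kernel 1) f') x = convolve (convolve ?K (power_kernel 1)) f' x"
      by (rule convolution_assoc_causal[where s = ?s and B = B])
         (use s p B f'0 integrable_laplace_prabhakar_kernel[OF \<theta>] in \<open>auto simp: power_kernel_def prabhakar_kernel_def\<close>)
    also have "convolve ?K (power_kernel 1) = convolve (power_kernel 1) ?K"
      by (rule ext) (rule convolution_commute)
    also have "convolve (convolve (power_kernel 1) ?K) f' x = convolve (power_kernel 1) (convolve ?K f') x"
      by (rule convolution_assoc_causal[symmetric, where s = ?s and B = B])
         (use s p B f'0 integrable_laplace_prabhakar_kernel[OF \<theta>] in \<open>auto simp: power_kernel_def prabhakar_kernel_def\<close>)
    finally show ?thesis .
  qed
  have "(convolve (power_kernel 1) ?K has_real_derivative ?K z) (at z)"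
    by (rule has_real_derivative_convolution_1[OF K_cont _ integrable_atMost_prabhakar_kernel[OF \<theta>] z]) measurable
  moreover have "(convolve (power_kernel 1) (convolve ?K f') has_real_derivative convolve ?K f' z) (at z)"
  proof -
    have "convolve (power_kernel 1) (convolve ?K f') = convolve (prabhakar_kernel \<nu> \<delta> \<eta> (\<theta> + 1)) f'"
      by (rule ext) (rule convolution_power_prabhakar_kernel_causal[OF \<theta> zero_less_one f'0 f'])
    then show ?thesis
      using has_real_derivative_convolution_prabhakar_kernel_Suc[OF \<theta> f'0 f' z] by simp
  qed
  ultimately have "((\<lambda>x. f 0 * convolve (power_kernel 1) ?K x + convolve (power_kernel 1) (convolve ?K f') x)
    has_real_derivative f 0 * ?K z + convolve ?K f' z) (at z)"
    by (auto intro!: derivative_eq_intros)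
  moreover have "convolve ?K f = (\<lambda>x. f 0 * convolve (power_kernel 1) ?K x + convolve (power_kernel 1) (convolve ?K f') x)"
    unfolding eq2[symmetric] by (rule ext) (rule eq)
  ultimately show ?thesis by simp
qed

text \<open>Fractional integration of order \<open>\<beta> = k - (a + \<theta>)\<close> raises the
  index from \<open>\<theta>\<close> to \<open>k - a\<close>, so \<open>\<theta>\<close> cancels. Of
  the \<open>k\<close> derivatives, \<open>k - 1\<close> lower the index to \<open>1 - a\<close>;
  the last one acts on \<open>f\<close>, since a kernel of index \<open>- a\<close> is no longer
  available.\<close>

lemma prabhakar_derivative_eq:
  assumes \<theta>: "\<theta> > 0" and a: "0 < a" "a < 1" and f0: "\<And>x. x < 0 \<Longrightarrow> f x = 0" and f: "continuous_on {0..} f"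
    and f'0: "\<And>x. x < 0 \<Longrightarrow> f' x = 0" and f': "continuous_on {0..} f'"
    and ff': "\<And>z. z \<ge> 0 \<Longrightarrow> f z = f 0 + convolve (power_kernel 1) f' z" and x: "x > 0"
  shows "prabhakar_derivative \<theta> \<nu> a (- \<eta>) \<delta> f x
    = f 0 * prabhakar_kernel \<nu> \<delta> \<eta> (1 - a) x + convolve (prabhakar_kernel \<nu> \<delta> \<eta> (1 - a)) f' x"
proof -
  let ?K = "prabhakar_kernel \<nu> \<delta> \<eta>"
  define k where "k = nat \<lfloor>a + \<theta>\<rfloor> + 1"
  define \<beta> where "\<beta> = real k - (a + \<theta>)"
  have \<beta>: "\<beta> > 0" unfolding \<beta>_def k_def using a \<theta> by linarith
  have G: "Gamma \<beta> > 0" using \<beta> by (rule Gamma_real_pos)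
  \<comment> \<open>For \<open>i \<ge> 1\<close> the index \<open>i - a\<close> is positive because
    \<open>a < 1\<close>. The bottom entry \<open>H 0\<close> has another form: it is the derivative
    of \<open>H 1\<close> obtained by differentiating \<open>f\<close>.\<close>
  define H where "H = (\<lambda>i z. if i = 0 then f 0 * ?K (1 - a) z + convolve (?K (1 - a)) f' z
    else convolve (?K (real i - a)) f z)"
  define g where "g = (\<lambda>x. LBINT y:{0..x}. (x - y) powr (\<theta> - 1)
              * prabhakar_E \<nu> \<theta> (- \<delta>) (- \<eta> * (x - y) powr \<nu>) * f y)"
  have fm [measurable]: "f \<in> borel_measurable borel" by (rule causal_borel_measurable[OF f0 f])
  have [measurable]: "?K \<theta> \<in> borel_measurable borel"
    using borel_measurable_prabhakar_kernel[OF \<nu> \<eta> \<theta>] .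
  have [measurable]: "(prabhakar_E \<nu> \<theta> (- \<delta>) :: real \<Rightarrow> real) \<in> borel_measurable borel"
    using isCont_prabhakar_E[OF \<nu> \<eta> \<theta>, where \<delta> = \<delta>]
    by (intro borel_measurable_continuous_onI) (auto simp: continuous_on_eq_continuous_at)
  have g: "g y = convolve (?K \<theta>) f y" if "y > 0" for y
    unfolding g_def convolve_def set_lebesgue_integral_def
  proof (rule integral_cong_AE)
    show "AE u in lborel. indicator {0..y} u *\<^sub>R ((y - u) powr (\<theta> - 1) * prabhakar_E \<nu> \<theta> (- \<delta>) (- \<eta> * (y - u) powr \<nu>) * f u)
        = ?K \<theta> (y - u) * f u"
      using AE_lborel_singleton[of y]
      by eventually_elim (use f0 in \<open>auto simp: prabhakar_kernel_def indicator_def\<close>)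
  qed measurable
  have "(deriv ^^ k) (\<lambda>z. LBINT y:{0..z}. g y / (z - y) powr (a + \<theta> - real k + 1)) x = Gamma \<beta> * H 0 x"
  proof (rule iterated_deriv_eq[OF _ _ x])
    show "(H (Suc i) has_real_derivative H i z) (at z)" if z: "z > 0" for i z
    proof (cases "i = 0")
      case True
      have "1 - a > 0" using a by simp
      from has_real_derivative_convolution_prabhakar_kernel_1[OF this f0 f f'0 f' ff' z]
      show ?thesis using True by (simp add: H_def)
    next
      case False
      then have "real i - a > 0" using a by (cases i) auto
      from has_real_derivative_convolution_prabhakar_kernel_Suc[OF this f0 f z]
      show ?thesis using False by (simp add: H_def algebra_simps)
    qed
    show "(LBINT y:{0..z}. g y / (z - y) powr (a + \<theta> - real k + 1)) = Gamma \<beta> * H k z" if z: "z > 0" for z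
    proof -
      have "(LBINT y:{0..z}. g y / (z - y) powr (1 - \<beta>)) = Gamma \<beta> * convolve (power_kernel \<beta>) (convolve (?K \<theta>) f) z"
        by (rule set_integral_eq_convolution[OF \<beta> z convolution_prabhakar_kernel_causal[OF f0] _ g]) measurable
      also have "convolve (power_kernel \<beta>) (convolve (?K \<theta>) f) z = convolve (?K (\<theta> + \<beta>)) f z"
        by (rule convolution_power_prabhakar_kernel_causal[OF \<theta> \<beta> f0 f])
      also have "\<theta> + \<beta> = real k - a" by (simp add: \<beta>_def)
      finally show ?thesis by (simp add: H_def \<beta>_def k_def algebra_simps)
    qed
  qed
  then show ?thesis
    using G unfolding prabhakar_derivative_def RL_derivative_def Let_def k_def[symmetric] g_def[symmetric]
    by (simp add: \<beta>_def H_def)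
qed

end

section \<open>The symbol and the Levy measure\<close>

text \<open>The Laplace exponent, continued to complex arguments by principal powers.\<close>

definition laplace_symbol :: "real \<Rightarrow> real \<Rightarrow> real \<Rightarrow> complex \<Rightarrow> complex" where
  "laplace_symbol \<eta> \<nu> \<delta> z = (of_real \<eta> + z powr of_real \<nu>) powr of_real \<delta> - of_real (\<eta> powr \<delta>)"

context
  fixes \<eta> \<nu> \<delta> :: real
  assumes \<eta>: "\<eta> > 0" and \<nu>: "0 < \<nu>" "\<nu> < 1" and \<delta>: "\<delta> > 0" and \<nu>\<delta>: "\<nu> * \<delta> < 1"
begin

text \<open>In the closed right half-plane the argument is at most \<open>pi / 2\<close> in modulus;
  multiplied by \<open>\<nu> < 1\<close> it stays within the principal strip, so no multiple of
  \<open>2 * pi\<close> has to be corrected.\<close>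

lemma Ln_powr_of_real:
  assumes z: "z \<noteq> 0" "Re z \<ge> 0"
  shows "Ln (z powr of_real \<nu>) = of_real \<nu> * Ln z" "\<bar>Im (Ln (z powr of_real \<nu>))\<bar> \<le> \<nu> * (pi / 2)"
proof -
  have Im: "\<bar>Im (Ln z)\<bar> \<le> pi / 2" using z Re_Ln_pos_le by blast
  have "\<bar>\<nu> * Im (Ln z)\<bar> \<le> \<nu> * (pi / 2)"
    using Im \<nu> by (simp add: abs_mult)
  moreover have "\<nu> * (pi / 2) < pi"
  proof -
    have "\<nu> * (pi / 2) < 1 * (pi / 2)" using \<nu> by (intro mult_strict_right_mono) auto
    then show ?thesis by simp
  qed
  ultimately show *: "Ln (z powr of_real \<nu>) = of_real \<nu> * Ln z"
  proof -
    have "\<bar>Im (of_real \<nu> * Ln z)\<bar> < pi"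
      using le_less_trans[OF \<open>\<bar>\<nu> * Im (Ln z)\<bar> \<le> \<nu> * (pi / 2)\<close> \<open>\<nu> * (pi / 2) < pi\<close>] by simp
    then show ?thesis using z by (simp add: powr_def Ln_exp abs_less_iff)
  qed
  show "\<bar>Im (Ln (z powr of_real \<nu>))\<bar> \<le> \<nu> * (pi / 2)"
    unfolding * using \<open>\<bar>\<nu> * Im (Ln z)\<bar> \<le> \<nu> * (pi / 2)\<close> by simp
qed

lemma Re_powr_pos:
  assumes z: "z \<noteq> 0" "Re z \<ge> 0"
  shows "Re (z powr of_real \<nu>) > 0"
proof -
  have "\<bar>Im (Ln (z powr of_real \<nu>))\<bar> \<le> \<nu> * (pi / 2)" using Ln_powr_of_real(2)[OF z] .
  also have "\<dots> < 1 * (pi / 2)" using \<nu> by (intro mult_strict_right_mono) auto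
  finally have "\<bar>Im (Ln (z powr of_real \<nu>))\<bar> < pi / 2" by simp
  moreover have "z powr of_real \<nu> \<noteq> 0" using z by simp
  ultimately show ?thesis using Re_Ln_pos_lt by blast
qed

text \<open>As \<open>z powr \<nu>\<close> has positive real part, adding \<open>\<eta> > 0\<close>
  can only enlarge the modulus and shrink the argument. Both estimates are thus inherited from
  \<open>z powr \<nu>\<close>.\<close>

lemma laplace_symbol_base:
  assumes z: "z \<noteq> 0" "Re z \<ge> 0"
  defines "u \<equiv> of_real \<eta> + z powr of_real \<nu>"
  shows "Re u > 0" "u \<notin> \<real>\<^sub>\<le>\<^sub>0" "norm z powr \<nu> \<le> norm u" "\<bar>Im (Ln u)\<bar> \<le> \<nu> * (pi / 2)"
proof -
  define w where "w = z powr of_real \<nu>"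
  have w: "Re w > 0" unfolding w_def using z by (rule Re_powr_pos)
  then have w0: "w \<noteq> 0" by auto
  show Re: "Re u > 0" using w \<eta> by (simp add: u_def w_def)
  then show "u \<notin> \<real>\<^sub>\<le>\<^sub>0" by (auto simp: complex_nonpos_Reals_iff)
  have u0: "u \<noteq> 0" using Re by auto
  have comp: "Re u = \<eta> + Re w" "Im u = Im w" by (simp_all add: u_def w_def)
  have "norm w \<le> norm u"
    unfolding norm_complex_def comp using w \<eta> by (intro real_sqrt_le_mono add_right_mono power_mono) auto
  moreover have "norm w = norm z powr \<nu>" by (simp add: w_def norm_powr_real_powr')
  ultimately show "norm z powr \<nu> \<le> norm u" by simp
  have "Im (Ln u) = arctan (Im w / (\<eta> + Re w))" "Im (Ln w) = arctan (Im w / Re w)"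
    using Im_Ln_eq[OF u0] Im_Ln_eq[OF w0] Re w by (simp_all add: comp)
  moreover have "\<bar>arctan x\<bar> = arctan \<bar>x\<bar>" for x :: real by (simp add: abs_if arctan_minus)
  moreover have "\<bar>Im w / (\<eta> + Re w)\<bar> \<le> \<bar>Im w / Re w\<bar>"
    unfolding abs_divide using w \<eta> by (intro divide_left_mono) auto
  ultimately have "\<bar>Im (Ln u)\<bar> \<le> \<bar>Im (Ln w)\<bar>" by (simp add: arctan_le_iff)
  also have "\<dots> \<le> \<nu> * (pi / 2)" unfolding w_def by (rule Ln_powr_of_real(2)[OF z])
  finally show "\<bar>Im (Ln u)\<bar> \<le> \<nu> * (pi / 2)" .
qed

lemma cos_symbol_pos: "cos (\<nu> * \<delta> * (pi / 2)) > 0"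
proof -
  have "\<nu> * \<delta> * (pi / 2) < 1 * (pi / 2)" using \<nu>\<delta> by (intro mult_strict_right_mono) auto
  moreover have "\<nu> * \<delta> * (pi / 2) \<ge> 0" using \<nu> \<delta> by simp
  ultimately show ?thesis using pi_gt_zero by (intro cos_gt_zero_pi) linarith+
qed

text \<open>The argument of \<open>(\<eta> + z powr \<nu>) powr \<delta>\<close> is at most
  \<open>\<nu> * \<delta> * (pi / 2) < pi / 2\<close>, so the real part is at least a fixed positive
  fraction of the modulus. All decay of the characteristic function comes from here.\<close>

lemma Re_laplace_symbol_ge:
  assumes z: "z \<noteq> 0" "Re z \<ge> 0"
  shows "Re (laplace_symbol \<eta> \<nu> \<delta> z) \<ge> cos (\<nu> * \<delta> * (pi / 2)) * norm z powr (\<nu> * \<delta>) - \<eta> powr \<delta>"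
proof -
  define u where "u = of_real \<eta> + z powr of_real \<nu>"
  note base = laplace_symbol_base[OF z, folded u_def]
  have u0: "u \<noteq> 0" using base(1) by auto
  have "\<delta> * \<bar>Im (Ln u)\<bar> \<le> \<delta> * (\<nu> * (pi / 2))" using base(4) \<delta> by (intro mult_left_mono) auto
  also have "\<dots> = \<nu> * \<delta> * (pi / 2)" by simp
  finally have arg: "\<bar>\<delta> * Im (Ln u)\<bar> \<le> \<nu> * \<delta> * (pi / 2)" using \<delta> by (simp add: abs_mult)
  have "\<nu> * \<delta> * (pi / 2) \<le> 1 * pi" using \<nu>\<delta> \<nu> \<delta> by (intro mult_mono) auto
  then have "cos (\<nu> * \<delta> * (pi / 2)) \<le> cos \<bar>\<delta> * Im (Ln u)\<bar>"
    using arg by (intro cos_monotone_0_pi_le) auto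
  then have cos: "cos (\<nu> * \<delta> * (pi / 2)) \<le> cos (\<delta> * Im (Ln u))" by simp
  have "norm z powr (\<nu> * \<delta>) = (norm z powr \<nu>) powr \<delta>" by (simp add: powr_powr)
  also have "\<dots> \<le> norm u powr \<delta>" using base(3) \<delta> by (intro powr_mono2) auto
  finally have "cos (\<nu> * \<delta> * (pi / 2)) * norm z powr (\<nu> * \<delta>) \<le> cos (\<delta> * Im (Ln u)) * norm u powr \<delta>"
    using cos cos_symbol_pos by (intro mult_mono) auto
  also have "\<dots> = Re (u powr of_real \<delta>)"
    using u0 by (simp add: powr_def Re_exp Re_Ln mult.commute)
  finally show ?thesis by (simp add: laplace_symbol_def u_def)
qed

lemma laplace_symbol_of_real:
  assumes "s > 0"
  shows "laplace_symbol \<eta> \<nu> \<delta> (of_real s) = of_real ((\<eta> + s powr \<nu>) powr \<delta> - \<eta> powr \<delta>)"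
proof -
  have "complex_of_real s powr of_real \<nu> = of_real (s powr \<nu>)"
    using assms by (intro powr_of_real) auto
  moreover have "complex_of_real (\<eta> + s powr \<nu>) powr of_real \<delta> = of_real ((\<eta> + s powr \<nu>) powr \<delta>)"
    using \<eta> by (intro powr_of_real) auto
  ultimately show ?thesis by (simp add: laplace_symbol_def)
qed

lemma holomorphic_laplace_symbol: "laplace_symbol \<eta> \<nu> \<delta> holomorphic_on {z. Re z > 0}"
proof -
  have "of_real \<eta> + z powr of_real \<nu> \<notin> \<real>\<^sub>\<le>\<^sub>0" if "Re z > 0" for z
    by (rule laplace_symbol_base(2)) (use that in auto)
  then show ?thesis
    unfolding laplace_symbol_def[abs_def]
    by (intro holomorphic_on_diff holomorphic_on_powr holomorphic_on_add holomorphic_on_const holomorphic_on_ident)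
      (auto simp: complex_nonpos_Reals_iff)
qed

lemma isCont_laplace_symbol:
  assumes "\<xi> \<noteq> 0"
  shows "isCont (laplace_symbol \<eta> \<nu> \<delta>) (of_real \<xi> * \<i>)"
proof -
  have "of_real \<eta> + (of_real \<xi> * \<i>) powr of_real \<nu> \<notin> \<real>\<^sub>\<le>\<^sub>0"
    using laplace_symbol_base(2)[of "of_real \<xi> * \<i>"] assms by simp
  moreover have "of_real \<xi> * \<i> \<notin> \<real>\<^sub>\<le>\<^sub>0" using assms by (simp add: complex_nonpos_Reals_iff)
  ultimately show ?thesis
    unfolding laplace_symbol_def[abs_def] by (intro continuous_intros)
qed

lemma tendsto_laplace_symbol:
  assumes "\<xi> \<noteq> 0"
  shows "(\<lambda>n. laplace_symbol \<eta> \<nu> \<delta> (of_real (inverse (real (Suc n))) + of_real \<xi> * \<i>))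
    \<longlonglongrightarrow> laplace_symbol \<eta> \<nu> \<delta> (of_real \<xi> * \<i>)"
  by (rule isCont_tendsto_compose[OF isCont_laplace_symbol[OF assms] tendsto_imaginary_axis])

text \<open>Continuity is established away from the branch point; the single value at
  \<open>\<xi> = 0\<close> is patched in.\<close>

lemma borel_measurable_laplace_symbol_imaginary [measurable]:
  "(\<lambda>\<xi>. laplace_symbol \<eta> \<nu> \<delta> (of_real \<xi> * \<i>)) \<in> borel_measurable borel"
proof -
  have "(\<lambda>\<xi>. indicator (- {0}) \<xi> *\<^sub>R laplace_symbol \<eta> \<nu> \<delta> (of_real \<xi> * \<i>)) \<in> borel_measurable borel"
  proof (rule borel_measurable_continuous_on_indicator)
    show "continuous_on (- {0}) (\<lambda>\<xi>. laplace_symbol \<eta> \<nu> \<delta> (of_real \<xi> * \<i>))"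
    proof (intro continuous_at_imp_continuous_on ballI)
      fix \<xi> :: real assume "\<xi> \<in> - {0}"
      then have "isCont (laplace_symbol \<eta> \<nu> \<delta>) (of_real \<xi> * \<i>)" by (intro isCont_laplace_symbol) simp
      then show "isCont (\<lambda>\<xi>. laplace_symbol \<eta> \<nu> \<delta> (of_real \<xi> * \<i>)) \<xi>"
        by (rule isCont_o2[rotated]) simp
    qed
  qed auto
  then have "(\<lambda>\<xi>. if \<xi> = 0 then laplace_symbol \<eta> \<nu> \<delta> 0
      else indicator (- {0}) \<xi> *\<^sub>R laplace_symbol \<eta> \<nu> \<delta> (of_real \<xi> * \<i>)) \<in> borel_measurable borel"
    by measurable
  then show ?thesis
    by (rule measurable_cong[THEN iffD1, rotated]) auto
qed

text \<open>Once \<open>s \<ge> \<eta> powr (1 / \<nu>)\<close>, the base is at most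
  \<open>2 * s powr \<nu>\<close>; dividing by \<open>s\<close> leaves a multiple of
  \<open>s powr (\<nu> * \<delta> - 1)\<close>, which tends to \<open>0\<close>. The lemma is meant
  for the drift coefficient.\<close>

lemma no_linear_minorant:
  assumes "\<And>s. s > 0 \<Longrightarrow> b * s \<le> (\<eta> + s powr \<nu>) powr \<delta> - \<eta> powr \<delta>"
  shows "b \<le> 0"
proof (rule tendsto_lowerbound)
  have "((\<lambda>s. s powr (\<nu> * \<delta> - 1)) \<longlongrightarrow> 0) at_top"
    using \<nu>\<delta> by (intro tendsto_neg_powr filterlim_ident) auto
  then have "((\<lambda>s. 2 powr \<delta> * s powr (\<nu> * \<delta> - 1)) \<longlongrightarrow> 2 powr \<delta> * 0) at_top" by (intro tendsto_intros)
  then show "((\<lambda>s. 2 powr \<delta> * s powr (\<nu> * \<delta> - 1)) \<longlongrightarrow> 0) at_top" by simp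
  show "eventually (\<lambda>s. b \<le> 2 powr \<delta> * s powr (\<nu> * \<delta> - 1)) at_top"
    using eventually_ge_at_top[of "\<eta> powr (1 / \<nu>)"] eventually_gt_at_top[of 0]
  proof eventually_elim
    case (elim s)
    have "(\<eta> powr (1 / \<nu>)) powr \<nu> \<le> s powr \<nu>" using elim \<nu> by (intro powr_mono2) auto
    then have "\<eta> \<le> s powr \<nu>" using \<nu> \<eta> by (simp add: powr_powr)
    then have "(\<eta> + s powr \<nu>) powr \<delta> \<le> (2 * s powr \<nu>) powr \<delta>" using \<eta> \<delta> by (intro powr_mono2) auto
    also have "\<dots> = 2 powr \<delta> * s powr (\<nu> * \<delta> - 1) * s"
      using elim by (simp add: powr_mult powr_powr powr_diff)
    finally have "(\<eta> + s powr \<nu>) powr \<delta> \<le> 2 powr \<delta> * s powr (\<nu> * \<delta> - 1) * s" .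
    moreover have "\<eta> powr \<delta> \<ge> 0" by simp
    ultimately have "b * s \<le> 2 powr \<delta> * s powr (\<nu> * \<delta> - 1) * s"
      using assms[OF elim(2)] by linarith
    then show ?case using elim by (simp add: mult_le_cancel_right)
  qed
qed auto

end

text \<open>The weight \<open>1 + \<bar>\<xi>\<bar>\<close> pays for one space derivative or for one
  factor of the symbol, which grows at most linearly. The comparison function is a multiple of
  \<open>1 / (1 + \<xi>^2)\<close>, and \<open>C\<close> takes care of the bounded range
  \<open>\<bar>\<xi>\<bar> < S\<close>.\<close>

lemma integrable_stretched_exp:
  fixes \<kappa> a :: real
  assumes \<kappa>: "\<kappa> > 0" and a: "a > 0"
  shows "integrable lborel (\<lambda>\<xi>. (1 + \<bar>\<xi>\<bar>) * exp (- \<kappa> * \<bar>\<xi>\<bar> powr a))"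
proof -
  have "((\<lambda>x. (1 + x^2) * ((1 + x) * exp (- \<kappa> * x powr a))) \<longlongrightarrow> 0) at_top"
    using assms by real_asymp
  then have "eventually (\<lambda>x. dist ((1 + x^2) * ((1 + x) * exp (- \<kappa> * x powr a))) 0 < 1) at_top"
    by (rule tendstoD) simp
  then obtain R where R: "\<And>x. x \<ge> R \<Longrightarrow> \<bar>(1 + x^2) * ((1 + x) * exp (- \<kappa> * x powr a))\<bar> < 1"
    by (auto simp: eventually_at_top_linorder)
  define S where "S = max 1 \<bar>R\<bar>"
  define C where "C = (1 + S^2) * (1 + S)"
  have C1: "C \<ge> 1" unfolding C_def using mult_mono[of 1 "1 + S^2" 1 "1 + S"] by (simp add: S_def)
  have bd: "(1 + \<bar>\<xi>\<bar>) * exp (- \<kappa> * \<bar>\<xi>\<bar> powr a) \<le> C * inverse (1 + \<xi>^2)" for \<xi>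
  proof -
    have "(1 + \<xi>^2) * ((1 + \<bar>\<xi>\<bar>) * exp (- \<kappa> * \<bar>\<xi>\<bar> powr a)) \<le> C"
    proof (cases "\<bar>\<xi>\<bar> \<ge> S")
      case True
      then have "\<bar>\<xi>\<bar> \<ge> R" by (auto simp: S_def)
      from R[OF this] show ?thesis using C1 by simp
    next
      case False
      have "(1 + \<xi>^2) * ((1 + \<bar>\<xi>\<bar>) * exp (- \<kappa> * \<bar>\<xi>\<bar> powr a)) \<le> (1 + S^2) * ((1 + S) * 1)"
        using False \<kappa> by (intro mult_mono add_mono) (auto simp: abs_le_square_iff[symmetric] S_def)
      then show ?thesis by (simp add: C_def)
    qed
    moreover have "1 + \<xi>^2 > 0" by (simp add: add_pos_nonneg)
    ultimately show ?thesis by (simp add: field_simps)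
  qed
  have "integrable lborel (\<lambda>x::real. inverse (1 + x^2))"
    using integrable_inverse_1_plus_square by (simp add: set_integrable_def)
  then have "integrable lborel (\<lambda>x::real. C * inverse (1 + x^2))" by (rule integrable_mult_right)
  then show ?thesis
  proof (rule Bochner_Integration.integrable_bound)
    show "AE \<xi> in lborel. norm ((1 + \<bar>\<xi>\<bar>) * exp (- \<kappa> * \<bar>\<xi>\<bar> powr a)) \<le> norm (C * inverse (1 + \<xi>^2))"
    proof (intro AE_I2)
      fix \<xi> :: real
      have "norm ((1 + \<bar>\<xi>\<bar>) * exp (- \<kappa> * \<bar>\<xi>\<bar> powr a)) = (1 + \<bar>\<xi>\<bar>) * exp (- \<kappa> * \<bar>\<xi>\<bar> powr a)"
        by (simp add: abs_mult)
      also note bd[of \<xi>]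
      finally show "norm ((1 + \<bar>\<xi>\<bar>) * exp (- \<kappa> * \<bar>\<xi>\<bar> powr a)) \<le> norm (C * inverse (1 + \<xi>^2))" by simp
    qed
  qed measurable
qed

text \<open>A Levy measure is specified by its representation of the exponent at positive reals,
  with some drift \<open>b\<close>. The vanishing of \<open>b\<close>, the symbol on the imaginary
  axis and the tail of \<open>m\<close> are all extracted from that identity.\<close>

locale levy_symbol =
  fixes \<eta> \<nu> \<delta> b :: real and m :: "real measure"
  assumes \<eta>: "\<eta> > 0" and \<nu>: "0 < \<nu>" "\<nu> < 1" and \<delta>: "\<delta> > 0" and \<nu>\<delta>: "\<nu> * \<delta> < 1"
    and sets_m [measurable_cong, simp]: "sets m = sets borel"
    and null: "emeasure m {..0} = 0"
    and int_min: "set_integrable m {0<..} (\<lambda>x. min 1 x)"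
    and b: "b \<ge> 0"
    and levy_khintchine: "\<And>s. s > 0 \<Longrightarrow>
      (\<eta> + s powr \<nu>) powr \<delta> - \<eta> powr \<delta> = b * s + (LINT x:{0<..}|m. 1 - exp (- s * x))"
begin

abbreviation \<Phi> :: "complex \<Rightarrow> complex" where "\<Phi> \<equiv> laplace_symbol \<eta> \<nu> \<delta>"

lemma AE_pos: "AE x in m. x > 0"
proof (rule AE_I[of _ _ "{..0}"])
  show "{x \<in> space m. \<not> x > 0} \<subseteq> {..0}" by auto
qed (use null in auto)

lemma space_m [simp]: "space m = UNIV"
  using sets_eq_imp_space_eq[OF sets_m] by simp

lemma integrable_min: "integrable m (\<lambda>x. min 1 x)"
proof (rule integrable_cong_AE_imp)
  show "integrable m (\<lambda>x. indicator {0<..} x *\<^sub>R min 1 x)" using int_min by (simp add: set_integrable_def)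
  show "AE x in m. indicator {0<..} x *\<^sub>R min 1 x = min 1 x" using AE_pos by eventually_elim simp
qed measurable

definition W :: real where "W = (\<integral>x. min 1 x \<partial>m)"

lemma W_nonneg: "W \<ge> 0"
  unfolding W_def
proof (rule integral_nonneg_AE)
  show "AE x in m. 0 \<le> min 1 x" using AE_pos by eventually_elim simp
qed

text \<open>\<open>m\<close> may have infinite mass near \<open>0\<close>, so boundedness is no test
  of integrability; domination by \<open>min 1 x\<close> takes its place.\<close>

lemma integrable_min_bound:
  fixes f :: "real \<Rightarrow> 'b::{banach, second_countable_topology}"
  assumes [measurable]: "f \<in> borel_measurable borel" and bd: "\<And>x. x > 0 \<Longrightarrow> norm (f x) \<le> C * min 1 x"
  shows "integrable m f" "norm (\<integral>x. f x \<partial>m) \<le> C * W"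
proof -
  have AE: "AE x in m. norm (f x) \<le> C * min 1 x" using AE_pos by eventually_elim (rule bd)
  have int: "integrable m (\<lambda>x. C * min 1 x)" by (intro integrable_mult_right integrable_min)
  show f: "integrable m f"
    by (rule Bochner_Integration.integrable_bound[OF int])
       (measurable, use AE in eventually_elim, force)
  have "norm (\<integral>x. f x \<partial>m) \<le> (\<integral>x. norm (f x) \<partial>m)" by (rule integral_norm_bound)
  also have "\<dots> \<le> (\<integral>x. C * min 1 x \<partial>m)" using f int AE by (intro integral_mono_AE) auto
  finally show "norm (\<integral>x. f x \<partial>m) \<le> C * W" by (simp add: W_def)
qed

text \<open>Markov's inequality for \<open>min 1 x\<close>, which is at least \<open>min 1 u\<close>
  on \<open>{u<..}\<close>.\<close>

lemma emeasure_greaterThan_finite: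
  assumes "u > 0"
  shows "emeasure m {u<..} < \<infinity>"
proof -
  have "emeasure m {u<..} = (\<integral>\<^sup>+x. indicator {u<..} x \<partial>m)" by simp
  also have "\<dots> \<le> (\<integral>\<^sup>+x. ennreal (1 / min 1 u) * ennreal (min 1 x) \<partial>m)"
  proof (rule nn_integral_mono)
    fix x
    show "indicator {u<..} x \<le> ennreal (1 / min 1 u) * ennreal (min 1 x)"
    proof (cases "x > u")
      case True
      then have "1 \<le> 1 / min 1 u * min 1 x" using assms by (simp add: field_simps min_def)
      then have "ennreal 1 \<le> ennreal (1 / min 1 u * min 1 x)" by (rule ennreal_leI)
      also have "ennreal (1 / min 1 u * min 1 x) = ennreal (1 / min 1 u) * ennreal (min 1 x)"
        using assms True by (intro ennreal_mult) auto
      finally show ?thesis using True by simp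
    qed simp
  qed
  also have "\<dots> = ennreal (1 / min 1 u) * ennreal W"
    using AE_pos unfolding W_def
    by (subst nn_integral_cmult) (auto intro!: nn_integral_eq_integral[OF integrable_min] arg_cong2[where f = "(*)"])
  also have "\<dots> < \<infinity>" by (simp add: ennreal_mult_less_top)
  finally show ?thesis .
qed

lemma sigma_finite_m: "sigma_finite_measure m"
proof
  show "\<exists>A. countable A \<and> A \<subseteq> sets m \<and> \<Union> A = space m \<and> (\<forall>a\<in>A. emeasure m a \<noteq> \<infinity>)"
  proof (intro exI[of _ "insert {..0} (range (\<lambda>n. {inverse (real (Suc n))<..}))"] conjI ballI)
    show "\<Union> (insert {..0} (range (\<lambda>n. {inverse (real (Suc n))<..}))) = space m"
    proof -
      have "\<exists>n. inverse (real (Suc n)) < x" if "x > 0" for x :: real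
        using reals_Archimedean[OF that] by simp
      then have "x \<in> \<Union> (insert {..0} (range (\<lambda>n. {inverse (real (Suc n))<..})))" for x :: real
        by (cases "x > 0") (simp_all del: of_nat_Suc)
      then show ?thesis unfolding space_m by blast
    qed
    show "emeasure m a \<noteq> \<infinity>" if "a \<in> insert {..0} (range (\<lambda>n. {inverse (real (Suc n))<..}))" for a
      using that null emeasure_greaterThan_finite[of "inverse (real (Suc n))" for n] by (auto simp: less_top)
  qed auto
qed

sublocale m: sigma_finite_measure m by (rule sigma_finite_m)

lemma norm_one_minus_exp:
  fixes z :: complex
  assumes "x > 0" "Re z \<ge> 0"
  shows "norm (1 - exp (- z * of_real x)) \<le> (2 + norm z) * min 1 x"
  using assms by (intro norm_exp_diff_le) auto

lemma one_minus_exp_le: "x > 0 \<Longrightarrow> s > 0 \<Longrightarrow> norm (1 - exp (- s * x)) \<le> (2 + s) * min 1 (x::real)"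
proof -
  assume x: "x > 0" and s: "s > 0"
  have "1 - exp (- of_real s * of_real x) = complex_of_real (1 - exp (- s * x))"
    by (simp flip: exp_of_real)
  then have "norm (1 - exp (- of_real s * of_real x) :: complex) = norm (1 - exp (- s * x))"
    by (simp only: norm_of_real real_norm_def)
  then show ?thesis using norm_one_minus_exp[OF x, of "of_real s"] s by simp
qed

text \<open>The integral is nonnegative, so the drift term is a linear minorant of a sublinear
  function; hence \<open>b = 0\<close>.\<close>

lemma integral_one_minus_exp:
  assumes s: "s > 0"
  shows "(\<integral>x. 1 - exp (- s * x) \<partial>m) = (\<eta> + s powr \<nu>) powr \<delta> - \<eta> powr \<delta>"
proof -
  have set: "(LINT x:{0<..}|m. 1 - exp (- s * x)) = (\<integral>x. 1 - exp (- s * x) \<partial>m)" for s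
    unfolding set_lebesgue_integral_def
    by (intro integral_cong_AE, measurable, use AE_pos in eventually_elim) simp
  have "b * s \<le> (\<eta> + s powr \<nu>) powr \<delta> - \<eta> powr \<delta>" if "s > 0" for s
  proof -
    have "0 \<le> (\<integral>x. 1 - exp (- s * x) \<partial>m)"
      using AE_pos by (intro integral_nonneg_AE, eventually_elim) (use that in auto)
    then show ?thesis using levy_khintchine[OF that] unfolding set by simp
  qed
  then have "b \<le> 0" by (rule no_linear_minorant[OF \<eta> \<nu> \<delta> \<nu>\<delta>])
  with b have "b = 0" by simp
  with levy_khintchine[OF s] show ?thesis unfolding set by simp
qed

text \<open>Both sides are limits of one sequence of values of the symbol in the open half-plane:
  the integral by dominated convergence, the symbol by its continuity off \<open>0\<close>.\<close>

lemma integral_one_minus_iexp: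
  assumes \<xi>: "\<xi> \<noteq> 0"
  shows "(\<integral>x. 1 - exp (- (of_real \<xi> * \<i>) * of_real x) \<partial>m) = \<Phi> (of_real \<xi> * \<i>)"
proof (rule LIMSEQ_unique)
  have ind: "(\<integral>x. indicator {0..} x *\<^sub>R (1 - exp (- z * of_real x)) \<partial>m) = (\<integral>x. 1 - exp (- z * of_real x) \<partial>m)" for z :: complex
    by (intro integral_cong_AE, measurable, use AE_pos in eventually_elim) simp
  have "(\<lambda>n. \<Phi> (of_real (inverse (real (Suc n))) + of_real \<xi> * \<i>))
    \<longlonglongrightarrow> (\<integral>x. indicator {0..} x *\<^sub>R (1 - exp (- (of_real \<xi> * \<i>) * of_real x)) \<partial>m)"
  proof (rule laplace_integral_boundary_value[where w = "\<lambda>x. min 1 x"])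
    show "integrable m (\<lambda>x. indicator {0..} x * min 1 x)"
      using integrable_mult_indicator[OF _ integrable_min, of "{0..}"] by simp
    show "\<Phi> holomorphic_on {z. Re z > 0}" by (rule holomorphic_laplace_symbol[OF \<eta> \<nu> \<delta> \<nu>\<delta>])
    show "(\<integral>x. indicator {0..} x *\<^sub>R (1 - exp (- of_real s * of_real x)) \<partial>m) = \<Phi> (of_real s)" if "s > 0" for s
    proof -
      have "(\<integral>x. 1 - exp (- of_real s * of_real x) \<partial>m) = (\<integral>x. complex_of_real (1 - exp (- s * x)) \<partial>m)"
        by (intro Bochner_Integration.integral_cong) (simp_all flip: exp_of_real)
      also have "\<dots> = of_real (\<integral>x. 1 - exp (- s * x) \<partial>m)" by (rule integral_complex_of_real)
      also have "\<dots> = \<Phi> (of_real s)"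
        unfolding integral_one_minus_exp[OF that] laplace_symbol_of_real[OF \<eta> \<nu> \<delta> \<nu>\<delta> that] ..
      finally show ?thesis unfolding ind .
    qed
    show "norm (1 - exp (- z * of_real x)) \<le> (2 + norm z) * min 1 x" if "Re z \<ge> 0" "x \<ge> 0" for z :: complex and x
      using that by (rule norm_exp_diff_le)
  qed auto
  then show "(\<lambda>n. \<Phi> (of_real (inverse (real (Suc n))) + of_real \<xi> * \<i>))
    \<longlonglongrightarrow> (\<integral>x. 1 - exp (- (of_real \<xi> * \<i>) * of_real x) \<partial>m)"
    unfolding ind .
  show "(\<lambda>n. \<Phi> (of_real (inverse (real (Suc n))) + of_real \<xi> * \<i>)) \<longlonglongrightarrow> \<Phi> (of_real \<xi> * \<i>)"
    by (rule tendsto_laplace_symbol[OF \<eta> \<nu> \<delta> \<nu>\<delta> \<xi>])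
qed

lemma norm_laplace_symbol_le:
  assumes \<xi>: "\<xi> \<noteq> 0"
  shows "norm (\<Phi> (of_real \<xi> * \<i>)) \<le> (2 + \<bar>\<xi>\<bar>) * W"
  unfolding integral_one_minus_iexp[OF \<xi>, symmetric]
proof (rule integrable_min_bound(2))
  show "norm (1 - exp (- (of_real \<xi> * \<i>) * of_real x)) \<le> (2 + \<bar>\<xi>\<bar>) * min 1 x" if "x > 0" for x
    using norm_one_minus_exp[OF that, of "of_real \<xi> * \<i>"] by (simp add: norm_mult)
qed measurable

text \<open>Setting it to \<open>0\<close> on the nonpositive numbers, where the mass may be
  infinite, makes it causal and fit for convolution.\<close>

definition tail :: "real \<Rightarrow> real" where
  "tail u = (if u > 0 then measure m {u<..} else 0)"

lemma tail_eq: "u > 0 \<Longrightarrow> ennreal (tail u) = (\<integral>\<^sup>+y. indicator {u<..} y \<partial>m)"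
  using emeasure_greaterThan_finite[of u] by (simp add: tail_def emeasure_eq_ennreal_measure less_top)

lemma borel_measurable_tail [measurable]: "tail \<in> borel_measurable borel"
proof -
  have "(\<lambda>u. enn2real (\<integral>\<^sup>+y. (if u < y \<and> 0 < u then 1 else 0) \<partial>m)) \<in> borel_measurable borel"
    by measurable
  moreover have "enn2real (\<integral>\<^sup>+y. (if u < y \<and> 0 < u then 1 else 0) \<partial>m) = tail u" for u
  proof (cases "u > 0")
    case True
    then have "(\<integral>\<^sup>+y. (if u < y \<and> 0 < u then 1 else 0) \<partial>m) = ennreal (tail u)"
      unfolding tail_eq[OF True] by (intro nn_integral_cong) auto
    then show ?thesis by (simp add: tail_def)
  qed (simp add: tail_def)
  ultimately show ?thesis by simp
qed

text \<open>Tonelli on the region \<open>0 < u < y\<close>: integrating \<open>exp (- s * u)\<close>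
  over \<open>u\<close> first leaves \<open>(1 - exp (- s * y)) / s\<close>, whose integral against
  \<open>m\<close> is the Laplace exponent divided by \<open>s\<close>.\<close>

lemma has_bochner_integral_laplace_tail:
  assumes s: "s > 0"
  shows "has_bochner_integral lborel (\<lambda>u. exp (- s * u) * tail u) (((\<eta> + s powr \<nu>) powr \<delta> - \<eta> powr \<delta>) / s)"
proof (rule has_bochner_integral_nn_integral)
  interpret pair_sigma_finite m lborel ..
  have inner: "(\<integral>\<^sup>+u. ennreal (exp (- s * u)) * indicator {0<..<y} u \<partial>lborel) = ennreal ((1 - exp (- s * y)) / s)"
    if "y > 0" for y
  proof -
    have "(\<integral>\<^sup>+u. ennreal (exp (- s * u)) * indicator {0<..<y} u \<partial>lborel)
      = (\<integral>\<^sup>+u. ennreal (exp (- s * u)) * indicator {0..y} u \<partial>lborel)"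
    proof (rule nn_integral_cong_AE)
      show "AE u in lborel. ennreal (exp (- s * u)) * indicator {0<..<y} u = ennreal (exp (- s * u)) * indicator {0..y} u"
        using AE_lborel_singleton[of 0] AE_lborel_singleton[of y] by eventually_elim (auto simp: indicator_def)
    qed
    also have "\<dots> = ennreal (- exp (- s * y) / s - (- exp (- s * 0) / s))"
      by (rule nn_integral_FTC_Icc) (use s that in \<open>auto intro!: derivative_eq_intros\<close>)
    also have "- exp (- s * y) / s - (- exp (- s * 0) / s) = (1 - exp (- s * y)) / s"
      by (simp add: diff_divide_distrib)
    finally show ?thesis .
  qed
  have "(\<integral>\<^sup>+u. ennreal (exp (- s * u) * tail u) \<partial>lborel)
    = (\<integral>\<^sup>+u. \<integral>\<^sup>+y. (if 0 < u \<and> u < y then ennreal (exp (- s * u)) else 0) \<partial>m \<partial>lborel)"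
  proof (rule nn_integral_cong)
    fix u
    show "ennreal (exp (- s * u) * tail u) = (\<integral>\<^sup>+y. (if 0 < u \<and> u < y then ennreal (exp (- s * u)) else 0) \<partial>m)"
    proof (cases "u > 0")
      case True
      have "ennreal (exp (- s * u) * tail u) = ennreal (exp (- s * u)) * (\<integral>\<^sup>+y. indicator {u<..} y \<partial>m)"
        by (simp add: ennreal_mult' flip: tail_eq[OF True])
      also have "\<dots> = (\<integral>\<^sup>+y. ennreal (exp (- s * u)) * indicator {u<..} y \<partial>m)"
        by (simp add: nn_integral_cmult)
      also have "\<dots> = (\<integral>\<^sup>+y. (if 0 < u \<and> u < y then ennreal (exp (- s * u)) else 0) \<partial>m)"
        by (intro nn_integral_cong) (use True in auto)
      finally show ?thesis .
    qed (simp add: tail_def)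
  qed
  also have "\<dots> = (\<integral>\<^sup>+y. \<integral>\<^sup>+u. (if 0 < u \<and> u < y then ennreal (exp (- s * u)) else 0) \<partial>lborel \<partial>m)"
    by (rule Fubini') measurable
  also have "\<dots> = (\<integral>\<^sup>+y. ennreal ((1 - exp (- s * y)) / s) \<partial>m)"
  proof (rule nn_integral_cong_AE, use AE_pos in eventually_elim)
    fix y :: real assume "y > 0"
    have "(\<integral>\<^sup>+u. (if 0 < u \<and> u < y then ennreal (exp (- s * u)) else 0) \<partial>lborel)
      = (\<integral>\<^sup>+u. ennreal (exp (- s * u)) * indicator {0<..<y} u \<partial>lborel)"
      by (intro nn_integral_cong) auto
    then show "(\<integral>\<^sup>+u. (if 0 < u \<and> u < y then ennreal (exp (- s * u)) else 0) \<partial>lborel)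
      = ennreal ((1 - exp (- s * y)) / s)" unfolding inner[OF \<open>y > 0\<close>] .
  qed
  also have "\<dots> = ennreal (\<integral>y. (1 - exp (- s * y)) / s \<partial>m)"
  proof (rule nn_integral_eq_integral)
    have "integrable m (\<lambda>y. 1 - exp (- s * y))"
      by (rule integrable_min_bound(1)[where C = "2 + s"]) (measurable, use one_minus_exp_le s in auto)
    then show "integrable m (\<lambda>y. (1 - exp (- s * y)) / s)" by simp
    show "AE y in m. 0 \<le> (1 - exp (- s * y)) / s" using AE_pos by eventually_elim (use s in auto)
  qed
  also have "(\<integral>y. (1 - exp (- s * y)) / s \<partial>m) = ((\<eta> + s powr \<nu>) powr \<delta> - \<eta> powr \<delta>) / s"
    using integral_one_minus_exp[OF s] by simp
  finally show "(\<integral>\<^sup>+u. ennreal (exp (- s * u) * tail u) \<partial>lborel) = ennreal (((\<eta> + s powr \<nu>) powr \<delta> - \<eta> powr \<delta>) / s)" .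
  have "\<eta> powr \<delta> \<le> (\<eta> + s powr \<nu>) powr \<delta>" using \<eta> \<delta> by (intro powr_mono2) auto
  then show "0 \<le> ((\<eta> + s powr \<nu>) powr \<delta> - \<eta> powr \<delta>) / s" using s by simp
  show "AE u in lborel. 0 \<le> exp (- s * u) * tail u" by (auto simp: tail_def)
qed measurable

abbreviation K :: "real \<Rightarrow> real" where "K \<equiv> prabhakar_kernel \<nu> \<delta> \<eta> (1 - \<nu> * \<delta>)"

text \<open>For large \<open>s\<close> both transforms equal
  \<open>(\<eta> + s powr \<nu>) powr \<delta> / s\<close>; the multiple of
  \<open>power_kernel 1\<close> restores the subtracted
  \<open>\<eta> powr \<delta> / s\<close>.\<close>

lemma AE_tail_eq: "AE u in lborel. tail u + \<eta> powr \<delta> * power_kernel 1 u = K u"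
proof (rule AE_eq_if_laplace_eq[where c = "\<eta> powr (1 / \<nu>) + 1"])
  fix s assume "s \<ge> \<eta> powr (1 / \<nu>) + 1"
  then have s: "s > \<eta> powr (1 / \<nu>)" by simp
  note s' = laplace_parameter_large[OF \<nu>(1) \<eta> s]
  have "1 - \<nu> * \<delta> > 0" using \<nu>\<delta> by simp
  from has_bochner_integral_laplace_prabhakar_kernel[OF \<nu>(1) \<eta> this s, of \<delta>]
  have "has_bochner_integral lborel (\<lambda>x. exp (- s * x) * K x)
      (s powr (- (1 - \<nu> * \<delta>)) * (1 + \<eta> * s powr (- \<nu>)) powr \<delta>)" .
  moreover have "s powr (- (1 - \<nu> * \<delta>)) * (1 + \<eta> * s powr (- \<nu>)) powr \<delta> = (\<eta> + s powr \<nu>) powr \<delta> / s"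
  proof -
    have "s powr (- (1 - \<nu> * \<delta>)) = (s powr \<nu>) powr \<delta> / s" using s' by (simp add: powr_powr powr_diff)
    moreover have "(s powr \<nu>) powr \<delta> * (1 + \<eta> * s powr (- \<nu>)) powr \<delta> = (s powr \<nu> * (1 + \<eta> * s powr (- \<nu>))) powr \<delta>"
      using s' \<eta> by (intro powr_mult[symmetric])
    moreover have "s powr \<nu> * (1 + \<eta> * s powr (- \<nu>)) = \<eta> + s powr \<nu>"
      using s' by (simp add: powr_minus field_simps)
    ultimately show ?thesis by simp
  qed
  ultimately show "has_bochner_integral lborel (\<lambda>x. exp (- s * x) * K x) ((\<eta> + s powr \<nu>) powr \<delta> / s)" by simp
  have "has_bochner_integral lborel (\<lambda>x. exp (- s * x) * tail x + \<eta> powr \<delta> * (exp (- s * x) * power_kernel 1 x))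
    (((\<eta> + s powr \<nu>) powr \<delta> - \<eta> powr \<delta>) / s + \<eta> powr \<delta> * s powr (- 1))"
    by (intro has_bochner_integral_add has_bochner_integral_mult_right has_bochner_integral_laplace_tail
      has_bochner_integral_laplace_power_kernel s') auto
  moreover have "((\<eta> + s powr \<nu>) powr \<delta> - \<eta> powr \<delta>) / s + \<eta> powr \<delta> * s powr (- 1) = (\<eta> + s powr \<nu>) powr \<delta> / s"
    using s' by (simp add: powr_minus field_simps)
  ultimately show "has_bochner_integral lborel (\<lambda>x. exp (- s * x) * (tail x + \<eta> powr \<delta> * power_kernel 1 x)) ((\<eta> + s powr \<nu>) powr \<delta> / s)"
    by (simp add: algebra_simps)
qed (auto simp: tail_def power_kernel_def prabhakar_kernel_def)

text \<open>Approach from the right is essential: only then do the indicators of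
  \<open>{X n<..}\<close> converge at \<open>x\<close> too, where \<open>m\<close> could a priori
  have an atom.\<close>

lemma tail_right_continuous:
  assumes x: "x > 0" and X: "\<And>n. X n > x" "X \<longlonglongrightarrow> x"
  shows "(\<lambda>n. tail (X n)) \<longlonglongrightarrow> tail x"
proof -
  have int: "integrable m (indicator {x<..} :: real \<Rightarrow> real)"
    using emeasure_greaterThan_finite[OF x] by (simp add: integrable_indicator_iff)
  have "(\<lambda>n. \<integral>y. indicator {X n<..} y \<partial>m) \<longlonglongrightarrow> (\<integral>y. indicator {x<..} y \<partial>m :: real)"
  proof (rule integral_dominated_convergence[OF _ _ int])
    show "AE y in m. (\<lambda>n. indicator {X n<..} y :: real) \<longlonglongrightarrow> indicator {x<..} y"
    proof (intro AE_I2)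
      fix y
      have "eventually (\<lambda>n. indicator {X n<..} y = (indicator {x<..} y :: real)) sequentially"
      proof (cases "y > x")
        case True
        then have "eventually (\<lambda>n. X n < y) sequentially" using order_tendstoD(2)[OF X(2)] by auto
        then show ?thesis by eventually_elim (use True in simp)
      next
        case False
        then have "\<not> X n < y" for n using X(1)[of n] by linarith
        then show ?thesis using False by simp
      qed
      then show "(\<lambda>n. indicator {X n<..} y :: real) \<longlonglongrightarrow> indicator {x<..} y"
        by (rule tendsto_eventually)
    qed
    show "AE y in m. norm (indicator {X n<..} y :: real) \<le> indicator {x<..} y" for n
      using less_trans[OF X(1)[of n]] by (intro AE_I2) (auto simp: indicator_def)
  qed measurable
  moreover have "X n > 0" for n using X(1)[of n] x by linarith
  ultimately show ?thesis using x by (simp add: tail_def)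
qed

text \<open>Points where the two sides agree are chosen to the right of \<open>x\<close> and tending
  to it; right continuity of the tail and continuity of the kernel transfer the equality to
  \<open>x\<close>.\<close>

lemma tail_eq_kernel:
  assumes x: "x > 0"
  shows "tail x = K x - \<eta> powr \<delta>"
proof -
  have "\<exists>u. x < u \<and> u < x + inverse (real (Suc n)) \<and> tail u + \<eta> powr \<delta> * power_kernel 1 u = K u" for n
    by (rule AE_lborel_between[OF AE_tail_eq]) simp
  then obtain X where X: "\<And>n. x < X n" "\<And>n. X n < x + inverse (real (Suc n))"
    "\<And>n. tail (X n) + \<eta> powr \<delta> * power_kernel 1 (X n) = K (X n)" by metis
  have lim: "X \<longlonglongrightarrow> x"
  proof (rule tendsto_sandwich)
    show "eventually (\<lambda>n. x \<le> X n) sequentially" using X(1) by (simp add: less_imp_le)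
    show "eventually (\<lambda>n. X n \<le> x + inverse (real (Suc n))) sequentially" using X(2) by (simp add: less_imp_le)
    show "(\<lambda>n. x + inverse (real (Suc n))) \<longlonglongrightarrow> x"
      using tendsto_add[OF tendsto_const LIMSEQ_inverse_real_of_nat, of x] by simp
  qed simp
  have "isCont K x" using \<nu>\<delta> x by (intro isCont_prabhakar_kernel[OF \<nu>(1) \<eta>]) auto
  then have "(\<lambda>n. K (X n) - \<eta> powr \<delta>) \<longlonglongrightarrow> K x - \<eta> powr \<delta>"
    by (intro tendsto_diff tendsto_const isCont_tendsto_compose[OF _ lim])
  moreover have "K (X n) - \<eta> powr \<delta> = tail (X n)" for n
    using X(1)[of n] X(3)[of n] x by (simp add: power_kernel_1)
  ultimately have "(\<lambda>n. tail (X n)) \<longlonglongrightarrow> K x - \<eta> powr \<delta>" by simp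
  with tail_right_continuous[OF x X(1) lim] show ?thesis by (rule LIMSEQ_unique)
qed

end

section \<open>The operator \<open>Theta\<close> on continuously differentiable functions\<close>

lemma integrable_convolution_causal:
  fixes g h :: "real \<Rightarrow> real"
  assumes g0: "\<And>x. x < 0 \<Longrightarrow> g x = 0" and g: "continuous_on {0..} g"
    and h0: "\<And>x. x < 0 \<Longrightarrow> h x = 0" and [measurable]: "h \<in> borel_measurable borel"
    and h: "integrable lborel (\<lambda>y. indicator {..x} y * h y)"
  shows "integrable lborel (\<lambda>y. g (x - y) * h y)"
proof -
  have [measurable]: "g \<in> borel_measurable borel" using g0 g by (rule causal_borel_measurable)
  obtain B where B: "B \<ge> 0" "\<And>y. y \<le> x \<Longrightarrow> \<bar>g y\<bar> \<le> B" using causal_bounded[OF g0 g] by blast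
  show ?thesis
  proof (rule Bochner_Integration.integrable_bound)
    show "integrable lborel (\<lambda>y. B * (indicator {..x} y * h y))" using h by (rule integrable_mult_right)
    show "AE y in lborel. norm (g (x - y) * h y) \<le> norm (B * (indicator {..x} y * h y))"
    proof (intro AE_I2)
      fix y
      show "norm (g (x - y) * h y) \<le> norm (B * (indicator {..x} y * h y))"
      proof (cases "y < 0 \<or> y > x")
        case True
        then have "g (x - y) * h y = 0" using h0[of y] g0[of "x - y"] by auto
        then show ?thesis by (simp only:) simp
      next
        case False
        then have "\<bar>g (x - y)\<bar> \<le> B" by (intro B) auto
        then show ?thesis using False B(1) by (simp add: abs_mult mult_right_mono)
      qed
    qed
    show "(\<lambda>y. g (x - y) * h y) \<in> borel_measurable lborel" by measurable
  qed
qed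

context levy_symbol
begin

text \<open>Integration by parts in the guise of Fubini: \<open>f x - f (x - y)\<close> is the
  integral of \<open>f' (x - u)\<close> over \<open>0 < u < y\<close>, plus \<open>f 0\<close> if
  \<open>y > x\<close>, when \<open>x - y\<close> has crossed the jump at \<open>0\<close>. After
  the swap every \<open>u\<close> collects the mass of \<open>{u<..}\<close>.\<close>

lemma Theta_eq_tail:
  assumes f0: "\<And>x. x < 0 \<Longrightarrow> f x = 0"
    and f'0: "\<And>x. x < 0 \<Longrightarrow> f' x = 0" and f': "continuous_on {0..} f'"
    and ff': "\<And>z. z \<ge> 0 \<Longrightarrow> f z = f 0 + convolve (power_kernel 1) f' z" and x: "x > 0"
  shows "set_integrable m {0<..} (\<lambda>y. f x - f (x - y))"
    and "Theta m f x = f 0 * tail x + convolve tail f' x"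
proof -
  interpret pair_sigma_finite m lborel ..
  have f'm [measurable]: "f' \<in> borel_measurable borel" using f'0 f' by (rule causal_borel_measurable)
  obtain B where B: "B \<ge> 0" "\<And>y. y \<le> x \<Longrightarrow> \<bar>f' y\<bar> \<le> B" using causal_bounded[OF f'0 f'] by blast
  define g where "g = (\<lambda>y u. (if 0 < u \<and> u < y then f' (x - u) else 0))"
  have gm [measurable]: "(\<lambda>(y, u). g y u) \<in> borel_measurable (m \<Otimes>\<^sub>M lborel)"
    unfolding g_def by measurable
  have g_bd: "\<bar>g y u\<bar> \<le> B * indicator {0..min x y} u" for y u
    using B(1) B(2)[of "x - u"] f'0[of "x - u"] by (auto simp: g_def indicator_def)
  have bd_int: "integrable lborel (\<lambda>u. B * indicator {0..min x y} u)" for y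
    by (cases "0 \<le> min x y") auto
  have g_int: "integrable lborel (g y)" for y
  proof (rule Bochner_Integration.integrable_bound[OF bd_int[of y]])
    show "AE u in lborel. norm (g y u) \<le> norm (B * indicator {0..min x y} u)"
      using order_trans[OF g_bd abs_ge_self] by auto
    show "g y \<in> borel_measurable lborel" unfolding g_def by measurable
  qed
  have gg: "integrable (m \<Otimes>\<^sub>M lborel) (\<lambda>(y, u). g y u)"
  proof (rule Fubini_integrable)
    show "integrable m (\<lambda>y. \<integral>u. norm (case (y, u) of (y, u) \<Rightarrow> g y u) \<partial>lborel)"
    proof (rule integrable_min_bound(1)[where C = "B * (1 + x)"])
      show "(\<lambda>y. \<integral>u. norm (case (y, u) of (y, u) \<Rightarrow> g y u) \<partial>lborel) \<in> borel_measurable borel"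
        unfolding g_def by measurable
      fix y :: real assume y: "y > 0"
      have "(\<integral>u. norm (g y u) \<partial>lborel) \<le> (\<integral>u. B * indicator {0..min x y} u \<partial>lborel)"
        using g_int bd_int g_bd by (intro integral_mono) auto
      also have "\<dots> = B * min x y" using x y by simp
      \<comment> \<open>For \<open>y \<ge> 1\<close> the bound \<open>min x y \<le> x\<close> is
        used, for \<open>y < 1\<close> the bound \<open>min x y \<le> y\<close>; the factor
        \<open>1 + x\<close> dominates in both cases.\<close>
      also have "\<dots> \<le> B * ((1 + x) * min 1 y)"
      proof (rule mult_left_mono[OF _ B(1)])
        have "0 \<le> x * y" using x y by simp
        then have "min x y \<le> 1 + x" "min x y \<le> (1 + x) * y" using x y by (simp_all add: ring_distribs min_le_iff_disj)
        then show "min x y \<le> (1 + x) * min 1 y" by (cases "1 \<le> y") simp_all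
      qed
      finally show "norm (\<integral>u. norm (case (y, u) of (y, u) \<Rightarrow> g y u) \<partial>lborel) \<le> B * (1 + x) * min 1 y"
        by simp
    qed
  qed (use g_int in auto)
  have conv0: "convolve (power_kernel 1) f' z = 0" if "z < 0" for z
    using f'0 that by (intro convolution_causal_eq_0) (auto simp: power_kernel_def)
  have p1: "integrable lborel (\<lambda>w. indicator {..<z} w * f' w)" if "z \<le> x" for z
  proof (rule Bochner_Integration.integrable_bound)
    show "integrable lborel (\<lambda>u. B * indicator {0..max 0 x} u)" by simp
    show "AE w in lborel. norm (indicator {..<z} w * f' w) \<le> norm (B * indicator {0..max 0 x} w)"
      using B that f'0 by (intro AE_I2) (auto simp: indicator_def not_le)
  qed measurable
  have diff: "f x - f (x - y) = (\<integral>u. g y u \<partial>lborel) + f 0 * indicator {x<..} y" if y: "y > 0" for y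
  proof -
    have "(\<integral>u. g y u \<partial>lborel) = (\<integral>w. g y (x - w) \<partial>lborel)"
      by (subst lborel_integral_real_affine[where c = "-1" and t = x]) auto
    also have "\<dots> = (\<integral>w. indicator {..<x} w * f' w - indicator {..<x - y} w * f' w \<partial>lborel)"
    proof (rule integral_cong_AE)
      show "AE w in lborel. g y (x - w) = indicator {..<x} w * f' w - indicator {..<x - y} w * f' w"
        using AE_lborel_singleton[of "x - y"]
        by eventually_elim (use y in \<open>auto simp: g_def indicator_def\<close>)
      show "(\<lambda>w. g y (x - w)) \<in> borel_measurable lborel" unfolding g_def by measurable
    qed measurable
    also have "\<dots> = convolve (power_kernel 1) f' x - convolve (power_kernel 1) f' (x - y)"
      using p1 y unfolding convolution_power_kernel_1 by (intro Bochner_Integration.integral_diff) auto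
    finally have eq: "(\<integral>u. g y u \<partial>lborel) = convolve (power_kernel 1) f' x - convolve (power_kernel 1) f' (x - y)" .
    show ?thesis
    proof (cases "y > x")
      case True
      then show ?thesis unfolding eq using ff'[of x] f0[of "x - y"] conv0[of "x - y"] x by simp
    next
      case False
      then show ?thesis unfolding eq ff'[of x, OF less_imp_le[OF x]] using ff'[of "x - y"] by simp
    qed
  qed
  have int1: "integrable m (\<lambda>y. \<integral>u. g y u \<partial>lborel)"
    using integrable_fst'[OF gg] by simp
  have int2: "integrable m (indicator {x<..} :: real \<Rightarrow> real)"
    using emeasure_greaterThan_finite[OF x] by (simp add: integrable_indicator_iff)
  have int12: "integrable m (\<lambda>y. (\<integral>u. g y u \<partial>lborel) + f 0 * indicator {x<..} y)"
    using int1 int2 by (intro Bochner_Integration.integrable_add integrable_mult_right)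
  have AE_eq: "AE y in m. (\<integral>u. g y u \<partial>lborel) + f 0 * indicator {x<..} y = indicator {0<..} y *\<^sub>R (f x - f (x - y))"
    using AE_pos by eventually_elim (simp add: diff)
  have fm [measurable]: "f \<in> borel_measurable borel"
  proof -
    have "(\<lambda>z. if z < 0 then 0 else f 0 + convolve (power_kernel 1) f' z) \<in> borel_measurable borel"
      by measurable
    moreover have "(\<lambda>z. if z < 0 then 0 else f 0 + convolve (power_kernel 1) f' z) = f"
    proof
      fix z show "(if z < 0 then 0 else f 0 + convolve (power_kernel 1) f' z) = f z"
        using f0[of z] ff'[of z] by (cases "z < 0") simp_all
    qed
    ultimately show ?thesis by simp
  qed
  show "set_integrable m {0<..} (\<lambda>y. f x - f (x - y))"
    unfolding set_integrable_def by (rule integrable_cong_AE_imp[OF int12 _ AE_eq]) measurable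
  have inner: "(\<integral>y. g y u \<partial>m) = f' (x - u) * tail u" for u
  proof (cases "u > 0")
    case True
    have "(\<integral>y. g y u \<partial>m) = (\<integral>y. f' (x - u) * indicator {u<..} y \<partial>m)"
      using True by (intro Bochner_Integration.integral_cong) (auto simp: g_def)
    then show ?thesis using True by (simp add: tail_def)
  qed (simp add: g_def tail_def)
  have "Theta m f x = (\<integral>y. (\<integral>u. g y u \<partial>lborel) + f 0 * indicator {x<..} y \<partial>m)"
    unfolding Theta_def set_lebesgue_integral_def
    by (rule integral_cong_AE[symmetric]) (use int12 AE_eq in auto)
  also have "\<dots> = (\<integral>y. \<integral>u. g y u \<partial>lborel \<partial>m) + f 0 * (\<integral>y. indicator {x<..} y \<partial>m)"
    using int1 int2 by simp
  also have "(\<integral>y. indicator {x<..} y \<partial>m) = tail x" using x by (simp add: tail_def)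
  also have "(\<integral>y. \<integral>u. g y u \<partial>lborel \<partial>m) = (\<integral>u. \<integral>y. g y u \<partial>m \<partial>lborel)"
    using Fubini_integral[OF gg] by simp
  also have "(\<integral>u. \<integral>y. g y u \<partial>m \<partial>lborel) = (\<integral>u. f' (x - u) * tail u \<partial>lborel)"
    by (simp only: inner)
  also have "(\<integral>u. f' (x - u) * tail u \<partial>lborel) = convolve f' tail x" by (simp add: convolve_def)
  also have "\<dots> = convolve tail f' x" by (rule convolution_commute)
  finally show "Theta m f x = f 0 * tail x + convolve tail f' x" by simp
qed

lemma Theta_eq_prabhakar_derivative:
  assumes f: "f \<in> half_line_C1" and x: "x > 0"
  shows "set_integrable m {0<..} (\<lambda>y. f x - f (x - y))"
    and "\<theta> > 0 \<Longrightarrow> Theta m f x = prabhakar_derivative \<theta> \<nu> (\<nu> * \<delta>) (- \<eta>) \<delta> f x - \<eta> powr \<delta> * f x"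
proof -
  obtain f' where f0: "\<And>x. x < 0 \<Longrightarrow> f x = 0" and fc: "continuous_on {0..} f"
    and f'0: "\<And>x. x < 0 \<Longrightarrow> f' x = 0" and f': "continuous_on {0..} f'"
    and ff': "\<And>z. z \<ge> 0 \<Longrightarrow> f z = f 0 + convolve (power_kernel 1) f' z"
    using half_line_C1E[OF f] by blast
  show "set_integrable m {0<..} (\<lambda>y. f x - f (x - y))"
    by (rule Theta_eq_tail(1)[OF f0 f'0 f' ff' x])
  assume \<theta>: "\<theta> > 0"
  have a: "0 < \<nu> * \<delta>" "\<nu> * \<delta> < 1" "0 < 1 - \<nu> * \<delta>" using \<nu> \<delta> \<nu>\<delta> by auto
  have f'm [measurable]: "f' \<in> borel_measurable borel" using f'0 f' by (rule causal_borel_measurable)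
  have Km [measurable]: "K \<in> borel_measurable borel"
    by (rule borel_measurable_prabhakar_kernel[OF \<nu>(1) \<eta> a(3)])
  have Ki: "integrable lborel (\<lambda>y. f' (x - y) * K y)"
    by (rule integrable_convolution_causal[OF f'0 f' _ Km integrable_atMost_prabhakar_kernel[OF \<nu>(1) \<eta> a(3)]])
       (auto simp: prabhakar_kernel_def)
  have pi: "integrable lborel (\<lambda>y. f' (x - y) * power_kernel 1 y)"
  proof (rule integrable_convolution_causal[OF f'0 f'])
    show "integrable lborel (\<lambda>y. indicator {..x} y * power_kernel 1 y)"
      using has_bochner_integral_laplace_power_kernel[of 1 1]
      by (intro integrable_atMost_if_laplace[where s = 1]) (auto simp: has_bochner_integral_iff)
  qed (auto simp: power_kernel_def)
  have "convolve tail f' x = convolve (\<lambda>y. K y - \<eta> powr \<delta> * power_kernel 1 y) f' x"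
    by (rule convolution_cong_AE) (use AE_tail_eq in \<open>auto elim!: eventually_mono\<close>)
  also have "\<dots> = (\<integral>y. f' (x - y) * K y - \<eta> powr \<delta> * (f' (x - y) * power_kernel 1 y) \<partial>lborel)"
    unfolding convolution_commute[of _ f'] unfolding convolve_def
    by (intro Bochner_Integration.integral_cong) (auto simp: algebra_simps)
  also have "\<dots> = convolve K f' x - \<eta> powr \<delta> * convolve (power_kernel 1) f' x"
    unfolding convolution_commute[of _ f'] unfolding convolve_def using Ki pi by simp
  finally have "Theta m f x = f 0 * (K x - \<eta> powr \<delta>) + (convolve K f' x - \<eta> powr \<delta> * convolve (power_kernel 1) f' x)"
  proof -
    have "Theta m f x = f 0 * tail x + convolve tail f' x"
      by (rule Theta_eq_tail(2)[OF f0 f'0 f' ff' x])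
    then show "convolve tail f' x = convolve K f' x - \<eta> powr \<delta> * convolve (power_kernel 1) f' x \<Longrightarrow> ?thesis"
      unfolding tail_eq_kernel[OF x] by simp
  qed
  \<comment> \<open>The constant \<open>\<eta> powr \<delta>\<close> meets \<open>f 0\<close> in the
    boundary term and the integral of \<open>f'\<close> in the convolution; together these are
    \<open>\<eta> powr \<delta> * f x\<close>.\<close>
  also have "\<dots> = f 0 * K x + convolve K f' x - \<eta> powr \<delta> * (f 0 + convolve (power_kernel 1) f' x)"
    by (simp add: algebra_simps)
  also have "f 0 * K x + convolve K f' x = prabhakar_derivative \<theta> \<nu> (\<nu> * \<delta>) (- \<eta>) \<delta> f x"
    by (rule prabhakar_derivative_eq[OF \<nu>(1) \<eta> \<theta> a(1,2) f0 fc f'0 f' ff' x, symmetric])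
  also have "f 0 + convolve (power_kernel 1) f' x = f x"
    by (rule ff'[symmetric]) (use x in simp)
  finally show "Theta m f x = prabhakar_derivative \<theta> \<nu> (\<nu> * \<delta>) (- \<eta>) \<delta> f x - \<eta> powr \<delta> * f x" .
qed

end

section \<open>Fourier inversion\<close>

lemma continuous_AE_eq_imp_eq:
  fixes f g :: "real \<Rightarrow> real"
  assumes f: "continuous_on UNIV f" and g: "continuous_on UNIV g" and eq: "AE x in lborel. f x = g x"
  shows "f = g"
proof (rule ccontr)
  assume "f \<noteq> g"
  then obtain x where x: "f x \<noteq> g x" by auto
  have "open {x. f x \<noteq> g x}" using f g by (rule open_Collect_neq)
  then obtain e where e: "e > 0" "ball x e \<subseteq> {x. f x \<noteq> g x}" using x openE by blast
  have "x - e < x + e" using e by simp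
  then obtain y where y: "x - e < y" "y < x + e" "f y = g y" using AE_lborel_between[OF eq] by blast
  then have "y \<in> ball x e" by (auto simp: dist_real_def)
  then show False using e(2) y(3) by blast
qed

text \<open>Two densities of one law agree almost everywhere, and continuity removes the exceptional
  set. This is what gives the definite description in \<open>pdf\<close> its meaning.\<close>

lemma is_continuous_pdf_unique:
  assumes f: "is_continuous_pdf M X f" and g: "is_continuous_pdf M X g"
  shows "f = g"
proof (rule continuous_AE_eq_imp_eq)
  show c: "continuous_on UNIV f" "continuous_on UNIV g" using f g by (simp_all add: is_continuous_pdf_def)
  have [measurable]: "f \<in> borel_measurable borel" "g \<in> borel_measurable borel"
    using c by (auto intro: borel_measurable_continuous_onI)
  have "density lborel (\<lambda>x. ennreal (f x)) = density lborel (\<lambda>x. ennreal (g x))"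
    using f g by (auto simp: is_continuous_pdf_def distributed_def)
  then have "AE x in lborel. ennreal (f x) = ennreal (g x)"
    by (subst (asm) sigma_finite_measure.density_unique_iff[OF lborel.sigma_finite_measure_axioms]) auto
  then show "AE x in lborel. f x = g x"
    by eventually_elim (use f g in \<open>auto simp: is_continuous_pdf_def\<close>)
qed

lemma pdf_eqI: "is_continuous_pdf M X f \<Longrightarrow> pdf M X = f"
  unfolding pdf_def by (rule the_equality) (auto intro: is_continuous_pdf_unique)

text \<open>Turns the quotient in Levy's inversion formula into an integral over the interval, ready
  for Fubini.\<close>

lemma integral_greaterThanAtMost_iexp:
  fixes a b t :: real
  assumes "a \<le> b" "t \<noteq> 0"
  shows "(LBINT x:{a<..b}. iexp (- (t * x))) = (iexp (- (t * a)) - iexp (- (t * b))) / (\<i> * t)"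
proof -
  have c: "continuous_on {a..b} (\<lambda>x. iexp (- (t * x)))" by (intro continuous_intros)
  have si: "set_integrable lborel {a..b} (\<lambda>x. iexp (- (t * x)))"
    by (rule borel_integrable_atLeastAtMost'[OF c])
  have "(LBINT x:{a<..b}. iexp (- (t * x))) = (LBINT x:{a..b}. iexp (- (t * x)))"
    unfolding set_lebesgue_integral_def
  proof (rule integral_cong_AE)
    show "AE x in lborel. indicator {a<..b} x *\<^sub>R iexp (- (t * x)) = indicator {a..b} x *\<^sub>R iexp (- (t * x))"
      using AE_lborel_singleton[of a] by eventually_elim (auto simp: indicator_def)
  qed measurable
  also have "\<dots> = integral {a..b} (\<lambda>x. iexp (- (t * x)))"
    by (rule set_borel_integral_eq_integral(2)[OF si])
  also have "\<dots> = (- iexp (- (t * b)) / (\<i> * t)) - (- iexp (- (t * a)) / (\<i> * t))"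
  proof (rule integral_unique, rule fundamental_theorem_of_calculus[OF assms(1)])
    fix x
    have "((\<lambda>z. - exp (\<i> * - (of_real t * z)) / (\<i> * t)) has_field_derivative exp (\<i> * - (of_real t * of_real x))) (at (of_real x))"
      using assms(2) by (auto intro!: derivative_eq_intros simp: field_simps)
    from has_vector_derivative_real_field[OF this]
    show "((\<lambda>x. - iexp (- (t * x)) / (\<i> * t)) has_vector_derivative iexp (- (t * x))) (at x within {a..b})"
      by simp
  qed
  also have "\<dots> = (iexp (- (t * a)) - iexp (- (t * b))) / (\<i> * t)" by (simp add: diff_divide_distrib)
  finally show ?thesis .
qed

text \<open>Taking the real part under the integral yields a real function directly, with no
  symmetry of \<open>q\<close> to be checked.\<close>

definition inverse_fourier :: "(real \<Rightarrow> complex) \<Rightarrow> real \<Rightarrow> real" where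
  "inverse_fourier q x = (\<integral>t. Re (iexp (- (t * x)) * q t) / (2 * pi) \<partial>lborel)"

context
  fixes q :: "real \<Rightarrow> complex"
  assumes int: "integrable lborel q"
begin

lemma fourier_measurable [measurable]: "q \<in> borel_measurable borel"
  using int by auto

lemma integrable_iexp_mult: "integrable lborel (\<lambda>t. iexp (- (t * x)) * q t)"
  by (rule Bochner_Integration.integrable_bound[OF int]) (auto simp: norm_mult)

lemma integrable_fourier_integrand: "integrable lborel (\<lambda>t. Re (iexp (- (t * x)) * q t) / (2 * pi))"
  using integrable_iexp_mult[of x] by (intro integrable_divide integrable_Re) auto

lemma norm_fourier_integrand_le: "norm (Re (iexp (- (t * x)) * q t) / (2 * pi)) \<le> norm (q t)"
proof -
  have "norm (Re (iexp (- (t * x)) * q t) / (2 * pi)) \<le> norm (iexp (- (t * x)) * q t) / 1"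
    unfolding norm_divide using pi_ge_two abs_Re_le_cmod[of "iexp (- (t * x)) * q t"]
    by (intro frac_le) auto
  then show ?thesis by (simp add: norm_mult)
qed

lemma continuous_inverse_fourier: "continuous_on UNIV (inverse_fourier q)"
proof (rule continuous_at_imp_continuous_on, rule ballI)
  fix x :: real
  show "isCont (inverse_fourier q) x"
    unfolding continuous_at_sequentially
  proof (intro allI impI)
    fix X assume X: "X \<longlonglongrightarrow> x"
    have "(\<lambda>n. \<integral>t. Re (iexp (- (t * X n)) * q t) / (2 * pi) \<partial>lborel)
      \<longlonglongrightarrow> (\<integral>t. Re (iexp (- (t * x)) * q t) / (2 * pi) \<partial>lborel)"
    proof (rule integral_dominated_convergence[where w = "\<lambda>t. norm (q t)"])
      show "integrable lborel (\<lambda>t. norm (q t))" using int by simp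
      show "AE t in lborel. (\<lambda>n. Re (iexp (- (t * X n)) * q t) / (2 * pi))
          \<longlonglongrightarrow> Re (iexp (- (t * x)) * q t) / (2 * pi)"
        by (intro AE_I2 tendsto_intros X) auto
      show "AE t in lborel. norm (Re (iexp (- (t * X n)) * q t) / (2 * pi)) \<le> norm (q t)" for n
        by (intro AE_I2 norm_fourier_integrand_le)
    qed measurable
    then show "(inverse_fourier q \<circ> X) \<longlonglongrightarrow> inverse_fourier q x"
      by (simp add: comp_def inverse_fourier_def)
  qed
qed

lemma borel_measurable_inverse_fourier [measurable]: "inverse_fourier q \<in> borel_measurable borel"
  using continuous_inverse_fourier by (rule borel_measurable_continuous_onI)

lemma abs_inverse_fourier_le: "\<bar>inverse_fourier q x\<bar> \<le> (\<integral>t. norm (q t) \<partial>lborel)"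
proof -
  have "\<bar>inverse_fourier q x\<bar> \<le> (\<integral>t. norm (Re (iexp (- (t * x)) * q t) / (2 * pi)) \<partial>lborel)"
    unfolding inverse_fourier_def real_norm_def[symmetric] by (rule integral_norm_bound)
  also have "\<dots> \<le> (\<integral>t. norm (q t) \<partial>lborel)"
    by (intro integral_mono integrable_norm integrable_fourier_integrand int norm_fourier_integrand_le)
  finally show ?thesis .
qed

end

lemma has_real_derivative_Re:
  assumes "(F has_field_derivative D) (at (complex_of_real t))"
  shows "((\<lambda>t. Re (F (of_real t))) has_real_derivative Re D) (at t)"
  using bounded_linear.has_vector_derivative[OF bounded_linear_Re has_vector_derivative_real_field[OF assms]]
  by (simp add: has_real_derivative_iff_has_vector_derivative)

lemma has_real_derivative_inverse_fourier:
  assumes q: "integrable lborel q" and tq: "integrable lborel (\<lambda>t. of_real t * q t)"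
  shows "(inverse_fourier q has_real_derivative inverse_fourier (\<lambda>t. - \<i> * of_real t * q t) x) (at x)"
  unfolding inverse_fourier_def[abs_def]
proof (rule has_field_derivative_integral_dominated[where e = 1 and w = "\<lambda>t. norm (of_real t * q t)"
      and f' = "\<lambda>x t. Re (iexp (- (t * x)) * (- \<i> * of_real t * q t)) / (2 * pi)"])
  note [measurable] = fourier_measurable[OF q]
  show "integrable lborel (\<lambda>t. Re (iexp (- (t * y)) * q t) / (2 * pi))" for y
    by (rule integrable_fourier_integrand[OF q])
  have *: "integrable lborel (\<lambda>t. - \<i> * of_real t * q t)"
    using integrable_mult_right[OF tq, of "- \<i>"] by (simp add: mult.assoc)
  show "norm (Re (iexp (- (t * y)) * (- \<i> * of_real t * q t)) / (2 * pi)) \<le> norm (of_real t * q t)" for y t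
    using norm_fourier_integrand_le[OF *, of t y] by (simp add: norm_mult)
  show "integrable lborel (\<lambda>t. norm (of_real t * q t))" using tq by (rule integrable_norm)
  show "((\<lambda>y. Re (iexp (- (t * y)) * q t) / (2 * pi)) has_real_derivative
      Re (iexp (- (t * y)) * (- \<i> * of_real t * q t)) / (2 * pi)) (at y)" for y t
  proof -
    have "((\<lambda>z. exp (\<i> * - (of_real t * z)) * q t) has_field_derivative
        exp (\<i> * - (of_real t * of_real y)) * (- \<i> * of_real t * q t)) (at (of_real y))"
      by (auto intro!: derivative_eq_intros)
    from has_real_derivative_Re[OF this]
    have "((\<lambda>y. Re (iexp (- (t * y)) * q t)) has_real_derivative
        Re (iexp (- (t * y)) * (- \<i> * of_real t * q t))) (at y)" by simp
    then show ?thesis by (rule DERIV_cdivide)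
  qed
  show "(\<lambda>t. Re (iexp (- (t * x)) * (- \<i> * of_real t * q t)) / (2 * pi)) \<in> borel_measurable lborel"
    by (rule borel_measurable_integrable[OF integrable_fourier_integrand[OF *]])
qed auto

section \<open>Inversion of an integrable characteristic function\<close>

context real_distribution
begin

context
  assumes int: "integrable lborel (char M)"
begin

lemma char_measurable' [measurable]: "char M \<in> borel_measurable borel"
  using int by auto

lemmas integrable_iexp_char = integrable_iexp_mult[OF int]
lemmas continuous_inversion_density = continuous_inverse_fourier[OF int]
lemmas abs_inversion_density_le = abs_inverse_fourier_le[OF int]
lemmas [measurable] = borel_measurable_inverse_fourier[OF int]

text \<open>Levy's formula is a limit of truncated integrals. The quotient in it is at most
  \<open>b - a\<close> in modulus, so integrability of the characteristic function makes the limit a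
  full integral, and Fubini then exchanges it with the integral over the interval.\<close>

lemma measure_Ioc_of_no_atoms:
  assumes ab: "a \<le> b" and "measure M {a} = 0" "measure M {b} = 0"
  shows "measure M {a<..b} = (LBINT x:{a<..b}. inverse_fourier (char M) x)"
proof -
  let ?F = "\<lambda>t::real. (iexp (- (t * a)) - iexp (- (t * b))) / (\<i> * t)"
  have Fm [measurable]: "?F \<in> borel_measurable borel" by measurable
  have Fbd: "norm (?F t) \<le> b - a" if "t \<noteq> 0" for t
    using Levy_Inversion_aux2[of "- b" "- a" t] ab that by simp
  have bd_int: "integrable lborel (\<lambda>t. (b - a) * norm (char M t))" using int by simp
  have prod_int: "integrable (lborel \<Otimes>\<^sub>M lborel) (\<lambda>(x, t). indicator {a<..b} x *\<^sub>R (iexp (- (t * x)) * char M t))"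
    proof (rule lborel_pair.Fubini_integrable)
      show "AE x in lborel. integrable lborel (\<lambda>t. case (x, t) of (x, t) \<Rightarrow> indicator {a<..b} x *\<^sub>R (iexp (- (t * x)) * char M t))"
        using integrable_iexp_char by auto
      have "(\<integral>t. norm (indicator {a<..b} x *\<^sub>R (iexp (- (t * x)) * char M t)) \<partial>lborel)
          = indicator {a<..b} x * (\<integral>t. norm (char M t) \<partial>lborel)" for x
        by (simp add: norm_mult)
      then show "integrable lborel (\<lambda>x. \<integral>t. norm (case (x, t) of (x, t) \<Rightarrow> indicator {a<..b} x *\<^sub>R (iexp (- (t * x)) * char M t)) \<partial>lborel)"
        unfolding prod.case using ab by (simp only:) simp
    qed measurable
  have lim: "(\<lambda>T. \<integral>t. indicator {- real T<..<real T} t *\<^sub>R (?F t * char M t) \<partial>lborel)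
      \<longlonglongrightarrow> (\<integral>t. ?F t * char M t \<partial>lborel)"
  proof (rule integral_dominated_convergence[OF _ _ bd_int])
    show "AE t in lborel. (\<lambda>T. indicator {- real T<..<real T} t *\<^sub>R (?F t * char M t)) \<longlonglongrightarrow> ?F t * char M t"
    proof (intro AE_I2 tendsto_eventually)
      fix t :: real
      obtain N :: nat where N: "\<bar>t\<bar> < real N" using reals_Archimedean2 by blast
      show "eventually (\<lambda>T. indicator {- real T<..<real T} t *\<^sub>R (?F t * char M t) = ?F t * char M t) sequentially"
        using eventually_ge_at_top[of N]
      proof eventually_elim
        case (elim T)
        then have "t \<in> {- real T<..<real T}" using N by (simp add: abs_less_iff)
        then show ?case by simp
      qed
    qed
    show "AE t in lborel. norm (indicator {- real T<..<real T} t *\<^sub>R (?F t * char M t)) \<le> (b - a) * norm (char M t)" for T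
      using AE_lborel_singleton[of 0]
    proof eventually_elim
      case (elim t)
      have "norm (?F t * char M t) \<le> (b - a) * norm (char M t)"
        unfolding norm_mult using Fbd[OF elim] by (intro mult_right_mono) auto
      moreover have "0 \<le> (b - a) * norm (char M t)" using ab by simp
      ultimately show ?case by (simp add: indicator_def)
    qed
  qed measurable
  have "(\<lambda>T. 1 / (2 * pi) * (CLBINT t=-real T..real T. ?F t * char M t)) \<longlonglongrightarrow> measure M {a<..b}"
    using Levy_Inversion[OF assms] by simp
  moreover have "(CLBINT t=-real T..real T. ?F t * char M t) = (\<integral>t. indicator {- real T<..<real T} t *\<^sub>R (?F t * char M t) \<partial>lborel)" for T
    by (simp add: interval_lebesgue_integral_def set_lebesgue_integral_def einterval_eq)
  ultimately have "complex_of_real (measure M {a<..b}) = 1 / (2 * pi) * (\<integral>t. ?F t * char M t \<partial>lborel)"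
    using tendsto_mult_left[OF lim, of "1 / (2 * pi)"] by (intro LIMSEQ_unique) auto
  also have "(\<integral>t. ?F t * char M t \<partial>lborel) = (\<integral>t. \<integral>x. indicator {a<..b} x *\<^sub>R (iexp (- (t * x)) * char M t) \<partial>lborel \<partial>lborel)"
  proof (rule integral_cong_AE)
    show "AE t in lborel. ?F t * char M t = (\<integral>x. indicator {a<..b} x *\<^sub>R (iexp (- (t * x)) * char M t) \<partial>lborel)"
      using AE_lborel_singleton[of 0]
    proof eventually_elim
      case (elim t)
      have "?F t * char M t = (\<integral>x. (indicator {a<..b} x *\<^sub>R iexp (- (t * x))) * char M t \<partial>lborel)"
        using integral_greaterThanAtMost_iexp[OF ab elim]
        unfolding set_lebesgue_integral_def by (simp only: integral_mult_left_zero)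
      then show ?case by (simp only: mult_scaleR_left)
    qed
  qed measurable
  also have "\<dots> = (\<integral>x. \<integral>t. indicator {a<..b} x *\<^sub>R (iexp (- (t * x)) * char M t) \<partial>lborel \<partial>lborel)"
    using lborel_pair.Fubini_integral[OF prod_int] by simp
  finally have eq: "complex_of_real (measure M {a<..b})
    = 1 / (2 * pi) * (\<integral>x. \<integral>t. indicator {a<..b} x *\<^sub>R (iexp (- (t * x)) * char M t) \<partial>lborel \<partial>lborel)" .
  have int_x: "integrable lborel (\<lambda>x. \<integral>t. indicator {a<..b} x *\<^sub>R (iexp (- (t * x)) * char M t) \<partial>lborel)"
    using lborel_pair.integrable_fst'[OF prod_int] by simp
  let ?Z = "\<integral>x. \<integral>t. indicator {a<..b} x *\<^sub>R (iexp (- (t * x)) * char M t) \<partial>lborel \<partial>lborel"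
  have "complex_of_real (measure M {a<..b}) = of_real (1 / (2 * pi)) * ?Z"
    unfolding eq of_real_divide of_real_mult of_real_1 of_real_numeral ..
  from arg_cong[OF this, where f = Re]
  have "measure M {a<..b} = 1 / (2 * pi) * Re ?Z"
    unfolding Re_complex_of_real times_complex.sel Im_complex_of_real by (simp only: mult_zero_left diff_zero)
  also have "Re ?Z = (\<integral>x. Re (\<integral>t. indicator {a<..b} x *\<^sub>R (iexp (- (t * x)) * char M t) \<partial>lborel) \<partial>lborel)"
    by (rule integral_Re[OF int_x, symmetric])
  also have "1 / (2 * pi) * \<dots> = (\<integral>x. 1 / (2 * pi) * Re (\<integral>t. indicator {a<..b} x *\<^sub>R (iexp (- (t * x)) * char M t) \<partial>lborel) \<partial>lborel)"
    by (rule integral_mult_right_zero[symmetric])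
  also have "\<dots> = (LBINT x:{a<..b}. inverse_fourier (char M) x)"
    unfolding set_lebesgue_integral_def
  proof (rule Bochner_Integration.integral_cong[OF refl])
    fix x
    have "Re (\<integral>t. iexp (- (t * x)) * char M t \<partial>lborel) = (\<integral>t. Re (iexp (- (t * x)) * char M t) \<partial>lborel)"
      by (rule integral_Re[OF integrable_iexp_char, symmetric])
    then show "1 / (2 * pi) * Re (\<integral>t. indicator {a<..b} x *\<^sub>R (iexp (- (t * x)) * char M t) \<partial>lborel)
        = indicator {a<..b} x *\<^sub>R inverse_fourier (char M) x"
      by (simp add: inverse_fourier_def)
  qed
  finally show ?thesis .
qed

lemma set_integrable_inversion_density: "set_integrable lborel {a<..b} (inverse_fourier (char M))"
proof -
  have "set_integrable lborel {a..b} (inverse_fourier (char M))"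
    by (rule borel_integrable_atLeastAtMost') (rule continuous_on_subset[OF continuous_inversion_density], simp)
  then show ?thesis by (rule set_integrable_subset) auto
qed

text \<open>The inversion formula bounds the mass of an interval by \<open>C\<close> times its
  length, but so far only for endpoints that are no atoms. There are countably many atoms, so such
  endpoints exist arbitrarily close to \<open>a\<close> on both sides.\<close>

lemma no_atoms: "measure M {a} = 0"
proof (rule ccontr)
  assume "measure M {a} \<noteq> 0"
  then have pos: "measure M {a} > 0" using measure_nonneg[of M "{a}"] by linarith
  define C where "C = (\<integral>t. norm (char M t) \<partial>lborel)"
  have C: "C \<ge> 0" unfolding C_def by simp
  \<comment> \<open>Chosen so that \<open>C * (2 * e) = measure M {a} * C / (C + 1)\<close>, which
    is less than the supposed mass.\<close>
  define e where "e = measure M {a} / (2 * (C + 1))"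
  have e: "e > 0" using pos C by (simp add: e_def)
  have count: "countable {x. measure M {x} \<noteq> 0}" by (rule countable_support)
  have "\<exists>x\<in>{c<..<d}. measure M {x} = 0" if "c < d" for c d
  proof (rule ccontr)
    assume "\<not> (\<exists>x\<in>{c<..<d}. measure M {x} = 0)"
    then have "{c<..<d} \<subseteq> {x. measure M {x} \<noteq> 0}" by auto
    with count have "countable {c<..<d}" using countable_subset by blast
    then show False using uncountable_open_interval[of c d] that by blast
  qed
  from this[of "a - e" a] this[of a "a + e"] e
  obtain c d where c: "a - e < c" "c < a" "measure M {c} = 0" and d: "a < d" "d < a + e" "measure M {d} = 0"
    by auto
  have "measure M {a} \<le> measure M {c<..d}" using c d by (intro finite_measure_mono) auto
  also have "\<dots> = (LBINT x:{c<..d}. inverse_fourier (char M) x)" using c d by (intro measure_Ioc_of_no_atoms) auto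
  also have "\<dots> \<le> (LBINT x:{c<..d}. C)"
    unfolding C_def
  proof (rule set_integral_mono[OF set_integrable_inversion_density])
    show "set_integrable lborel {c<..d} (\<lambda>x. \<integral>t. norm (char M t) \<partial>lborel)"
      using c d by (simp add: set_integrable_def)
    show "inverse_fourier (char M) x \<le> (\<integral>t. norm (char M t) \<partial>lborel)" for x
      using abs_inversion_density_le[of x] by linarith
  qed
  also have "\<dots> = C * (d - c)" using c d by (simp add: set_lebesgue_integral_def)
  also have "\<dots> \<le> C * (2 * e)" using c d C by (intro mult_left_mono) auto
  also have "\<dots> < measure M {a}" using C pos by (simp add: e_def field_simps)
  finally show False by simp
qed

lemma measure_Ioc: "a \<le> b \<Longrightarrow> measure M {a<..b} = (LBINT x:{a<..b}. inverse_fourier (char M) x)"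
  by (intro measure_Ioc_of_no_atoms no_atoms)

text \<open>Near a negative value continuity keeps the function below half of it, and a short
  interval to the right would have negative measure.\<close>

lemma inversion_density_nonneg: "inverse_fourier (char M) x \<ge> 0"
proof (rule ccontr)
  assume "\<not> inverse_fourier (char M) x \<ge> 0"
  then have neg: "inverse_fourier (char M) x < 0" by simp
  have "isCont (inverse_fourier (char M)) x" using continuous_inversion_density by (simp add: continuous_on_eq_continuous_at)
  then have "eventually (\<lambda>y. inverse_fourier (char M) y < inverse_fourier (char M) x / 2) (at x)"
    unfolding isCont_def by (rule order_tendstoD(2)) (use neg in simp)
  then obtain e where e: "e > 0" "\<And>y. y \<noteq> x \<Longrightarrow> dist y x < e \<Longrightarrow> inverse_fourier (char M) y < inverse_fourier (char M) x / 2"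
    unfolding eventually_at by blast
  define d where "d = e / 2"
  have d: "d > 0" using e by (simp add: d_def)
  have "0 \<le> measure M {x<..x + d}" by simp
  also have "\<dots> = (LBINT y:{x<..x + d}. inverse_fourier (char M) y)" using d by (intro measure_Ioc) simp
  also have "\<dots> \<le> (LBINT y:{x<..x + d}. inverse_fourier (char M) x / 2)"
  proof (rule set_integral_mono[OF set_integrable_inversion_density])
    show "set_integrable lborel {x<..x + d} (\<lambda>y. inverse_fourier (char M) x / 2)"
      using d by (simp add: set_integrable_def)
    show "inverse_fourier (char M) y \<le> inverse_fourier (char M) x / 2" if "y \<in> {x<..x + d}" for y
      using that e d by (intro less_imp_le e(2)) (auto simp: d_def dist_real_def)
  qed
  also have "\<dots> = inverse_fourier (char M) x / 2 * d" using d by (simp add: set_lebesgue_integral_def)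
  also have "\<dots> < 0" using neg d by (simp add: mult_less_0_iff)
  finally show False by simp
qed

lemma eq_density_inversion: "M = density lborel (\<lambda>x. ennreal (inverse_fourier (char M) x))"
proof (rule measure_eqI_generator_eq[where E = "range (\<lambda>(a, b). {a<..b})" and \<Omega> = UNIV and A = "\<lambda>i::nat. {- real i<..real i}"])
  show "Int_stable (range (\<lambda>(a, b). {a<..b::real}))"
  proof (rule Int_stableI)
    fix A B assume "A \<in> range (\<lambda>(a, b). {a<..b::real})" "B \<in> range (\<lambda>(a, b). {a<..b::real})"
    then obtain a b c d where "A = {a<..b}" "B = {c<..d}" by auto
    then have "A \<inter> B = (\<lambda>(a, b). {a<..b}) (max a c, min b d)" by auto
    then show "A \<inter> B \<in> range (\<lambda>(a, b). {a<..b})" by (rule range_eqI)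
  qed
  show "emeasure M X = emeasure (density lborel (\<lambda>x. ennreal (inverse_fourier (char M) x))) X"
    if XE: "X \<in> range (\<lambda>(a, b). {a<..b})" for X
  proof -
    obtain a b where X: "X = {a<..b}" using XE by auto
    show ?thesis
    proof (cases "a \<le> b")
      case True
      have "emeasure (density lborel (\<lambda>x. ennreal (inverse_fourier (char M) x))) X
        = (\<integral>\<^sup>+x. ennreal (indicator X x *\<^sub>R inverse_fourier (char M) x) \<partial>lborel)"
        by (subst emeasure_density) (auto simp: X intro!: nn_integral_cong split: split_indicator)
      also have "\<dots> = ennreal (LBINT x:X. inverse_fourier (char M) x)"
        unfolding set_lebesgue_integral_def using set_integrable_inversion_density[of a b] inversion_density_nonneg
        by (intro nn_integral_eq_integral) (auto simp: set_integrable_def X)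
      also have "\<dots> = emeasure M X"
        unfolding X measure_Ioc[OF True, symmetric] by (simp add: emeasure_eq_measure)
      finally show ?thesis ..
    qed (simp add: X)
  qed
  show "sets M = sigma_sets UNIV (range (\<lambda>(a, b). {a<..b}))"
    "sets (density lborel (\<lambda>x. ennreal (inverse_fourier (char M) x))) = sigma_sets UNIV (range (\<lambda>(a, b). {a<..b}))"
    by (simp_all add: borel_sigma_sets_Ioc)
  show "(\<Union>i::nat. {- real i<..real i}) = UNIV"
  proof (intro set_eqI iffI UNIV_I)
    fix x :: real
    obtain N :: nat where "\<bar>x\<bar> < real N" using reals_Archimedean2 by blast
    then have "x \<in> {- real N<..real N}" by auto
    then show "x \<in> (\<Union>i::nat. {- real i<..real i})" by blast
  qed
qed (auto simp: emeasure_eq_measure)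

end

end

section \<open>The density, its derivatives and its Laplace transform\<close>

context levy_symbol
begin

text \<open>The characteristic function is the Laplace transform at \<open>- \<i> * \<xi>\<close>,
  which explains the sign in the argument of the symbol.\<close>

definition phi :: "real \<Rightarrow> real \<Rightarrow> complex" where
  "phi t \<xi> = exp (- of_real t * \<Phi> (of_real (- \<xi>) * \<i>))"

lemma symbol_0: "\<Phi> 0 = 0"
  using \<eta> by (simp add: laplace_symbol_def powr_of_real)

lemma norm_symbol_le: "norm (\<Phi> (of_real \<xi> * \<i>)) \<le> (2 + \<bar>\<xi>\<bar>) * W"
  using norm_laplace_symbol_le[of \<xi>] W_nonneg by (cases "\<xi> = 0") (simp_all add: symbol_0)

lemma symbol_eq_integral: "\<Phi> (of_real \<xi> * \<i>) = (\<integral>x. 1 - exp (- (of_real \<xi> * \<i>) * of_real x) \<partial>m)"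
  using integral_one_minus_iexp[of \<xi>] by (cases "\<xi> = 0") (simp_all add: symbol_0)

abbreviation decay :: real where "decay \<equiv> cos (\<nu> * \<delta> * (pi / 2))"

lemma norm_phi_le:
  assumes t: "t \<ge> 0"
  shows "norm (phi t \<xi>) \<le> exp (t * \<eta> powr \<delta>) * exp (- (t * decay) * \<bar>\<xi>\<bar> powr (\<nu> * \<delta>))"
proof -
  have "Re (\<Phi> (of_real (- \<xi>) * \<i>)) \<ge> decay * \<bar>\<xi>\<bar> powr (\<nu> * \<delta>) - \<eta> powr \<delta>"
  proof (cases "\<xi> = 0")
    case True
    then show ?thesis using \<eta> by (simp add: symbol_0)
  next
    case False
    then have "of_real (- \<xi>) * \<i> \<noteq> 0" by simp
    from Re_laplace_symbol_ge[OF \<eta> \<nu> \<delta> \<nu>\<delta> this] show ?thesis by (simp add: norm_mult)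
  qed
  then have "t * (decay * \<bar>\<xi>\<bar> powr (\<nu> * \<delta>) - \<eta> powr \<delta>) \<le> t * Re (\<Phi> (of_real (- \<xi>) * \<i>))"
    using t by (rule mult_left_mono)
  then have "- (t * Re (\<Phi> (of_real (- \<xi>) * \<i>))) \<le> t * \<eta> powr \<delta> + - (t * decay) * \<bar>\<xi>\<bar> powr (\<nu> * \<delta>)"
    by (simp add: algebra_simps)
  then show ?thesis
    unfolding phi_def norm_exp_eq_Re exp_add[symmetric] exp_le_cancel_iff by simp
qed

lemma symbol_minus_measurable [measurable]: "(\<lambda>\<xi>. \<Phi> (of_real (- \<xi>) * \<i>)) \<in> borel_measurable borel"
proof -
  have "(\<lambda>\<xi>::real. - \<xi>) \<in> borel_measurable borel" by measurable
  from measurable_compose[OF this borel_measurable_laplace_symbol_imaginary[OF \<eta> \<nu> \<delta> \<nu>\<delta>]]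
  show ?thesis .
qed

lemma phi_measurable [measurable]: "phi t \<in> borel_measurable borel"
  unfolding phi_def by measurable

text \<open>It serves all times within \<open>t / 2\<close> of \<open>t\<close>: the growing
  exponential is taken at \<open>2 * t\<close>, the decaying one at \<open>t / 2\<close>.\<close>

definition majorant :: "real \<Rightarrow> real \<Rightarrow> real" where
  "majorant t \<xi> = exp (2 * t * \<eta> powr \<delta>) * ((1 + \<bar>\<xi>\<bar>) * exp (- (t / 2 * decay) * \<bar>\<xi>\<bar> powr (\<nu> * \<delta>)))"

lemma integrable_majorant:
  assumes "t > 0"
  shows "integrable lborel (majorant t)"
  unfolding majorant_def
  using assms cos_symbol_pos[OF \<eta> \<nu> \<delta> \<nu>\<delta>] \<nu> \<delta>
  by (intro integrable_mult_right integrable_stretched_exp) auto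

lemma majorant_bound:
  assumes t: "t > 0" and s: "s \<in> ball t (t / 2)"
  shows "(1 + \<bar>\<xi>\<bar>) * norm (phi s \<xi>) \<le> majorant t \<xi>"
proof -
  have "\<bar>t - s\<bar> < t / 2" using s by (simp add: dist_real_def)
  then have s: "t / 2 \<le> s" "s \<le> 2 * t" using t by linarith+
  have c: "decay > 0" by (rule cos_symbol_pos[OF \<eta> \<nu> \<delta> \<nu>\<delta>])
  have "norm (phi s \<xi>) \<le> exp (s * \<eta> powr \<delta>) * exp (- (s * decay) * \<bar>\<xi>\<bar> powr (\<nu> * \<delta>))"
    using s t by (intro norm_phi_le) auto
  also have "\<dots> \<le> exp (2 * t * \<eta> powr \<delta>) * exp (- (t / 2 * decay) * \<bar>\<xi>\<bar> powr (\<nu> * \<delta>))"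
  proof (intro mult_mono)
    have "s * \<eta> powr \<delta> \<le> 2 * t * \<eta> powr \<delta>" using s by (intro mult_right_mono) auto
    then show "exp (s * \<eta> powr \<delta>) \<le> exp (2 * t * \<eta> powr \<delta>)" by simp
    have "t / 2 * decay * \<bar>\<xi>\<bar> powr (\<nu> * \<delta>) \<le> s * decay * \<bar>\<xi>\<bar> powr (\<nu> * \<delta>)"
      using s c by (intro mult_right_mono) auto
    then show "exp (- (s * decay) * \<bar>\<xi>\<bar> powr (\<nu> * \<delta>)) \<le> exp (- (t / 2 * decay) * \<bar>\<xi>\<bar> powr (\<nu> * \<delta>))"
      by simp
  qed auto
  finally have "(1 + \<bar>\<xi>\<bar>) * norm (phi s \<xi>) \<le> (1 + \<bar>\<xi>\<bar>) * (exp (2 * t * \<eta> powr \<delta>) * exp (- (t / 2 * decay) * \<bar>\<xi>\<bar> powr (\<nu> * \<delta>)))"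
    by (rule mult_left_mono) simp
  then show ?thesis by (simp add: majorant_def mult_ac)
qed

lemma integrable_weighted_phi:
  assumes t: "t > 0"
  shows "integrable lborel (\<lambda>\<xi>. (1 + \<bar>\<xi>\<bar>) * norm (phi t \<xi>))"
proof (rule Bochner_Integration.integrable_bound[OF integrable_majorant[OF t]])
  show "AE \<xi> in lborel. norm ((1 + \<bar>\<xi>\<bar>) * norm (phi t \<xi>)) \<le> norm (majorant t \<xi>)"
  proof (intro AE_I2)
    fix \<xi>
    have "norm ((1 + \<bar>\<xi>\<bar>) * norm (phi t \<xi>)) = (1 + \<bar>\<xi>\<bar>) * norm (phi t \<xi>)" by (simp add: abs_mult)
    also have "\<dots> \<le> majorant t \<xi>" using t by (intro majorant_bound) auto
    finally show "norm ((1 + \<bar>\<xi>\<bar>) * norm (phi t \<xi>)) \<le> norm (majorant t \<xi>)" by simp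
  qed
qed measurable

lemma integrable_phi_mult:
  fixes g :: "real \<Rightarrow> complex"
  assumes t: "t > 0" and [measurable]: "g \<in> borel_measurable borel" and g: "\<And>\<xi>. norm (g \<xi>) \<le> C * (1 + \<bar>\<xi>\<bar>)"
  shows "integrable lborel (\<lambda>\<xi>. g \<xi> * phi t \<xi>)"
proof (rule Bochner_Integration.integrable_bound)
  show "integrable lborel (\<lambda>\<xi>. C * ((1 + \<bar>\<xi>\<bar>) * norm (phi t \<xi>)))"
    by (intro integrable_mult_right integrable_weighted_phi t)
  show "AE \<xi> in lborel. norm (g \<xi> * phi t \<xi>) \<le> norm (C * ((1 + \<bar>\<xi>\<bar>) * norm (phi t \<xi>)))"
  proof (intro AE_I2)
    fix \<xi>
    have "norm (g \<xi> * phi t \<xi>) \<le> C * (1 + \<bar>\<xi>\<bar>) * norm (phi t \<xi>)"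
      unfolding norm_mult using g by (intro mult_right_mono) auto
    then show "norm (g \<xi> * phi t \<xi>) \<le> norm (C * ((1 + \<bar>\<xi>\<bar>) * norm (phi t \<xi>)))"
      by (simp add: mult.assoc)
  qed
qed measurable

lemma integrable_phi: "t > 0 \<Longrightarrow> integrable lborel (phi t)"
  using integrable_phi_mult[of t "\<lambda>_. 1" 1] by simp

lemma integrable_times_phi: "t > 0 \<Longrightarrow> integrable lborel (\<lambda>\<xi>. of_real \<xi> * phi t \<xi>)"
  by (rule integrable_phi_mult[where C = 1]) auto

lemma integrable_symbol_phi: "t > 0 \<Longrightarrow> integrable lborel (\<lambda>\<xi>. \<Phi> (of_real (- \<xi>) * \<i>) * phi t \<xi>)"
proof (rule integrable_phi_mult[where C = "2 * W"])
  fix \<xi>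
  have "(2 + \<bar>\<xi>\<bar>) * W \<le> (2 * (1 + \<bar>\<xi>\<bar>)) * W" using W_nonneg by (intro mult_right_mono) auto
  then show "norm (\<Phi> (of_real (- \<xi>) * \<i>)) \<le> 2 * W * (1 + \<bar>\<xi>\<bar>)"
    using norm_symbol_le[of "- \<xi>"] by (simp add: mult_ac)
qed measurable

definition dens :: "real \<Rightarrow> real \<Rightarrow> real" where "dens t = inverse_fourier (phi t)"

lemma has_real_derivative_dens_space:
  "t > 0 \<Longrightarrow> (dens t has_real_derivative inverse_fourier (\<lambda>\<xi>. - \<i> * of_real \<xi> * phi t \<xi>) x) (at x)"
  unfolding dens_def by (intro has_real_derivative_inverse_fourier integrable_phi integrable_times_phi)

lemma integrable_dens_deriv: "t > 0 \<Longrightarrow> integrable lborel (\<lambda>\<xi>. - \<i> * of_real \<xi> * phi t \<xi>)"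
  unfolding mult.assoc by (intro integrable_mult_right integrable_times_phi)

lemma has_real_derivative_dens_time:
  assumes t: "t > 0"
  shows "((\<lambda>s. dens s x) has_real_derivative - inverse_fourier (\<lambda>\<xi>. \<Phi> (of_real (- \<xi>) * \<i>) * phi t \<xi>) x) (at t)"
proof -
  let ?f' = "\<lambda>s \<xi>. Re (iexp (- (\<xi> * x)) * (- \<Phi> (of_real (- \<xi>) * \<i>) * phi s \<xi>)) / (2 * pi)"
  have int': "integrable lborel (\<lambda>\<xi>. - \<Phi> (of_real (- \<xi>) * \<i>) * phi s \<xi>)" if "s > 0" for s
    using integrable_minus[OF integrable_symbol_phi[OF that]] by simp
  have "((\<lambda>s. dens s x) has_real_derivative (\<integral>\<xi>. ?f' t \<xi> \<partial>lborel)) (at t)"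
    unfolding dens_def inverse_fourier_def
  \<comment> \<open>A time derivative costs one factor of the symbol, bounded by \<open>(2 +
    \<bar>\<xi>\<bar>) * W \<le> 2 * W * (1 + \<bar>\<xi>\<bar>)\<close>; the weight in
    \<open>majorant\<close> absorbs it.\<close>
  proof (rule has_field_derivative_integral_dominated[where e = "t / 2" and w = "\<lambda>\<xi>. 2 * W * majorant t \<xi>"])
    have pos: "s > 0" if "s \<in> ball t (t / 2)" for s
    proof -
      have "\<bar>t - s\<bar> < t / 2" using that by (simp add: dist_real_def)
      then show ?thesis using t by linarith
    qed
    show "integrable lborel (\<lambda>\<xi>. Re (iexp (- (\<xi> * x)) * phi s \<xi>) / (2 * pi))" if "s \<in> ball t (t / 2)" for s
      by (rule integrable_fourier_integrand[OF integrable_phi[OF pos[OF that]]])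
    show "?f' t \<in> borel_measurable lborel"
      by (rule borel_measurable_integrable[OF integrable_fourier_integrand[OF int'[OF t]]])
    show "integrable lborel (\<lambda>\<xi>. 2 * W * majorant t \<xi>)"
      by (intro integrable_mult_right integrable_majorant t)
    show "norm (?f' s \<xi>) \<le> 2 * W * majorant t \<xi>" if s: "s \<in> ball t (t / 2)" for s \<xi>
    proof -
      have "norm (?f' s \<xi>) \<le> norm (- \<Phi> (of_real (- \<xi>) * \<i>) * phi s \<xi>)"
        by (rule norm_fourier_integrand_le[OF int'[OF pos[OF s]]])
      also have "\<dots> = norm (\<Phi> (of_real (- \<xi>) * \<i>)) * norm (phi s \<xi>)" by (simp add: norm_mult)
      also have "\<dots> \<le> (2 * W * (1 + \<bar>\<xi>\<bar>)) * norm (phi s \<xi>)"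
      proof (rule mult_right_mono)
        have "(2 + \<bar>\<xi>\<bar>) * W \<le> (2 * (1 + \<bar>\<xi>\<bar>)) * W" using W_nonneg by (intro mult_right_mono) auto
        then show "norm (\<Phi> (of_real (- \<xi>) * \<i>)) \<le> 2 * W * (1 + \<bar>\<xi>\<bar>)"
          using norm_symbol_le[of "- \<xi>"] by (simp add: mult_ac)
      qed simp
      also have "\<dots> \<le> 2 * W * majorant t \<xi>"
        using mult_left_mono[OF majorant_bound[OF t s, of \<xi>], of "2 * W"] W_nonneg by (simp add: mult.assoc)
      finally show ?thesis .
    qed
    show "((\<lambda>s. Re (iexp (- (\<xi> * x)) * phi s \<xi>) / (2 * pi)) has_real_derivative ?f' s \<xi>) (at s)" for s \<xi>
    proof -
      have "((\<lambda>z. iexp (- (\<xi> * x)) * exp (- z * \<Phi> (of_real (- \<xi>) * \<i>))) has_field_derivative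
          iexp (- (\<xi> * x)) * (- \<Phi> (of_real (- \<xi>) * \<i>) * exp (- of_real s * \<Phi> (of_real (- \<xi>) * \<i>)))) (at (of_real s))"
        by (auto intro!: derivative_eq_intros)
      from DERIV_cdivide[OF has_real_derivative_Re[OF this]] show ?thesis unfolding phi_def .
    qed
  qed (use t in auto)
  moreover have "(\<integral>\<xi>. ?f' t \<xi> \<partial>lborel) = - inverse_fourier (\<lambda>\<xi>. \<Phi> (of_real (- \<xi>) * \<i>) * phi t \<xi>) x"
    unfolding inverse_fourier_def Bochner_Integration.integral_minus[symmetric]
    by (intro Bochner_Integration.integral_cong[OF refl])
      (simp only: mult_minus_left mult_minus_right uminus_complex.sel minus_divide_left)
  ultimately show ?thesis by simp
qed

text \<open>A shift by \<open>y\<close> multiplies the Fourier integrand by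
  \<open>exp (\<i> * \<xi> * y)\<close>, and integrating one minus this factor against
  \<open>m\<close> gives the symbol. Fubini applies because the integrand is at most
  \<open>2 * min 1 y\<close> times the integrable weighted \<open>phi\<close>. No sign of
  \<open>x\<close> enters, so the evolution equation includes \<open>x = 0\<close>.\<close>

lemma Theta_dens:
  assumes t: "t > 0"
  shows "Theta m (dens t) x = inverse_fourier (\<lambda>\<xi>. \<Phi> (of_real (- \<xi>) * \<i>) * phi t \<xi>) x"
proof -
  interpret pair_sigma_finite m lborel ..
  let ?q = "\<lambda>y \<xi>. (1 - exp (- (of_real (- \<xi>) * \<i>) * of_real y)) * phi t \<xi>"
  let ?g = "\<lambda>y \<xi>. Re (iexp (- (\<xi> * x)) * ?q y \<xi>) / (2 * pi)"
  have q_bd: "norm (?q y \<xi>) \<le> 2 * min 1 y * ((1 + \<bar>\<xi>\<bar>) * norm (phi t \<xi>))" if "y > 0" for y \<xi>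
  proof -
    have "norm (1 - exp (- (of_real (- \<xi>) * \<i>) * of_real y)) \<le> (2 + norm (of_real (- \<xi>) * \<i>)) * min 1 y"
      by (rule norm_one_minus_exp[OF that]) simp
    also have "\<dots> \<le> (2 * (1 + \<bar>\<xi>\<bar>)) * min 1 y"
      using that by (intro mult_right_mono) (auto simp: norm_mult)
    finally have "norm (1 - exp (- (of_real (- \<xi>) * \<i>) * of_real y)) * norm (phi t \<xi>)
        \<le> (2 * (1 + \<bar>\<xi>\<bar>)) * min 1 y * norm (phi t \<xi>)" by (rule mult_right_mono) simp
    then show ?thesis by (simp only: norm_mult mult_ac)
  qed
  have int_bd: "integrable lborel (\<lambda>\<xi>. 2 * min 1 y * ((1 + \<bar>\<xi>\<bar>) * norm (phi t \<xi>)))" for y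
    by (intro integrable_mult_right integrable_weighted_phi t)
  have q_int: "integrable lborel (?q y)" if "y > 0" for y
    by (rule Bochner_Integration.integrable_bound[OF int_bd[of y]])
       (use order_trans[OF q_bd[OF that] abs_ge_self] in auto)
  have gm [measurable]: "(\<lambda>(y, \<xi>). ?g y \<xi>) \<in> borel_measurable (m \<Otimes>\<^sub>M lborel)" by measurable
  define C where "C = (\<integral>\<xi>. (1 + \<bar>\<xi>\<bar>) * norm (phi t \<xi>) \<partial>lborel)"
  have gi: "integrable (m \<Otimes>\<^sub>M lborel) (\<lambda>(y, \<xi>). ?g y \<xi>)"
  proof (rule Fubini_integrable[OF gm])
    show "AE y in m. integrable lborel (\<lambda>\<xi>. case (y, \<xi>) of (y, \<xi>) \<Rightarrow> ?g y \<xi>)"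
      using AE_pos
    proof eventually_elim
      case (elim y)
      from integrable_fourier_integrand[OF q_int[OF elim]] show ?case by (simp only: prod.case)
    qed
    show "integrable m (\<lambda>y. \<integral>\<xi>. norm (case (y, \<xi>) of (y, \<xi>) \<Rightarrow> ?g y \<xi>) \<partial>lborel)"
      unfolding prod.case
    proof (rule integrable_min_bound(1)[where C = "2 * C"])
      show "(\<lambda>y. \<integral>\<xi>. norm (?g y \<xi>) \<partial>lborel) \<in> borel_measurable borel" by measurable
      fix y :: real assume y: "y > 0"
      have "(\<integral>\<xi>. norm (?g y \<xi>) \<partial>lborel) \<le> (\<integral>\<xi>. 2 * min 1 y * ((1 + \<bar>\<xi>\<bar>) * norm (phi t \<xi>)) \<partial>lborel)"
      proof (rule integral_mono)
        show "integrable lborel (\<lambda>\<xi>. norm (?g y \<xi>))"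
          by (rule integrable_norm[OF integrable_fourier_integrand[OF q_int[OF y]]])
        show "norm (?g y \<xi>) \<le> 2 * min 1 y * ((1 + \<bar>\<xi>\<bar>) * norm (phi t \<xi>))" for \<xi>
          by (rule order_trans[OF norm_fourier_integrand_le[OF q_int[OF y]] q_bd[OF y]])
      qed (rule int_bd)
      also have "\<dots> = 2 * C * min 1 y" by (simp add: C_def)
      finally show "norm (\<integral>\<xi>. norm (?g y \<xi>) \<partial>lborel) \<le> 2 * C * min 1 y" by simp
    qed
  qed
  have diff: "dens t x - dens t (x - y) = (\<integral>\<xi>. ?g y \<xi> \<partial>lborel)" for y
  proof -
    have "dens t x - dens t (x - y) = (\<integral>\<xi>. Re (iexp (- (\<xi> * x)) * phi t \<xi>) / (2 * pi)
        - Re (iexp (- (\<xi> * (x - y))) * phi t \<xi>) / (2 * pi) \<partial>lborel)"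
      unfolding dens_def inverse_fourier_def
      by (intro Bochner_Integration.integral_diff[symmetric] integrable_fourier_integrand integrable_phi t)
    also have "\<dots> = (\<integral>\<xi>. ?g y \<xi> \<partial>lborel)"
    proof (rule Bochner_Integration.integral_cong[OF refl])
      fix \<xi>
      have "iexp (- (\<xi> * (x - y))) = iexp (- (\<xi> * x)) * exp (- (of_real (- \<xi>) * \<i>) * of_real y)"
        unfolding exp_add[symmetric] by (simp add: algebra_simps)
      then have "iexp (- (\<xi> * x)) * phi t \<xi> - iexp (- (\<xi> * (x - y))) * phi t \<xi> = iexp (- (\<xi> * x)) * ?q y \<xi>"
        by (simp only:) (simp add: algebra_simps)
      then show "Re (iexp (- (\<xi> * x)) * phi t \<xi>) / (2 * pi) - Re (iexp (- (\<xi> * (x - y))) * phi t \<xi>) / (2 * pi) = ?g y \<xi>"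
        by (simp only: diff_divide_distrib[symmetric] minus_complex.sel[symmetric])
    qed
    finally show ?thesis .
  qed
  have "Theta m (dens t) x = (\<integral>y. dens t x - dens t (x - y) \<partial>m)"
    unfolding Theta_def set_lebesgue_integral_def
  proof (rule integral_cong_AE)
    have [measurable]: "dens t \<in> borel_measurable borel"
      unfolding dens_def by (rule borel_measurable_inverse_fourier[OF integrable_phi[OF t]])
    show "(\<lambda>y. indicator {0<..} y *\<^sub>R (dens t x - dens t (x - y))) \<in> borel_measurable m" by measurable
    show "(\<lambda>y. dens t x - dens t (x - y)) \<in> borel_measurable m" by measurable
    show "AE y in m. indicator {0<..} y *\<^sub>R (dens t x - dens t (x - y)) = dens t x - dens t (x - y)"
      using AE_pos by eventually_elim simp
  qed
  also have "\<dots> = (\<integral>y. \<integral>\<xi>. ?g y \<xi> \<partial>lborel \<partial>m)" by (simp only: diff)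
  also have "\<dots> = (\<integral>\<xi>. \<integral>y. ?g y \<xi> \<partial>m \<partial>lborel)"
    by (rule Fubini_integral[OF gi, symmetric])
  also have "\<dots> = inverse_fourier (\<lambda>\<xi>. \<Phi> (of_real (- \<xi>) * \<i>) * phi t \<xi>) x"
    unfolding inverse_fourier_def
  proof (rule Bochner_Integration.integral_cong[OF refl])
    fix \<xi> :: real
    define e where "e = (\<lambda>y. 1 - exp (- (complex_of_real (- \<xi>) * \<i>) * of_real y))"
    have e_int: "integrable m e"
      unfolding e_def
    proof (rule integrable_min_bound(1))
      show "norm (1 - exp (- (complex_of_real (- \<xi>) * \<i>) * of_real y)) \<le> (2 + norm (complex_of_real (- \<xi>) * \<i>)) * min 1 y"
        if "y > 0" for y by (rule norm_one_minus_exp[OF that]) simp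
    qed measurable
    have "(\<integral>y. Re (iexp (- (\<xi> * x)) * (e y * phi t \<xi>)) / (2 * pi) \<partial>m)
      = (\<integral>y. Re (iexp (- (\<xi> * x)) * (e y * phi t \<xi>)) \<partial>m) / (2 * pi)" by simp
    also have "(\<integral>y. Re (iexp (- (\<xi> * x)) * (e y * phi t \<xi>)) \<partial>m) = Re (\<integral>y. iexp (- (\<xi> * x)) * (e y * phi t \<xi>) \<partial>m)"
      by (intro integral_Re integrable_mult_right integrable_mult_left e_int)
    also have "(\<integral>y. iexp (- (\<xi> * x)) * (e y * phi t \<xi>) \<partial>m) = iexp (- (\<xi> * x)) * ((\<integral>y. e y \<partial>m) * phi t \<xi>)"
      by (simp only: integral_mult_right_zero integral_mult_left_zero)
    also have "(\<integral>y. e y \<partial>m) = \<Phi> (of_real (- \<xi>) * \<i>)"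
      unfolding e_def by (rule symbol_eq_integral[symmetric])
    finally show "(\<integral>y. ?g y \<xi> \<partial>m) = Re (iexp (- (\<xi> * x)) * (\<Phi> (of_real (- \<xi>) * \<i>) * phi t \<xi>)) / (2 * pi)"
      unfolding e_def .
  qed
  finally show ?thesis .
qed

text \<open>As \<open>f\<close> vanishes on the left, translation by \<open>y\<close> multiplies its
  transform by \<open>exp (- s * y)\<close> with no boundary term; integrating
  \<open>1 - exp (- s * y)\<close> against \<open>m\<close> then gives the exponent. The bound
  \<open>lip\<close> is what justifies Fubini.\<close>

lemma laplace_Theta:
  fixes f :: "real \<Rightarrow> real"
  assumes [measurable]: "f \<in> borel_measurable borel" and f0: "\<And>x. x < 0 \<Longrightarrow> f x = 0"
    and bd: "\<And>x. \<bar>f x\<bar> \<le> C" and lip: "\<And>x y. y > 0 \<Longrightarrow> \<bar>f x - f (x - y)\<bar> \<le> C' * min 1 y" and s: "s > 0"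
  shows "set_integrable lborel {0..} (\<lambda>x. exp (- s * x) * Theta m f x)"
    and "laplace_transform (Theta m f) s = ((s powr \<nu> + \<eta>) powr \<delta> - \<eta> powr \<delta>) * laplace_transform f s"
proof -
  interpret pair_sigma_finite m lborel ..
  define e where "e = (\<lambda>x::real. indicator {0..} x * exp (- s * x))"
  have em [measurable]: "e \<in> borel_measurable borel" unfolding e_def by measurable
  have e_int: "integrable lborel e"
  proof (rule integrable_cong_AE_imp)
    show "integrable lborel (\<lambda>x. exp (- s * x) * power_kernel 1 x)"
      using has_bochner_integral_laplace_power_kernel[OF zero_less_one s] by (simp add: has_bochner_integral_iff)
    show "AE x in lborel. exp (- s * x) * power_kernel 1 x = e x"
      using AE_lborel_singleton[of 0] by eventually_elim (auto simp: e_def power_kernel_1 indicator_def)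
  qed measurable
  have e0: "e x \<ge> 0" for x by (simp add: e_def)
  have C': "C' \<ge> 0" using lip[of 1 0] by simp
  have fe: "integrable lborel (\<lambda>x. e x * f (x - y))" for y
  proof (rule Bochner_Integration.integrable_bound)
    show "integrable lborel (\<lambda>x. C * e x)" using e_int by (rule integrable_mult_right)
    show "AE x in lborel. norm (e x * f (x - y)) \<le> norm (C * e x)"
    proof (intro AE_I2)
      fix x
      have "norm (e x * f (x - y)) = e x * \<bar>f (x - y)\<bar>" using e0[of x] by (simp add: abs_mult)
      also have "\<dots> \<le> e x * C" using e0[of x] bd by (intro mult_left_mono) auto
      finally show "norm (e x * f (x - y)) \<le> norm (C * e x)" by (simp add: mult.commute)
    qed
  qed measurable
  define L where "L = (\<integral>x. e x * f x \<partial>lborel)"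
  have L: "laplace_transform f s = L"
    unfolding laplace_transform_def set_lebesgue_integral_def L_def e_def
    by (intro Bochner_Integration.integral_cong) auto
  have shift: "(\<integral>x. e x * f (x - y) \<partial>lborel) = exp (- s * y) * L" if y: "y > 0" for y
  proof -
    have "(\<integral>x. e x * f (x - y) \<partial>lborel) = (\<integral>x. e (x + y) * f x \<partial>lborel)"
      using lborel_integral_real_affine[of 1 "\<lambda>x. e x * f (x - y)" y] by (simp add: add.commute)
    also have "\<dots> = (\<integral>x. exp (- s * y) * (e x * f x) \<partial>lborel)"
    proof (rule Bochner_Integration.integral_cong[OF refl])
      fix x
      show "e (x + y) * f x = exp (- s * y) * (e x * f x)"
      proof (cases "x < 0")
        case False
        have "exp (- s * (x + y)) = exp (- s * y) * exp (- s * x)"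
          unfolding exp_add[symmetric] by (simp add: algebra_simps)
        then show ?thesis using False y by (simp add: e_def)
      qed (simp add: f0)
    qed
    finally show ?thesis by (simp add: L_def)
  qed
  let ?g = "\<lambda>y x. e x * (f x - f (x - y))"
  have g_int: "integrable lborel (?g y)" for y
    using fe[of 0] fe[of y] by (simp add: ring_distribs)
  have gi: "integrable (m \<Otimes>\<^sub>M lborel) (\<lambda>(y, x). ?g y x)"
  proof (rule Fubini_integrable)
    show "integrable m (\<lambda>y. \<integral>x. norm (case (y, x) of (y, x) \<Rightarrow> ?g y x) \<partial>lborel)"
      unfolding prod.case
    proof (rule integrable_min_bound(1)[where C = "C' * (\<integral>x. e x \<partial>lborel)"])
      fix y :: real assume y: "y > 0"
      have "(\<integral>x. norm (?g y x) \<partial>lborel) \<le> (\<integral>x. C' * min 1 y * e x \<partial>lborel)"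
      proof (rule integral_mono)
        show "norm (?g y x) \<le> C' * min 1 y * e x" for x
          using mult_left_mono[OF lip[OF y, of x] e0[of x]] e0[of x] by (simp add: abs_mult mult.commute)
      qed (use g_int e_int in auto)
      then show "norm (\<integral>x. norm (?g y x) \<partial>lborel) \<le> C' * (\<integral>x. e x \<partial>lborel) * min 1 y"
        by (simp add: mult_ac)
    qed measurable
    show "AE y in m. integrable lborel (\<lambda>x. case (y, x) of (y, x) \<Rightarrow> ?g y x)"
      using g_int by (simp only: prod.case) simp
    show "(\<lambda>(y, x). ?g y x) \<in> borel_measurable (m \<Otimes>\<^sub>M lborel)" by measurable
  qed
  have th: "(\<integral>y. ?g y x \<partial>m) = indicator {0..} x *\<^sub>R (exp (- s * x) * Theta m f x)" for x
  proof -
    have "Theta m f x = (\<integral>y. f x - f (x - y) \<partial>m)"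
      unfolding Theta_def set_lebesgue_integral_def
      by (intro integral_cong_AE, measurable, use AE_pos in eventually_elim) simp
    then show ?thesis by (simp add: e_def)
  qed
  show "set_integrable lborel {0..} (\<lambda>x. exp (- s * x) * Theta m f x)"
    unfolding set_integrable_def th[symmetric] using integrable_snd[OF gi] by simp
  have "laplace_transform (Theta m f) s = (\<integral>x. \<integral>y. ?g y x \<partial>m \<partial>lborel)"
    unfolding laplace_transform_def set_lebesgue_integral_def th ..
  also have "\<dots> = (\<integral>y. \<integral>x. ?g y x \<partial>lborel \<partial>m)"
    by (rule Fubini_integral[OF gi])
  also have "\<dots> = (\<integral>y. (1 - exp (- s * y)) * L \<partial>m)"
  proof (rule integral_cong_AE)
    show "AE y in m. (\<integral>x. ?g y x \<partial>lborel) = (1 - exp (- s * y)) * L"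
      using AE_pos
    proof eventually_elim
      case (elim y)
      have "(\<integral>x. ?g y x \<partial>lborel) = (\<integral>x. e x * f (x - 0) \<partial>lborel) - (\<integral>x. e x * f (x - y) \<partial>lborel)"
        using Bochner_Integration.integral_diff[OF fe[of 0] fe[of y]] by (simp add: right_diff_distrib)
      then show ?case using shift[OF elim] by (simp add: L_def left_diff_distrib)
    qed
  qed measurable
  also have "\<dots> = ((s powr \<nu> + \<eta>) powr \<delta> - \<eta> powr \<delta>) * L"
    using integral_one_minus_exp[OF s] by (simp add: add.commute)
  finally show "laplace_transform (Theta m f) s = ((s powr \<nu> + \<eta>) powr \<delta> - \<eta> powr \<delta>) * laplace_transform f s"
    unfolding L .
qed

text \<open>The characteristic function of the law is the boundary value of
  \<open>exp (- t * \<Phi> z)\<close>, that is \<open>phi t\<close>; the point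
  \<open>\<xi> = 0\<close> is separate because the symbol is known to be continuous only off
  \<open>0\<close>. The density vanishes on the left almost everywhere since \<open>X\<close> is
  nonnegative, and everywhere by continuity.\<close>

lemma is_continuous_pdf_dens:
  assumes M: "prob_space M" and [measurable]: "X \<in> borel_measurable M" and pos: "AE \<omega> in M. X \<omega> \<ge> 0"
    and t: "t > 0"
    and lap: "\<And>s. s > 0 \<Longrightarrow> (LINT \<omega>|M. exp (- s * X \<omega>)) = exp (- t * ((\<eta> + s powr \<nu>) powr \<delta> - \<eta> powr \<delta>))"
  shows "is_continuous_pdf M X (dens t)" and "x < 0 \<Longrightarrow> dens t x = 0"
proof -
  interpret prob_space M by fact
  define N where "N = distr M borel X"
  interpret N: real_distribution N
    unfolding N_def by (rule real_distribution_distr) simp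
  have Npos: "AE x in N. x \<ge> 0" unfolding N_def by (subst AE_distr_iff) (use pos in auto)
  have F: "(\<lambda>z. exp (- of_real t * \<Phi> z)) holomorphic_on {z. Re z > 0}"
    by (intro holomorphic_on_compose_gen[OF _ holomorphic_on_exp, unfolded comp_def, of _ _ UNIV]
      holomorphic_on_mult holomorphic_on_const holomorphic_laplace_symbol[OF \<eta> \<nu> \<delta> \<nu>\<delta>]) auto
  have "char N \<xi> = phi t \<xi>" for \<xi>
  proof (cases "\<xi> = 0")
    case True
    then show ?thesis by (simp add: N.char_zero phi_def symbol_0)
  next
    case False
    have "(\<lambda>n. exp (- of_real t * \<Phi> (of_real (inverse (real (Suc n))) + of_real (- \<xi>) * \<i>)))
      \<longlonglongrightarrow> (\<integral>x. exp (- (of_real (- \<xi>) * \<i>) * of_real x) \<partial>N)"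
    proof (rule finite_measure_laplace_boundary_value[OF _ _ Npos F])
      show "of_real (\<integral>x. exp (- s * x) \<partial>N) = exp (- of_real t * \<Phi> (of_real s))" if "s > 0" for s
      proof -
        have "(\<integral>x. exp (- s * x) \<partial>N) = exp (- t * ((\<eta> + s powr \<nu>) powr \<delta> - \<eta> powr \<delta>))"
          unfolding N_def lap[OF that, symmetric] by (rule integral_distr) auto
        then show ?thesis
          unfolding laplace_symbol_of_real[OF \<eta> \<nu> \<delta> \<nu>\<delta> that] by (simp flip: exp_of_real)
      qed
    qed (auto simp: N_def intro: finite_measure_distr)
    moreover have "(\<integral>x. exp (- (of_real (- \<xi>) * \<i>) * of_real x) \<partial>N) = char N \<xi>"
      by (simp add: char_def mult_ac)
    moreover have "(\<lambda>n. exp (- of_real t * \<Phi> (of_real (inverse (real (Suc n))) + of_real (- \<xi>) * \<i>)))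
      \<longlonglongrightarrow> phi t \<xi>"
      unfolding phi_def using False
      by (intro tendsto_exp tendsto_mult tendsto_const tendsto_laplace_symbol[OF \<eta> \<nu> \<delta> \<nu>\<delta>]) simp
    ultimately show ?thesis using LIMSEQ_unique by (simp only:) blast
  qed
  then have char: "char N = phi t" by auto
  have int: "integrable lborel (char N)" unfolding char by (rule integrable_phi[OF t])
  have nonneg: "dens t x \<ge> 0" for x using N.inversion_density_nonneg[OF int] unfolding char dens_def .
  have cont: "continuous_on UNIV (dens t)" unfolding dens_def by (rule continuous_inverse_fourier[OF integrable_phi[OF t]])
  have N_eq: "N = density lborel (\<lambda>x. ennreal (dens t x))"
    using N.eq_density_inversion[OF int] unfolding char dens_def .
  show pdf: "is_continuous_pdf M X (dens t)"
    unfolding is_continuous_pdf_def distributed_def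
    using cont nonneg N_eq borel_measurable_continuous_onI[OF cont] by (auto simp: N_def cong: distr_cong)
  show "dens t x = 0" if "x < 0"
  proof (rule ccontr)
    assume "dens t x \<noteq> 0"
    have [measurable]: "dens t \<in> borel_measurable borel" by (rule borel_measurable_continuous_onI[OF cont])
    have "AE y in lborel. 0 < ennreal (dens t y) \<longrightarrow> y \<ge> 0"
      using Npos unfolding N_eq by (subst (asm) AE_density) auto
    then have AE0: "AE y in lborel. y < 0 \<longrightarrow> dens t y = 0"
      by eventually_elim (use nonneg in \<open>auto simp: not_less le_less\<close>)
    have "open ({..<0} \<inter> {y. dens t y \<noteq> 0})"
      using cont by (intro open_Int open_lessThan open_Collect_neq continuous_on_const)
    moreover have "x \<in> {..<0} \<inter> {y. dens t y \<noteq> 0}" using that \<open>dens t x \<noteq> 0\<close> by simp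
    ultimately obtain e where e: "e > 0" "ball x e \<subseteq> {..<0} \<inter> {y. dens t y \<noteq> 0}" using openE by blast
    have "x - e < x + e" using e by simp
    then obtain y where y: "x - e < y" "y < x + e" "y < 0 \<longrightarrow> dens t y = 0" using AE_lborel_between[OF AE0] by blast
    then have "y \<in> ball x e" by (auto simp: dist_real_def)
    then show False using e(2) y(3) by auto
  qed
qed

end

section \<open>The Laplace exponent of the time-changed process\<close>

lemma has_laplace_exponent_nn_integral:
  assumes "has_laplace_exponent M S \<Phi>" "t \<ge> 0" "\<mu> > 0"
  shows "(\<integral>\<^sup>+\<omega>. ennreal (exp (- \<mu> * S t \<omega>)) \<partial>M) = ennreal (exp (- t * \<Phi> \<mu>))"
proof -
  have eq: "(LINT \<omega>|M. exp (- \<mu> * S t \<omega>)) = exp (- t * \<Phi> \<mu>)"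
    using assms by (simp add: has_laplace_exponent_def)
  \<comment> \<open>The integral of a non-integrable function is \<open>0\<close> by convention,
    whereas this value is an exponential.\<close>
  then have "integrable M (\<lambda>\<omega>. exp (- \<mu> * S t \<omega>))"
    by (metis exp_not_eq_zero not_integrable_integral_eq)
  then show ?thesis unfolding eq[symmetric] by (intro nn_integral_eq_integral) auto
qed

lemma subordinator_AE_nonneg:
  assumes "subordinator M S"
  shows "AE \<omega> in M. \<forall>t\<ge>0. S t \<omega> \<ge> 0"
proof -
  have "AE \<omega> in M. S 0 \<omega> = 0 \<and> mono_on {0..} (\<lambda>t. S t \<omega>)"
    using assms by (simp add: subordinator_def)
  then show ?thesis
  proof eventually_elim
    case (elim \<omega>)
    show ?case
    proof (intro allI impI)
      fix t :: real assume "t \<ge> 0"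
      then show "S t \<omega> \<ge> 0"
        using mono_onD[of "{0..}" "\<lambda>t. S t \<omega>" 0 t] elim by simp
    qed
  qed
qed

text \<open>The Laplace parameter \<open>\<mu>\<close> is fixed, so the exponents enter as plain
  numbers: \<open>\<Phi> r\<close> is that of \<open>V r\<close> at \<open>\<mu> * c r\<close>.
  Index \<open>0\<close> of the independent family is the random time.\<close>

locale time_changed_stable_sum = prob_space M
  for M :: "'a measure" +
  fixes n :: nat and c \<Phi> :: "nat \<Rightarrow> real" and V :: "nat \<Rightarrow> real \<Rightarrow> 'a \<Rightarrow> real"
    and T :: "real \<Rightarrow> 'a \<Rightarrow> real" and \<mu> :: real
  assumes sub: "\<And>r. r \<in> {1..n} \<Longrightarrow> subordinator M (V r)" "subordinator M T"
    and c: "\<And>r. r \<in> {1..n} \<Longrightarrow> c r > 0" and \<mu>: "\<mu> > 0"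
    and lap: "\<And>r s. r \<in> {1..n} \<Longrightarrow> s \<ge> 0 \<Longrightarrow>
      (\<integral>\<^sup>+\<omega>. ennreal (exp (- (\<mu> * c r) * V r s \<omega>)) \<partial>M) = ennreal (exp (- s * \<Phi> r))"
    and \<Phi>: "\<And>r. r \<in> {1..n} \<Longrightarrow> \<Phi> r \<ge> 0"
    and indep: "independent_processes M (\<lambda>r. if r = 0 then T else V r) {0..n}"
begin

definition Y :: "real \<Rightarrow> 'a \<Rightarrow> real" where "Y s \<omega> = (\<Sum>r=1..n. c r * V r s \<omega>)"

definition \<psi> :: real where "\<psi> = (\<Sum>r=1..n. \<Phi> r)"

lemma measurable_T [measurable]: "t \<ge> 0 \<Longrightarrow> T t \<in> borel_measurable M"
  using sub(2) by (simp add: subordinator_def)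

lemma measurable_Y [measurable]: "s \<ge> 0 \<Longrightarrow> Y s \<in> borel_measurable M"
  unfolding Y_def using sub(1) by (intro borel_measurable_sum borel_measurable_times) (auto simp: subordinator_def)

lemma AE_T_nonneg: "AE \<omega> in M. \<forall>t\<ge>0. T t \<omega> \<ge> 0"
  by (rule subordinator_AE_nonneg[OF sub(2)])

lemma AE_Y_mono: "AE \<omega> in M. mono_on {0..} (\<lambda>s. Y s \<omega>)"
proof -
  have "AE \<omega> in M. \<forall>r\<in>{1..n}. mono_on {0..} (\<lambda>t. V r t \<omega>)"
    using sub(1) by (intro AE_finite_allI) (auto simp: subordinator_def)
  then show ?thesis
  proof eventually_elim
    case (elim \<omega>)
    show ?case
    proof (rule mono_onI)
      fix a b :: real assume "a \<in> {0..}" "b \<in> {0..}" "a \<le> b"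
      then show "Y a \<omega> \<le> Y b \<omega>"
        unfolding Y_def using elim c by (intro sum_mono mult_left_mono) (auto simp: mono_on_def less_imp_le)
    qed
  qed
qed

lemma AE_Y_nonneg: "AE \<omega> in M. \<forall>s\<ge>0. Y s \<omega> \<ge> 0"
proof -
  have "AE \<omega> in M. \<forall>r\<in>{1..n}. \<forall>t\<ge>0. V r t \<omega> \<ge> 0"
    using subordinator_AE_nonneg[OF sub(1)] by (intro AE_finite_allI) auto
  then show ?thesis
    by eventually_elim (auto simp: Y_def less_imp_le[OF c] intro!: sum_nonneg mult_nonneg_nonneg)
qed

text \<open>At a deterministic time every factor depends on a single process of the family, so
  independence splits the expectation. The event \<open>A\<close> later prescribes the grid cell of
  the random time.\<close>

lemma nn_integral_fixed_time:
  assumes t: "t \<ge> 0" and s: "s \<ge> 0" and A [measurable]: "A \<in> sets borel"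
  shows "(\<integral>\<^sup>+\<omega>. indicator A (T t \<omega>) * ennreal (exp (- \<mu> * Y s \<omega>)) \<partial>M)
    = (\<integral>\<^sup>+\<omega>. indicator A (T t \<omega>) * ennreal (exp (- \<psi> * s)) \<partial>M)"
proof -
  define f where "f = (\<lambda>i (w :: real \<Rightarrow> real). if i = 0 then indicator A (w t) else ennreal (exp (- (\<mu> * c i) * w s)))"
  define Z where "Z = (\<lambda>i \<omega>. f i (restrict (\<lambda>t. (if i = 0 then T else V i) t \<omega>) {0..}))"
  have Z: "Z 0 \<omega> = indicator A (T t \<omega>)" "i > 0 \<Longrightarrow> Z i \<omega> = ennreal (exp (- (\<mu> * c i) * V i s \<omega>))" for i \<omega>
    using t s by (simp_all add: Z_def f_def)
  have "indep_vars (\<lambda>_. borel) Z {0..n}"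
    unfolding Z_def
  proof (rule indep_vars_compose2[where Y = f and M' = "\<lambda>_. PiM {0..} (\<lambda>_. borel)"])
    show "indep_vars (\<lambda>_. PiM {0..} (\<lambda>_. borel)) (\<lambda>i \<omega>. restrict (\<lambda>t. (if i = 0 then T else V i) t \<omega>) {0..}) {0..n}"
      using indep by (simp add: independent_processes_def)
    have [measurable]: "(\<lambda>w. w u) \<in> borel_measurable (PiM {0..} (\<lambda>_. borel :: real measure))" if "u \<ge> 0" for u :: real
      using that by (intro measurable_component_singleton) auto
    show "f i \<in> borel_measurable (PiM {0..} (\<lambda>_. borel))" for i
      using t s unfolding f_def by (cases "i = 0") simp_all
  qed
  then have "(\<integral>\<^sup>+\<omega>. (\<Prod>i\<in>{0..n}. Z i \<omega>) \<partial>M) = (\<Prod>i\<in>{0..n}. \<integral>\<^sup>+\<omega>. Z i \<omega> \<partial>M)"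
    by (intro indep_vars_nn_integral) auto
  moreover have I: "{0..n} = insert 0 {1..n}" by auto
  moreover have "(\<Prod>i\<in>{0..n}. Z i \<omega>) = indicator A (T t \<omega>) * ennreal (exp (- \<mu> * Y s \<omega>))" for \<omega>
  proof -
    have "(\<Prod>i\<in>{1..n}. Z i \<omega>) = (\<Prod>i\<in>{1..n}. ennreal (exp (- (\<mu> * c i) * V i s \<omega>)))"
      by (intro prod.cong) (auto simp: Z)
    also have "\<dots> = ennreal (exp (\<Sum>i=1..n. - (\<mu> * c i) * V i s \<omega>))"
      by (simp add: prod_ennreal exp_sum)
    also have "(\<Sum>i=1..n. - (\<mu> * c i) * V i s \<omega>) = - \<mu> * Y s \<omega>"
      by (simp add: Y_def sum_distrib_left sum_negf mult_ac)
    finally show ?thesis unfolding I by (simp add: Z)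
  qed
  moreover have "(\<Prod>i\<in>{0..n}. \<integral>\<^sup>+\<omega>. Z i \<omega> \<partial>M) = (\<integral>\<^sup>+\<omega>. indicator A (T t \<omega>) * ennreal (exp (- \<psi> * s)) \<partial>M)"
  proof -
    have "(\<Prod>i\<in>{1..n}. \<integral>\<^sup>+\<omega>. Z i \<omega> \<partial>M) = (\<Prod>i\<in>{1..n}. ennreal (exp (- s * \<Phi> i)))"
      using lap s by (intro prod.cong) (auto simp: Z)
    also have "\<dots> = ennreal (exp (- \<psi> * s))"
      by (simp add: prod_ennreal \<psi>_def sum_distrib_left sum_distrib_right sum_negf mult_ac flip: exp_sum)
    finally have P: "(\<Prod>i\<in>{1..n}. \<integral>\<^sup>+\<omega>. Z i \<omega> \<partial>M) = ennreal (exp (- \<psi> * s))" .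
    have "(\<Prod>i\<in>{0..n}. \<integral>\<^sup>+\<omega>. Z i \<omega> \<partial>M) = (\<integral>\<^sup>+\<omega>. Z 0 \<omega> \<partial>M) * (\<Prod>i\<in>{1..n}. \<integral>\<^sup>+\<omega>. Z i \<omega> \<partial>M)"
      unfolding I by (rule prod.insert) auto
    then show ?thesis unfolding P Z(1) using t by (simp add: nn_integral_multc)
  qed
  ultimately show ?thesis by simp
qed

text \<open>Since \<open>T t\<close> and the process \<open>Y\<close> are independent, \<open>Y\<close> may be evaluated at a discretisation
  of \<open>T t\<close>; paths are monotone but not assumed right-continuous, so \<open>Y (T t)\<close> is squeezed between
  the two neighbouring grid times.\<close>

lemma nn_integral_grid_time:
  assumes t: "t \<ge> 0" and N: "N > (0::nat)" and i: "i \<ge> (0::real)"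
  shows "(\<integral>\<^sup>+\<omega>. ennreal (exp (- \<mu> * Y ((real (nat \<lfloor>real N * T t \<omega>\<rfloor>) + i) / real N) \<omega>)) \<partial>M)
    = (\<integral>\<^sup>+\<omega>. ennreal (exp (- \<psi> * ((real (nat \<lfloor>real N * T t \<omega>\<rfloor>) + i) / real N))) \<partial>M)"
proof -
  \<comment> \<open>These sets partition the line, so each sum over \<open>j\<close> below has
    exactly one nonzero term.\<close>
  define A where "A = (\<lambda>j. {x. nat \<lfloor>real N * x\<rfloor> = j})"
  have A [measurable]: "A j \<in> sets borel" for j unfolding A_def by measurable
  have split: "(\<Sum>j. indicator (A j) x * (g j :: ennreal)) = g (nat \<lfloor>real N * x\<rfloor>)" for x g
  proof -
    have "(\<Sum>j. indicator (A j) x * g j) = (\<Sum>j\<in>{nat \<lfloor>real N * x\<rfloor>}. indicator (A j) x * g j)"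
      by (rule suminf_finite) (auto simp: A_def)
    then show ?thesis by (simp add: A_def)
  qed
  have s: "(real j + i) / real N \<ge> 0" for j using i by simp
  have "(\<integral>\<^sup>+\<omega>. ennreal (exp (- \<mu> * Y ((real (nat \<lfloor>real N * T t \<omega>\<rfloor>) + i) / real N) \<omega>)) \<partial>M)
    = (\<integral>\<^sup>+\<omega>. (\<Sum>j. indicator (A j) (T t \<omega>) * ennreal (exp (- \<mu> * Y ((real j + i) / real N) \<omega>))) \<partial>M)"
    by (simp only: split)
  also have "\<dots> = (\<Sum>j. \<integral>\<^sup>+\<omega>. indicator (A j) (T t \<omega>) * ennreal (exp (- \<mu> * Y ((real j + i) / real N) \<omega>)) \<partial>M)"
    using t s measurable_Y[OF s] by (intro nn_integral_suminf) simp
  also have "\<dots> = (\<Sum>j. \<integral>\<^sup>+\<omega>. indicator (A j) (T t \<omega>) * ennreal (exp (- \<psi> * ((real j + i) / real N))) \<partial>M)"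
    by (intro suminf_cong nn_integral_fixed_time t s A)
  also have "\<dots> = (\<integral>\<^sup>+\<omega>. (\<Sum>j. indicator (A j) (T t \<omega>) * ennreal (exp (- \<psi> * ((real j + i) / real N)))) \<partial>M)"
    using t by (intro nn_integral_suminf[symmetric]) simp
  also have "\<dots> = (\<integral>\<^sup>+\<omega>. ennreal (exp (- \<psi> * ((real (nat \<lfloor>real N * T t \<omega>\<rfloor>) + i) / real N))) \<partial>M)"
    by (simp only: split)
  finally show ?thesis .
qed

text \<open>Rounding the random time down or up moves it by at most \<open>1 / N\<close>. Monotone
  paths then trap the left side between \<open>exp (- \<psi> / N)\<close> and
  \<open>exp (\<psi> / N)\<close> times the right side, for every \<open>N\<close>.\<close>

lemma expectation_time_changed:
  assumes t: "t \<ge> 0" and X [measurable]: "(\<lambda>\<omega>. Y (T t \<omega>) \<omega>) \<in> borel_measurable M"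
  shows "expectation (\<lambda>\<omega>. exp (- \<mu> * Y (T t \<omega>) \<omega>)) = expectation (\<lambda>\<omega>. exp (- \<psi> * T t \<omega>))"
proof -
  define a where "a = expectation (\<lambda>\<omega>. exp (- \<mu> * Y (T t \<omega>) \<omega>))"
  define b where "b = expectation (\<lambda>\<omega>. exp (- \<psi> * T t \<omega>))"
  have \<psi>: "\<psi> \<ge> 0" unfolding \<psi>_def by (intro sum_nonneg \<Phi>)
  have [measurable]: "T t \<in> borel_measurable M" using t by (rule measurable_T)
  have "integrable M (\<lambda>\<omega>. exp (- \<mu> * Y (T t \<omega>) \<omega>))"
    by (rule integrable_const_bound[where B = 1], use AE_T_nonneg AE_Y_nonneg in eventually_elim) (use t \<mu> in auto)
  then have a: "ennreal a = (\<integral>\<^sup>+\<omega>. ennreal (exp (- \<mu> * Y (T t \<omega>) \<omega>)) \<partial>M)"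
    unfolding a_def by (intro nn_integral_eq_integral[symmetric]) auto
  have "integrable M (\<lambda>\<omega>. exp (- \<psi> * T t \<omega>))"
    by (rule integrable_const_bound[where B = 1], use AE_T_nonneg in eventually_elim) (use t \<psi> in auto)
  then have b: "ennreal b = (\<integral>\<^sup>+\<omega>. ennreal (exp (- \<psi> * T t \<omega>)) \<partial>M)"
    unfolding b_def by (intro nn_integral_eq_integral[symmetric]) auto
  have b0: "b \<ge> 0" unfolding b_def by (intro integral_nonneg_AE) auto
  have a0: "a \<ge> 0" unfolding a_def by (intro integral_nonneg_AE) auto
  have grid: "real (nat \<lfloor>real N * x\<rfloor>) / real N \<le> x" "x \<le> (real (nat \<lfloor>real N * x\<rfloor>) + 1) / real N"
    if "x \<ge> 0" "N > 0" for x N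
  proof -
    have "real (nat \<lfloor>real N * x\<rfloor>) = of_int \<lfloor>real N * x\<rfloor>" using that by simp
    then show "real (nat \<lfloor>real N * x\<rfloor>) / real N \<le> x" "x \<le> (real (nat \<lfloor>real N * x\<rfloor>) + 1) / real N"
      using that of_int_floor_le[of "real N * x"] real_of_int_floor_add_one_ge[of "real N * x"]
      by (simp_all add: field_simps)
  qed
  have upper: "a \<le> exp (\<psi> / real N) * b" if N: "N > 0" for N
  proof -
    have "ennreal a \<le> (\<integral>\<^sup>+\<omega>. ennreal (exp (- \<mu> * Y ((real (nat \<lfloor>real N * T t \<omega>\<rfloor>) + 0) / real N) \<omega>)) \<partial>M)"
      unfolding a
    proof (rule nn_integral_mono_AE)
      show "AE \<omega> in M. ennreal (exp (- \<mu> * Y (T t \<omega>) \<omega>))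
          \<le> ennreal (exp (- \<mu> * Y ((real (nat \<lfloor>real N * T t \<omega>\<rfloor>) + 0) / real N) \<omega>))"
        using AE_T_nonneg AE_Y_mono
      proof eventually_elim
        case (elim \<omega>)
        then have "Y (real (nat \<lfloor>real N * T t \<omega>\<rfloor>) / real N) \<omega> \<le> Y (T t \<omega>) \<omega>"
          using grid[of "T t \<omega>" N] t N by (intro mono_onD[OF elim(2)]) auto
        then show ?case using \<mu> by (simp add: ennreal_le_iff)
      qed
    qed
    also have "\<dots> = (\<integral>\<^sup>+\<omega>. ennreal (exp (- \<psi> * ((real (nat \<lfloor>real N * T t \<omega>\<rfloor>) + 0) / real N))) \<partial>M)"
      by (rule nn_integral_grid_time) (use t N in auto)
    also have "\<dots> \<le> (\<integral>\<^sup>+\<omega>. ennreal (exp (\<psi> / real N)) * ennreal (exp (- \<psi> * T t \<omega>)) \<partial>M)"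
    proof (rule nn_integral_mono_AE)
      show "AE \<omega> in M. ennreal (exp (- \<psi> * ((real (nat \<lfloor>real N * T t \<omega>\<rfloor>) + 0) / real N)))
          \<le> ennreal (exp (\<psi> / real N)) * ennreal (exp (- \<psi> * T t \<omega>))"
        using AE_T_nonneg
      proof eventually_elim
        case (elim \<omega>)
        then have "T t \<omega> - 1 / real N \<le> real (nat \<lfloor>real N * T t \<omega>\<rfloor>) / real N"
          using grid(2)[of "T t \<omega>" N] t N by (simp add: add_divide_distrib)
        then have "\<psi> * (T t \<omega> - 1 / real N) \<le> \<psi> * (real (nat \<lfloor>real N * T t \<omega>\<rfloor>) / real N)"
          using \<psi> by (intro mult_left_mono)
        then show ?case
          by (simp add: ennreal_le_iff algebra_simps flip: ennreal_mult' exp_add)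
      qed
    qed
    also have "\<dots> = ennreal (exp (\<psi> / real N) * b)"
      using b0 by (simp add: nn_integral_cmult b ennreal_mult)
    finally show ?thesis using b0 by (simp add: ennreal_le_iff)
  qed
  have le: "exp (- \<psi> / real N) * exp (- \<psi> * \<tau>) \<le> exp (- \<psi> * q)" if "\<psi> * q \<le> \<psi> * (\<tau> + 1 / real N)" for N q \<tau>
    using that by (simp add: ring_distribs flip: exp_add)
  have lower: "exp (- \<psi> / real N) * b \<le> a" if N: "N > 0" for N
  proof -
    have "ennreal (exp (- \<psi> / real N) * b) = (\<integral>\<^sup>+\<omega>. ennreal (exp (- \<psi> / real N)) * ennreal (exp (- \<psi> * T t \<omega>)) \<partial>M)"
      using b0 by (simp add: nn_integral_cmult b ennreal_mult)
    also have "\<dots> \<le> (\<integral>\<^sup>+\<omega>. ennreal (exp (- \<psi> * ((real (nat \<lfloor>real N * T t \<omega>\<rfloor>) + 1) / real N))) \<partial>M)"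
    proof (rule nn_integral_mono_AE)
      show "AE \<omega> in M. ennreal (exp (- \<psi> / real N)) * ennreal (exp (- \<psi> * T t \<omega>))
        \<le> ennreal (exp (- \<psi> * ((real (nat \<lfloor>real N * T t \<omega>\<rfloor>) + 1) / real N)))"
        using AE_T_nonneg
      proof eventually_elim
        case (elim \<omega>)
        then have "(real (nat \<lfloor>real N * T t \<omega>\<rfloor>) + 1) / real N \<le> T t \<omega> + 1 / real N"
          using grid(1)[of "T t \<omega>" N] t N by (simp add: add_divide_distrib)
        then have "\<psi> * ((real (nat \<lfloor>real N * T t \<omega>\<rfloor>) + 1) / real N) \<le> \<psi> * (T t \<omega> + 1 / real N)"
          using \<psi> by (intro mult_left_mono)
        then have "exp (- \<psi> / real N) * exp (- \<psi> * T t \<omega>) \<le> exp (- \<psi> * ((real (nat \<lfloor>real N * T t \<omega>\<rfloor>) + 1) / real N))"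
          by (rule le)
        then show ?case
          unfolding ennreal_mult'[OF exp_ge_zero, symmetric] by (rule ennreal_leI)
      qed
    qed
    also have "\<dots> = (\<integral>\<^sup>+\<omega>. ennreal (exp (- \<mu> * Y ((real (nat \<lfloor>real N * T t \<omega>\<rfloor>) + 1) / real N) \<omega>)) \<partial>M)"
      by (rule nn_integral_grid_time[symmetric]) (use t N in auto)
    also have "\<dots> \<le> ennreal a"
      unfolding a
    proof (rule nn_integral_mono_AE)
      show "AE \<omega> in M. ennreal (exp (- \<mu> * Y ((real (nat \<lfloor>real N * T t \<omega>\<rfloor>) + 1) / real N) \<omega>))
          \<le> ennreal (exp (- \<mu> * Y (T t \<omega>) \<omega>))"
        using AE_T_nonneg AE_Y_mono
      proof eventually_elim
        case (elim \<omega>)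
        then have "Y (T t \<omega>) \<omega> \<le> Y ((real (nat \<lfloor>real N * T t \<omega>\<rfloor>) + 1) / real N) \<omega>"
          using grid[of "T t \<omega>" N] t N by (intro mono_onD[OF elim(2)]) auto
        then show ?case using \<mu> by (simp add: ennreal_le_iff)
      qed
    qed
    finally show ?thesis using a0 by (simp add: ennreal_le_iff)
  qed
  have "(\<lambda>N. exp (\<psi> / real N) * b) \<longlonglongrightarrow> exp 0 * b"
    by (intro tendsto_intros lim_const_over_n)
  then have "a \<le> exp 0 * b"
    by (rule LIMSEQ_le_const) (intro exI[of _ 1] allI impI upper, simp)
  then have "a \<le> b" by simp
  have "(\<lambda>N. exp (- \<psi> / real N) * b) \<longlonglongrightarrow> exp 0 * b"
    by (intro tendsto_intros lim_const_over_n)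
  then have "exp 0 * b \<le> a"
    by (rule LIMSEQ_le_const2) (intro exI[of _ 1] allI impI lower, simp)
  then have "b \<le> a" by simp
  with \<open>a \<le> b\<close> show ?thesis by (simp add: a_def b_def)
qed

end

text \<open>The weights in \<open>stable_sum\<close> are roots chosen so that stability turns them
  into binomial coefficients and powers of \<open>\<eta>\<close>. By the binomial theorem the
  exponent \<open>\<psi>\<close> of the sum satisfies
  \<open>\<eta> ^ n + \<psi> = (\<eta> + \<mu> powr \<nu>) ^ n\<close>, and the tempered exponent
  takes the power \<open>\<delta> / n\<close> of this.\<close>

lemma laplace_exponent_time_changed_stable_sum:
  fixes M :: "'a measure"
  assumes "prob_space M" and \<delta>: "\<delta> > 0" and \<eta>: "\<eta> > 0" and n: "n \<ge> 1" and \<nu>: "0 < \<nu>"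
    and V: "\<And>r. r \<in> {1..n} \<Longrightarrow> stable_subordinator M (\<nu> * real r) (V r)"
    and T: "tempered_stable_subordinator M \<eta> \<delta> n T"
    and indep: "independent_processes M (\<lambda>r. if r = 0 then T else V r) {0..n}"
    and meas: "time_changed (stable_sum \<eta> \<nu> n V) T t \<in> borel_measurable M"
    and t: "t \<ge> 0" and \<mu>: "\<mu> > 0"
  shows "(LINT \<omega>|M. exp (- \<mu> * time_changed (stable_sum \<eta> \<nu> n V) T t \<omega>))
      = exp (- t * ((\<eta> + \<mu> powr \<nu>) powr \<delta> - \<eta> powr \<delta>))"
    and "AE \<omega> in M. time_changed (stable_sum \<eta> \<nu> n V) T t \<omega> \<ge> 0"
proof -
  define c where "c = (\<lambda>r. real (n choose r) powr (1 / (\<nu> * real r)) * \<eta> powr (real (n - r) / (\<nu> * real r)))"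
  define \<Phi> where "\<Phi> = (\<lambda>r. (\<mu> * c r) powr (\<nu> * real r))"
  have c: "c r > 0" if "r \<in> {1..n}" for r
    using that \<eta> unfolding c_def by (intro mult_pos_pos) auto
  interpret time_changed_stable_sum M n c \<Phi> V T \<mu>
  proof (intro time_changed_stable_sum.intro time_changed_stable_sum_axioms.intro)
    show "prob_space M" by fact
    show "subordinator M (V r)" if "r \<in> {1..n}" for r using V[OF that] by (simp add: stable_subordinator_def)
    show "subordinator M T" using T by (simp add: tempered_stable_subordinator_def)
    show "(\<integral>\<^sup>+\<omega>. ennreal (exp (- (\<mu> * c r) * V r s \<omega>)) \<partial>M) = ennreal (exp (- s * \<Phi> r))"
      if "r \<in> {1..n}" "s \<ge> 0" for r s
      unfolding \<Phi>_def using V[OF that(1)] that c[OF that(1)] \<mu>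
      by (intro has_laplace_exponent_nn_integral) (auto simp: stable_subordinator_def)
    show "\<Phi> r \<ge> 0" for r by (simp add: \<Phi>_def)
  qed (use c \<mu> indep in auto)
  have Y: "Y s \<omega> = stable_sum \<eta> \<nu> n V s \<omega>" for s \<omega>
    unfolding Y_def stable_sum_def unfolding c_def ..
  have X: "time_changed (stable_sum \<eta> \<nu> n V) T t \<omega> = Y (T t \<omega>) \<omega>" for \<omega>
    by (simp add: time_changed_def Y)
  show "AE \<omega> in M. time_changed (stable_sum \<eta> \<nu> n V) T t \<omega> \<ge> 0"
    using AE_T_nonneg AE_Y_nonneg unfolding X by eventually_elim (use t in auto)
  have \<Phi>_eq: "\<Phi> r = real (n choose r) * (\<mu> powr \<nu>) ^ r * \<eta> ^ (n - r)" if r: "r \<in> {1..n}" for r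
  proof -
    have r0: "\<nu> * real r \<noteq> 0" using r \<nu> by auto
    have "c r powr (\<nu> * real r) = real (n choose r) * \<eta> ^ (n - r)"
      using r r0 \<eta> \<nu> by (simp add: c_def powr_mult powr_powr powr_realpow del: of_nat_diff)
    moreover have "\<mu> powr (\<nu> * real r) = (\<mu> powr \<nu>) ^ r"
      using \<mu> by (simp add: powr_realpow[symmetric] powr_powr)
    ultimately show ?thesis
      unfolding \<Phi>_def using c[OF r] \<mu> by (simp add: powr_mult)
  qed
  have \<psi>: "\<eta> ^ n + \<psi> = (\<eta> + \<mu> powr \<nu>) ^ n"
  proof -
    have I: "{..n} = insert 0 {1..n}" by auto
    have "(\<eta> + \<mu> powr \<nu>) ^ n = (\<mu> powr \<nu> + \<eta>) ^ n" by (simp add: add.commute)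
    also have "\<dots> = (\<Sum>r\<le>n. real (n choose r) * (\<mu> powr \<nu>) ^ r * \<eta> ^ (n - r))" by (rule binomial_ring)
    also have "\<dots> = \<eta> ^ n + (\<Sum>r=1..n. real (n choose r) * (\<mu> powr \<nu>) ^ r * \<eta> ^ (n - r))"
      unfolding I by (subst sum.insert) auto
    also have "(\<Sum>r=1..n. real (n choose r) * (\<mu> powr \<nu>) ^ r * \<eta> ^ (n - r)) = \<psi>"
      unfolding \<psi>_def by (intro sum.cong) (simp_all add: \<Phi>_eq)
    finally show ?thesis ..
  qed
  have "\<eta> ^ n < (\<eta> + \<mu> powr \<nu>) ^ n"
    using \<eta> \<mu> n by (intro power_strict_mono) auto
  then have \<psi>0: "\<psi> > 0" using \<psi> by linarith
  have m: "(\<lambda>\<omega>. Y (T t \<omega>) \<omega>) \<in> borel_measurable M" using meas by (simp add: X[symmetric])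
  have "(LINT \<omega>|M. exp (- \<mu> * Y (T t \<omega>) \<omega>)) = (LINT \<omega>|M. exp (- \<psi> * T t \<omega>))"
    by (rule expectation_time_changed[OF t m])
  also have "\<dots> = exp (- t * ((\<eta> ^ n + \<psi>) powr (\<delta> / real n) - \<eta> powr \<delta>))"
    using T t \<psi>0 by (simp add: tempered_stable_subordinator_def has_laplace_exponent_def)
  also have "(\<eta> ^ n + \<psi>) powr (\<delta> / real n) = (\<eta> + \<mu> powr \<nu>) powr \<delta>"
  proof -
    have "\<eta> + \<mu> powr \<nu> > 0" using \<eta> by (simp add: add_pos_nonneg)
    then have "(\<eta> + \<mu> powr \<nu>) ^ n = (\<eta> + \<mu> powr \<nu>) powr real n" by (simp add: powr_realpow)
    then show ?thesis unfolding \<psi> using n by (simp add: powr_powr)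
  qed
  finally show "(LINT \<omega>|M. exp (- \<mu> * time_changed (stable_sum \<eta> \<nu> n V) T t \<omega>))
      = exp (- t * ((\<eta> + \<mu> powr \<nu>) powr \<delta> - \<eta> powr \<delta>))"
    unfolding X .
qed

theorem mainTheorem2:
  fixes M :: "'a measure"
    and \<delta> \<eta> \<nu> :: real and n :: nat
    and V :: "nat \<Rightarrow> real \<Rightarrow> 'a \<Rightarrow> real"
    and T X :: "real \<Rightarrow> 'a \<Rightarrow> real"
    and m :: "real measure"
    and v :: "real \<Rightarrow> real \<Rightarrow> real"
  assumes "prob_space M"
    and "\<delta> > 0" and "\<eta> > 0" and "n = nat \<lceil>\<delta>\<rceil>"
    and "0 < \<nu>" and "\<nu> < 1"
    and "\<And>r. r \<in> {1..n} \<Longrightarrow> 0 < \<nu> * real r \<and> \<nu> * real r < 1"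
    and "\<And>r. r \<in> {1..n} \<Longrightarrow> stable_subordinator M (\<nu> * real r) (V r)"
    and "tempered_stable_subordinator M \<eta> \<delta> n T"
    and "independent_processes M (\<lambda>r. if r = 0 then T else V r) {0..n}"
    and "X = time_changed (stable_sum \<eta> \<nu> n V) T"
    and "\<And>t. t \<ge> 0 \<Longrightarrow> X t \<in> borel_measurable M"
    and "is_levy_measure M X m"
    and "v = (\<lambda>x t. pdf M (X t) x)"
  shows "(\<forall>t>0. is_continuous_pdf M (X t) (\<lambda>x. v x t) \<and> (\<lambda>x. v x t) \<in> half_line_C1)
    \<and> (\<forall>t>0. \<forall>x\<ge>0.
          ((\<lambda>s. v x s) has_real_derivative - Theta m (\<lambda>z. v z t) x) (at t))
    \<and> (\<forall>f\<in>half_line_C1. \<forall>x>0.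
          set_integrable m {0<..} (\<lambda>y. f x - f (x - y)) \<and>
          (\<forall>\<theta>>0. Theta m f x =
             prabhakar_derivative \<theta> \<nu> (\<nu> * \<delta>) (- \<eta>) \<delta> f x - \<eta> powr \<delta> * f x))
    \<and> (\<forall>t>0. \<forall>\<mu>>0.
          set_integrable lborel {0..} (\<lambda>x. exp (- \<mu> * x) * Theta m (\<lambda>z. v z t) x) \<and>
          laplace_transform (Theta m (\<lambda>z. v z t)) \<mu> =
             ((\<mu> powr \<nu> + \<eta>) powr \<delta> - \<eta> powr \<delta>) * laplace_transform (\<lambda>x. v x t) \<mu>)"
proof -
  have n: "real n \<ge> \<delta>" "n \<ge> 1" using assms(2,4) by linarith+
  \<comment> \<open>The hypothesis on \<open>\<nu> * r\<close> at \<open>r = n\<close>, combined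
    with \<open>\<delta> \<le> n\<close>.\<close>
  have "\<nu> * \<delta> \<le> \<nu> * real n" using n assms(5) by (intro mult_left_mono) auto
  also have "\<dots> < 1" using assms(7)[of n] n by auto
  finally have \<nu>\<delta>: "\<nu> * \<delta> < 1" .
  have X_meas: "X t \<in> borel_measurable M" if "t \<ge> 0" for t using assms(12)[OF that] .
  have lap: "(LINT \<omega>|M. exp (- \<mu> * X t \<omega>)) = exp (- t * ((\<eta> + \<mu> powr \<nu>) powr \<delta> - \<eta> powr \<delta>))"
    if "t \<ge> 0" "\<mu> > 0" for t \<mu>
    using laplace_exponent_time_changed_stable_sum(1)[OF assms(1-3) n(2) assms(5,8-10) _ that] X_meas[OF that(1)]
    unfolding assms(11) by simp
  have X_pos: "AE \<omega> in M. X t \<omega> \<ge> 0" if "t \<ge> 0" for t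
    using laplace_exponent_time_changed_stable_sum(2)[OF assms(1-3) n(2) assms(5,8-10) _ that zero_less_one] X_meas[OF that]
    unfolding assms(11) by simp
  obtain b where b: "b \<ge> 0" "has_laplace_exponent M X (\<lambda>\<mu>. b * \<mu> + (LINT x:{0<..}|m. 1 - exp (- \<mu> * x)))"
    using assms(13) by (auto simp: is_levy_measure_def)
  interpret levy_symbol \<eta> \<nu> \<delta> b m
  proof
    show "(\<eta> + s powr \<nu>) powr \<delta> - \<eta> powr \<delta> = b * s + (LINT x:{0<..}|m. 1 - exp (- s * x))" if "s > 0" for s
    proof -
      \<comment> \<open>Both exponents describe the same expectation at time \<open>1\<close>, and
        \<open>exp\<close> is injective.\<close>
      have "exp (- 1 * ((\<eta> + s powr \<nu>) powr \<delta> - \<eta> powr \<delta>)) = exp (- 1 * (b * s + (LINT x:{0<..}|m. 1 - exp (- s * x))))"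
        unfolding lap[OF zero_le_one that, symmetric]
        using b(2) that zero_le_one unfolding has_laplace_exponent_def by blast
      then have "- 1 * ((\<eta> + s powr \<nu>) powr \<delta> - \<eta> powr \<delta>) = - 1 * (b * s + (LINT x:{0<..}|m. 1 - exp (- s * x)))"
        by (rule exp_inj_iff[THEN iffD1])
      moreover have "- 1 * u = - 1 * w \<Longrightarrow> u = w" for u w :: real by simp
      ultimately show ?thesis by blast
    qed
  qed (use assms b \<nu>\<delta> in \<open>auto simp: is_levy_measure_def\<close>)
  have pdf: "is_continuous_pdf M (X t) (dens t)" and dens0: "\<And>x. x < 0 \<Longrightarrow> dens t x = 0" if "t > 0" for t
    using is_continuous_pdf_dens[OF assms(1) X_meas X_pos that lap] that by auto
  have v: "(\<lambda>x. v x t) = dens t" if "t > 0" for t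
    unfolding assms(14) using pdf_eqI[OF pdf[OF that]] by simp
  have C1: "dens t \<in> half_line_C1" if "t > 0" for t
    unfolding half_line_C1_def
  proof (intro CollectI conjI allI impI exI)
    show "dens t x = 0" if "x < 0" for x using dens0[OF \<open>t > 0\<close> that] .
    show "continuous_on {0..} (inverse_fourier (\<lambda>\<xi>. - \<i> * of_real \<xi> * phi t \<xi>))"
      by (rule continuous_on_subset[OF continuous_inverse_fourier[OF integrable_dens_deriv[OF that]]]) simp
    show "(dens t has_real_derivative inverse_fourier (\<lambda>\<xi>. - \<i> * of_real \<xi> * phi t \<xi>) x) (at x within {0..})" for x
      by (rule has_field_derivative_at_within[OF has_real_derivative_dens_space[OF that]])
  qed
  have part2: "((\<lambda>s. v x s) has_real_derivative - Theta m (\<lambda>z. v z t) x) (at t)" if t: "t > 0" for x t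
  proof -
    have "((\<lambda>s. dens s x) has_real_derivative - Theta m (dens t) x) (at t)"
      using has_real_derivative_dens_time[OF t, of x] Theta_dens[OF t, of x] by simp
    \<comment> \<open>\<open>v\<close> has been identified with \<open>dens\<close> at positive
      times; they form an open set, which is enough for a derivative at \<open>t\<close>.\<close>
    then have "((\<lambda>s. v x s) has_real_derivative - Theta m (dens t) x) (at t)"
      by (rule has_field_derivative_transform_within_open[where S = "{0<..}"])
         (use t v in \<open>auto simp: fun_eq_iff\<close>)
    then show ?thesis unfolding v[OF t] .
  qed
  have part4: "set_integrable lborel {0..} (\<lambda>x. exp (- \<mu> * x) * Theta m (dens t) x)"
      "laplace_transform (Theta m (dens t)) \<mu>
        = ((\<mu> powr \<nu> + \<eta>) powr \<delta> - \<eta> powr \<delta>) * laplace_transform (dens t) \<mu>"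
    if t: "t > 0" and \<mu>: "\<mu> > 0" for t \<mu>
  proof -
    define C where "C = (\<integral>\<xi>. norm (phi t \<xi>) \<partial>lborel)"
    define C' where "C' = (\<integral>\<xi>. norm (- \<i> * of_real \<xi> * phi t \<xi>) \<partial>lborel)"
    have bd: "\<bar>dens t x\<bar> \<le> C" for x
      unfolding dens_def C_def by (rule abs_inverse_fourier_le[OF integrable_phi[OF t]])
    have C0: "C \<ge> 0" "C' \<ge> 0" by (simp_all add: C_def C'_def)
    \<comment> \<open>\<open>2 * C\<close> comes from the uniform bound and serves
      \<open>y \<ge> 1\<close>; \<open>C'\<close> bounds the space derivative and serves
      \<open>y < 1\<close>.\<close>
    have lip: "\<bar>dens t x - dens t (x - y)\<bar> \<le> (2 * C + C') * min 1 y" if y: "y > 0" for x y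
    proof -
      have "norm (dens t x - dens t (x - y)) \<le> C' * norm (x - (x - y))"
      proof (rule field_differentiable_bound[OF convex_UNIV])
        show "(dens t has_real_derivative inverse_fourier (\<lambda>\<xi>. - \<i> * of_real \<xi> * phi t \<xi>) z) (at z within UNIV)" for z
          by (rule has_real_derivative_dens_space[OF t])
        show "norm (inverse_fourier (\<lambda>\<xi>. - \<i> * of_real \<xi> * phi t \<xi>) z) \<le> C'" for z
          unfolding C'_def real_norm_def by (rule abs_inverse_fourier_le[OF integrable_dens_deriv[OF t]])
      qed auto
      then have 1: "\<bar>dens t x - dens t (x - y)\<bar> \<le> C' * y" using y by simp
      have 2: "\<bar>dens t x - dens t (x - y)\<bar> \<le> 2 * C" using bd[of x] bd[of "x - y"] by linarith
      have "0 \<le> C * y" using C0 y by simp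
      with 1 2 C0 show ?thesis by (cases "1 \<le> y") (simp_all add: ring_distribs)
    qed
    have meas: "dens t \<in> borel_measurable borel"
      unfolding dens_def by (rule borel_measurable_inverse_fourier[OF integrable_phi[OF t]])
    show "set_integrable lborel {0..} (\<lambda>x. exp (- \<mu> * x) * Theta m (dens t) x)"
      by (rule laplace_Theta(1)[OF meas dens0[OF t] bd lip \<mu>])
    show "laplace_transform (Theta m (dens t)) \<mu>
        = ((\<mu> powr \<nu> + \<eta>) powr \<delta> - \<eta> powr \<delta>) * laplace_transform (dens t) \<mu>"
      by (rule laplace_Theta(2)[OF meas dens0[OF t] bd lip \<mu>])
  qed
  show ?thesis
  proof (intro conjI allI impI ballI)
    fix t :: real assume t: "t > 0"
    show "is_continuous_pdf M (X t) (\<lambda>x. v x t)" "(\<lambda>x. v x t) \<in> half_line_C1"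
      unfolding v[OF t] by (rule pdf[OF t], rule C1[OF t])
    show "((\<lambda>s. v x s) has_real_derivative - Theta m (\<lambda>z. v z t) x) (at t)" for x
      by (rule part2[OF t])
    fix \<mu> :: real assume \<mu>: "\<mu> > 0"
    show "set_integrable lborel {0..} (\<lambda>x. exp (- \<mu> * x) * Theta m (\<lambda>z. v z t) x)"
      "laplace_transform (Theta m (\<lambda>z. v z t)) \<mu>
        = ((\<mu> powr \<nu> + \<eta>) powr \<delta> - \<eta> powr \<delta>) * laplace_transform (\<lambda>x. v x t) \<mu>"
      unfolding v[OF t] by (rule part4(1)[OF t \<mu>], rule part4(2)[OF t \<mu>])
  next
    fix f :: "real \<Rightarrow> real" and x :: real assume f: "f \<in> half_line_C1" and x: "x > 0"
    show "set_integrable m {0<..} (\<lambda>y. f x - f (x - y))"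
      by (rule Theta_eq_prabhakar_derivative(1)[OF f x])
    show "Theta m f x = prabhakar_derivative \<theta> \<nu> (\<nu> * \<delta>) (- \<eta>) \<delta> f x - \<eta> powr \<delta> * f x" if "\<theta> > 0" for \<theta>
      by (rule Theta_eq_prabhakar_derivative(2)[OF f x that])
  qed
qed

end
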